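(* Let $P$ be a compact (connected) Riemann surface, let $\tau: P\to P$ be an antiholomorphic involution, and let $f: P\to\hat{\mathbb{C}}=\mathbb{C}\cup\{\infty\}$ be a holomorphic map. Let $\Sigma(f)$ be the divisor of the preimage of the critical values of $f$ (as defined in the context). 1) Suppose $\tau$ has at least one fixed point. Then $f$ is equivalent to a real algebraic function on $(P,\tau)$, i.e. there exists $g\in \mathrm{Aut}(\hat{\mathbb{C}})$ such that $\overline{g(f(\tau(p)))}=g(f(p))$ for all $p\in P$, if and only if $\tau\Sigma(f)=\Sigma(f)$. 2) Suppose $\tau$ has no fixed points. Then $f$ is equivalent to a real or pseudoreal algebraic function on $(P,\tau)$, i.e. there exists $g\in \mathrm{Aut}(\hat{\mathbb{C}})$ such that either $\overline{g(f(\tau(p)))}=g(f(p))$ for all $p\in P$, or $\overline{g(f(\tau(p)))}=-\frac{1}{g(f(p))}$ for all $p\in P$, if and only if $\tau\Sigma(f)=\Sigma(f)$.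
   Context: A real algebraic curve is a pair $(P,\tau)$, where $P$ is a compact Riemann surface (the complex points of the curve) and $\tau:P\to P$ is an antiholomorphic involution (complex conjugation). The fixed points of $\tau$ are the real points of the curve. A complex algebraic function on $(P,\tau)$ is a holomorphic map $f:P\to\hat{\mathbb{C}}$. For $p\in P$, the number of ramification $\mathrm{ord}_p=\mathrm{ord}_p(f)$ is the positive integer $n$ such that $f$ has the form $z\mapsto z^{n}$ in suitable local holomorphic coordinates centered at $p$ and at $f(p)$. The set of critical points is $\Sigma_P=\{p\in P\mid \mathrm{ord}_p>1\}$; the set of critical values is $\Sigma_{\hat{\mathbb{C}}}=f(\Sigma_P)\subset\hat{\mathbb{C}}$; the preimage of the critical values is $\Sigma_{P\hat{\mathbb{C}}}=f^{-1}(\Sigma_{\hat{\mathbb{C}}})\subset P$. The divisor of the preimage of the critical values is $$\Sigma(f)=\sum_{p\in\Sigma_{P\hat{\mathbb{C}}}}\mathrm{ord}_p\, p .$$ (For constant $f$, put $\Sigma(f)=0$.) The involution acts on divisors by $\tau\left(\sum n_p\,p\right)=\sum n_p\,\tau(p)$. Two functions $f,\tilde f:P\to\hat{\mathbb{C}}$ are called equivalent if $\tilde f=g\circ f$ for some $g\in\mathrm{Aut}(\hat{\mathbb{C}})$, the group of holomorphic automorphisms (Möbius transformations) of $\hat{\mathbb{C}}$. A complex algebraic function $f$ on $(P,\tau)$ is called real if $\overline{f(\tau(p))}=f(p)$ for all $p\in P$, and pseudoreal if $\overline{f(\tau(p))}=-\frac{1}{f(p)}$ for all $p\in P$. Conventions: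 $\overline{\infty}=\infty$, $-1/0=\infty$, $-1/\infty=0$. *)

theory Defs
  imports "HOL-Complex_Analysis.Complex_Analysis" "HOL-Library.Poly_Mapping"
begin

section \<open>Riemann surfaces\<close>

text \<open>
  A chart is a pair of its domain and its coordinate function; values of the coordinate
  function outside the domain are irrelevant.
\<close>

type_synonym 'a chart = "'a set \<times> ('a \<Rightarrow> complex)"

record 'a surface =
  topo :: "'a topology"
  atlas :: "'a chart set"

abbreviation points :: "'a surface \<Rightarrow> 'a set"
  where "points P \<equiv> topspace (topo P)"

definition is_chart :: "'a topology \<Rightarrow> 'a chart \<Rightarrow> bool" where
  "is_chart X c \<longleftrightarrow> (case c of (U, \<phi>) \<Rightarrow>
     openin X U \<and> open (\<phi> ` U) \<and>
     homeomorphic_map (subtopology X U) (top_of_set (\<phi> ` U)) \<phi>)"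

definition transition_holomorphic :: "'a chart \<Rightarrow> 'a chart \<Rightarrow> bool" where
  "transition_holomorphic c d \<longleftrightarrow> (case c of (U, \<phi>) \<Rightarrow> case d of (V, \<psi>) \<Rightarrow>
     (\<lambda>z. \<psi> (inv_into U \<phi> z)) holomorphic_on \<phi> ` (U \<inter> V))"

definition compatible :: "'a chart \<Rightarrow> 'a chart \<Rightarrow> bool" where
  "compatible c d \<longleftrightarrow> transition_holomorphic c d \<and> transition_holomorphic d c"

text \<open>
  The atlas is not required to be maximal. Second countability is not required either:
  it is automatic for compact surfaces.
\<close>

definition riemann_surface :: "'a surface \<Rightarrow> bool" where
  "riemann_surface P \<longleftrightarrow>
     points P \<noteq> {} \<and> connected_space (topo P) \<and> Hausdorff_space (topo P) \<and>
     (\<forall>c\<in>atlas P. is_chart (topo P) c) \<and>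
     (\<Union>(U, \<phi>)\<in>atlas P. U) = points P \<and>
     (\<forall>c\<in>atlas P. \<forall>d\<in>atlas P. compatible c d)"

definition compact_riemann_surface :: "'a surface \<Rightarrow> bool" where
  "compact_riemann_surface P \<longleftrightarrow> riemann_surface P \<and> compact_space (topo P)"

definition holomorphic_map :: "'a surface \<Rightarrow> 'b surface \<Rightarrow> ('a \<Rightarrow> 'b) \<Rightarrow> bool" where
  "holomorphic_map P Q f \<longleftrightarrow> continuous_map (topo P) (topo Q) f \<and>
     (\<forall>(U, \<phi>)\<in>atlas P. \<forall>(V, \<psi>)\<in>atlas Q.
        (\<lambda>z. \<psi> (f (inv_into U \<phi> z))) holomorphic_on \<phi> ` {p \<in> U. f p \<in> V})"

definition antiholomorphic_map :: "'a surface \<Rightarrow> 'b surface \<Rightarrow> ('a \<Rightarrow> 'b) \<Rightarrow> bool" where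
  "antiholomorphic_map P Q f \<longleftrightarrow> continuous_map (topo P) (topo Q) f \<and>
     (\<forall>(U, \<phi>)\<in>atlas P. \<forall>(V, \<psi>)\<in>atlas Q.
        (\<lambda>z. cnj (\<psi> (f (inv_into U \<phi> z)))) holomorphic_on \<phi> ` {p \<in> U. f p \<in> V})"

definition antiholomorphic_involution :: "'a surface \<Rightarrow> ('a \<Rightarrow> 'a) \<Rightarrow> bool" where
  "antiholomorphic_involution P \<tau> \<longleftrightarrow>
     antiholomorphic_map P P \<tau> \<and> (\<forall>p\<in>points P. \<tau> (\<tau> p) = p)"

definition automorphisms :: "'a surface \<Rightarrow> ('a \<Rightarrow> 'a) set" where
  "automorphisms P = {g. holomorphic_map P P g \<and>
     (\<exists>h. holomorphic_map P P h \<and> (\<forall>p\<in>points P. h (g p) = p \<and> g (h p) = p))}"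


section \<open>The Riemann sphere\<close>

text \<open>The point \<open>None\<close> is infinity.\<close>

definition sphere_chart_at_infinity :: "complex option \<Rightarrow> complex" where
  "sphere_chart_at_infinity w = (case w of None \<Rightarrow> 0 | Some z \<Rightarrow> inverse z)"

abbreviation sphere_topology :: "complex option topology" where
  "sphere_topology \<equiv> Alexandroff_compactification euclidean"

definition riemann_sphere :: "complex option surface" where
  "riemann_sphere =
     \<lparr>topo = sphere_topology,
      atlas = {(UNIV - {None}, the), (UNIV - {Some 0}, sphere_chart_at_infinity)}\<rparr>"

definition sphere_cnj :: "complex option \<Rightarrow> complex option" where
  "sphere_cnj = map_option cnj"

definition sphere_neg_recip :: "complex option \<Rightarrow> complex option" where
  "sphere_neg_recip w =
     (case w of None \<Rightarrow> Some 0 | Some z \<Rightarrow> if z = 0 then None else Some (- 1 / z))"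


section \<open>Ramification and the divisor of the preimage of the critical values\<close>

definition local_coordinate :: "'a surface \<Rightarrow> 'a \<Rightarrow> 'a chart \<Rightarrow> bool" where
  "local_coordinate P p c \<longleftrightarrow>
     is_chart (topo P) c \<and> (\<forall>d\<in>atlas P. compatible c d) \<and>
     (case c of (U, \<phi>) \<Rightarrow> p \<in> U \<and> \<phi> p = 0)"

definition has_ramification ::
    "'a surface \<Rightarrow> 'b surface \<Rightarrow> ('a \<Rightarrow> 'b) \<Rightarrow> 'a \<Rightarrow> nat \<Rightarrow> bool" where
  "has_ramification P Q f p n \<longleftrightarrow> n > 0 \<and>
     (\<exists>U \<phi> V \<psi>. local_coordinate P p (U, \<phi>) \<and> local_coordinate Q (f p) (V, \<psi>) \<and>
        f ` U \<subseteq> V \<and> (\<forall>q\<in>U. \<psi> (f q) = \<phi> q ^ n))"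

text \<open>Only meaningful for nonconstant maps, which have a unique ramification number everywhere.\<close>

definition ramification :: "'a surface \<Rightarrow> 'b surface \<Rightarrow> ('a \<Rightarrow> 'b) \<Rightarrow> 'a \<Rightarrow> nat" where
  "ramification P Q f p = (THE n. has_ramification P Q f p n)"

definition critical_points :: "'a surface \<Rightarrow> 'b surface \<Rightarrow> ('a \<Rightarrow> 'b) \<Rightarrow> 'a set" where
  "critical_points P Q f = {p \<in> points P. ramification P Q f p > 1}"

definition critical_values :: "'a surface \<Rightarrow> 'b surface \<Rightarrow> ('a \<Rightarrow> 'b) \<Rightarrow> 'b set" where
  "critical_values P Q f = f ` critical_points P Q f"

definition critical_preimage :: "'a surface \<Rightarrow> 'b surface \<Rightarrow> ('a \<Rightarrow> 'b) \<Rightarrow> 'a set" where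
  "critical_preimage P Q f = {p \<in> points P. f p \<in> critical_values P Q f}"

text \<open>
  Divisors are elements of the free abelian group \<open>'a \<Rightarrow>\<^sub>0 int\<close>. The sum below ranges over a
  finite set whenever \<open>P\<close> is a compact Riemann surface and \<open>f\<close> is nonconstant and holomorphic.
\<close>

definition critical_divisor ::
    "'a surface \<Rightarrow> 'b surface \<Rightarrow> ('a \<Rightarrow> 'b) \<Rightarrow> ('a \<Rightarrow>\<^sub>0 int)" where
  "critical_divisor P Q f =
     (if f constant_on points P then 0
      else (\<Sum>p\<in>critical_preimage P Q f. frag_cmul (int (ramification P Q f p)) (frag_of p)))"

definition divisor_map :: "('a \<Rightarrow> 'a) \<Rightarrow> ('a \<Rightarrow>\<^sub>0 int) \<Rightarrow> ('a \<Rightarrow>\<^sub>0 int)" where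
  "divisor_map \<tau> = frag_extend (frag_of \<circ> \<tau>)"


section \<open>Real and pseudoreal functions\<close>

definition real_function ::
    "'a surface \<Rightarrow> ('a \<Rightarrow> 'a) \<Rightarrow> ('a \<Rightarrow> complex option) \<Rightarrow> bool" where
  "real_function P \<tau> f \<longleftrightarrow> (\<forall>p\<in>points P. sphere_cnj (f (\<tau> p)) = f p)"

definition pseudoreal_function ::
    "'a surface \<Rightarrow> ('a \<Rightarrow> 'a) \<Rightarrow> ('a \<Rightarrow> complex option) \<Rightarrow> bool" where
  "pseudoreal_function P \<tau> f \<longleftrightarrow>
     (\<forall>p\<in>points P. sphere_cnj (f (\<tau> p)) = sphere_neg_recip (f p))"


section \<open>The Riemann sphere is a compact Riemann surface\<close>

lemma openin_sphere_topology: "openin sphere_topology V \<longleftrightarrow>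
   open {z. Some z \<in> V} \<and> (None \<in> V \<longrightarrow> compact {z. Some z \<notin> V})"
proof
  assume "openin sphere_topology V"
  then show "open {z. Some z \<in> V} \<and> (None \<in> V \<longrightarrow> compact {z. Some z \<notin> V})"
    unfolding openin_Alexandroff_compactification
  proof (elim disjE exE conjE)
    fix U :: "complex set" assume "openin euclidean U" "V = Some ` U"
    moreover from this have "{z. Some z \<in> V} = U" by auto
    ultimately show ?thesis by auto
  next
    fix C :: "complex set" assume C: "compactin euclidean C" "closedin euclidean C"
      "V = insert None (Some ` (topspace euclidean - C))"
    then have "{z. Some z \<in> V} = - C" "{z. Some z \<notin> V} = C" by auto
    with C show ?thesis by (auto simp: open_Compl)
  qed
next
  assume r: "open {z. Some z \<in> V} \<and> (None \<in> V \<longrightarrow> compact {z. Some z \<notin> V})"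
  show "openin sphere_topology V"
  proof (cases "None \<in> V")
    case True
    have "V = insert None (Some ` (topspace euclidean - {z. Some z \<notin> V}))"
    proof (intro set_eqI)
      fix w show "w \<in> V \<longleftrightarrow> w \<in> insert None (Some ` (topspace euclidean - {z. Some z \<notin> V}))"
        using True by (cases w) auto
    qed
    with r True show ?thesis unfolding openin_Alexandroff_compactification
      by (metis closed_closedin compact_imp_closed compactin_euclidean_iff)
  next
    case False
    have "V = Some ` {z. Some z \<in> V}"
    proof (intro set_eqI)
      fix w show "w \<in> V \<longleftrightarrow> w \<in> Some ` {z. Some z \<in> V}"
        using False by (cases w) auto
    qed
    with r show ?thesis unfolding openin_Alexandroff_compactification
      by (metis open_openin)
  qed
qed

definition sphere_recip :: "complex option \<Rightarrow> complex option" where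
  "sphere_recip w = (case w of None \<Rightarrow> Some 0 | Some z \<Rightarrow>
     if z = 0 then None else Some (inverse z))"

lemma sphere_recip_sphere_recip [simp]: "sphere_recip (sphere_recip w) = w"
  by (auto simp: sphere_recip_def split: option.splits)

lemma continuous_map_sphere_recip: "continuous_map sphere_topology sphere_topology sphere_recip"
  unfolding continuous_map_def
proof (intro conjI allI impI)
  show "sphere_recip \<in> topspace sphere_topology \<rightarrow> topspace sphere_topology"
    by (auto simp: sphere_recip_def split: option.splits)
next
  fix V assume "openin sphere_topology V"
  then have V: "open {z. Some z \<in> V}" "None \<in> V \<Longrightarrow> compact {z. Some z \<notin> V}"
    by (auto simp: openin_sphere_topology)
  define S where "S = {z. Some z \<in> V}"
  have S: "open S" using V S_def by simp
  let ?W = "{x \<in> topspace sphere_topology. sphere_recip x \<in> V}"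
  have top: "topspace sphere_topology = UNIV" using UNIV_option_conv by (auto)
  define T where "T = {z. Some z \<in> ?W}"
  have T: "z \<in> T \<longleftrightarrow> (if z = 0 then None \<in> V else inverse z \<in> S)" for z
    by (auto simp: T_def S_def sphere_recip_def)
  have N: "None \<in> ?W \<longleftrightarrow> 0 \<in> S" by (auto simp: sphere_recip_def S_def top)
  have o: "open {z. z \<noteq> 0 \<and> inverse z \<in> S}"
  proof -
    have "open ((- {0}) \<inter> inverse -` S)"
      by (rule continuous_open_preimage) (auto intro!: continuous_intros S)
    also have "(- {0}) \<inter> inverse -` S = {z. z \<noteq> 0 \<and> inverse z \<in> S}" by auto
    finally show ?thesis .
  qed
  have oT: "open T"
  proof (cases "None \<in> V")
    case False
    then have "T = {z. z \<noteq> 0 \<and> inverse z \<in> S}" by (intro set_eqI) (simp add: T)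
    with o show ?thesis by simp
  next
    case True
    have "compact (-S)" using V(2)[OF True] by (simp add: S_def Compl_eq)
    then obtain B where B: "B > 0" "\<And>z. z \<notin> S \<Longrightarrow> norm z \<le> B"
      using compact_imp_bounded bounded_pos by (metis ComplI)
    have b: "inverse z \<in> S" if "z \<noteq> 0" "norm z < inverse B" for z
    proof (rule ccontr)
      assume "inverse z \<notin> S"
      then have "norm (inverse z) \<le> B" using B by blast
      moreover have "norm (inverse z) > B"
        using that B(1) by (simp add: norm_divide less_imp_inverse_less field_simps)
      ultimately show False by simp
    qed
    have "T = ball 0 (inverse B) \<union> {z. z \<noteq> 0 \<and> inverse z \<in> S}"
      by (intro set_eqI) (use T True b B(1) in auto)
    with o show ?thesis by auto
  qed
  moreover have "compact (-T)" if "0 \<in> S"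
  proof -
    obtain r where r: "r > 0" "ball 0 r \<subseteq> S" using S \<open>0 \<in> S\<close> open_contains_ball by blast
    have "norm z \<le> inverse r" if "z \<in> -T" for z
    proof (cases "z = 0")
      case False
      with that have "inverse z \<notin> ball 0 r" using T[of z] r(2) by auto
      then show ?thesis using r(1) False by (simp add: norm_divide field_simps)
    qed (use r in auto)
    then have "bounded (-T)" by (auto simp: bounded_iff)
    moreover have "closed (-T)" using oT by auto
    ultimately show ?thesis using compact_eq_bounded_closed by blast
  qed
  moreover have "{z. Some z \<notin> ?W} = - T" by (auto simp: T_def)
  ultimately show "openin sphere_topology ?W"
    unfolding openin_sphere_topology N T_def[symmetric] by simp
qed

lemma homeomorphic_map_sphere_recip: "homeomorphic_map sphere_topology sphere_topology sphere_recip"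
  by (intro homeomorphic_maps_imp_map[of _ _ _ sphere_recip])
    (simp add: homeomorphic_maps_def continuous_map_sphere_recip)

lemma homeomorphic_map_the:
  "homeomorphic_map (subtopology sphere_topology (UNIV - {None})) euclidean the"
proof -
  have "homeomorphic_map euclidean (subtopology sphere_topology (Some ` topspace euclidean))
      (Some :: complex \<Rightarrow> _)"
    using embedding_map_Some[of "euclidean :: complex topology"] by (simp add: embedding_map_def)
  then obtain g where g: "homeomorphic_maps (euclidean :: complex topology)
      (subtopology sphere_topology (range Some)) Some g"
    by (auto simp: homeomorphic_map_maps)
  have "homeomorphic_map (subtopology sphere_topology (range (Some :: complex \<Rightarrow> _))) euclidean g"
    using g homeomorphic_maps_sym homeomorphic_maps_imp_map by blast
  then have "homeomorphic_map (subtopology sphere_topology (range (Some :: complex \<Rightarrow> _))) euclidean the"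
    by (rule homeomorphic_map_eq) (use g in \<open>auto simp: homeomorphic_maps_def\<close>)
  moreover have "range (Some :: complex \<Rightarrow> _) = UNIV - {None}"
    by (simp add: UNIV_option_conv)
  ultimately show ?thesis by simp
qed

lemma sphere_chart_at_infinity_eq: "sphere_chart_at_infinity w = the (sphere_recip w)" if "w \<noteq> Some 0"
  using that by (auto simp: sphere_chart_at_infinity_def sphere_recip_def split: option.splits)

lemma homeomorphic_map_sphere_chart_at_infinity:
  "homeomorphic_map (subtopology sphere_topology (UNIV - {Some 0})) euclidean sphere_chart_at_infinity"
proof -
  have "sphere_recip ` (UNIV - {Some 0}) = UNIV - {None}"
  proof -
    have *: "sphere_recip w = None \<longleftrightarrow> w = Some 0" "sphere_recip w = Some 0 \<longleftrightarrow> w = None" for w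
      by (auto simp: sphere_recip_def split: option.splits)
    have "w \<in> sphere_recip ` (UNIV - {Some 0})" if "w \<noteq> None" for w
      by (rule image_eqI[of _ _ "sphere_recip w"]) (use that * in auto)
    moreover have "w \<noteq> None" if "w \<in> sphere_recip ` (UNIV - {Some 0})" for w
      using that * by blast
    ultimately show ?thesis by blast
  qed
  moreover have top: "topspace sphere_topology = UNIV" using UNIV_option_conv by auto
  ultimately have "homeomorphic_map (subtopology sphere_topology (UNIV - {Some 0}))
      (subtopology sphere_topology (UNIV - {None})) sphere_recip"
    by (intro homeomorphic_map_subtopologies[OF homeomorphic_map_sphere_recip]) auto
  then have "homeomorphic_map (subtopology sphere_topology (UNIV - {Some 0})) euclidean (the \<circ> sphere_recip)"
    using homeomorphic_map_the homeomorphic_map_compose by blast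
  then show ?thesis
    by (rule homeomorphic_map_eq)
      (metis DiffD2 IntD2 sphere_chart_at_infinity_eq comp_apply singletonI topspace_subtopology)
qed

lemma image_sphere_charts:
  "the ` (UNIV - {None}) = (UNIV::complex set)"
  "sphere_chart_at_infinity ` (UNIV - {Some 0}) = UNIV"
  using homeomorphic_imp_surjective_map[OF homeomorphic_map_the]
    homeomorphic_imp_surjective_map[OF homeomorphic_map_sphere_chart_at_infinity]
  by (auto simp: UNIV_option_conv[symmetric])

lemma inj_on_sphere_charts:
  "inj_on the (UNIV - {None :: complex option})"
  "inj_on sphere_chart_at_infinity (UNIV - {Some 0})"
  by (auto simp: inj_on_def sphere_chart_at_infinity_def split: option.splits)

lemma inv_into_the: "inv_into (UNIV - {None}) the z = Some (z::complex)"
  by (rule inv_into_f_eq[OF inj_on_sphere_charts(1)]) auto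

lemma inv_into_sphere_chart_at_infinity:
  "inv_into (UNIV - {Some 0}) sphere_chart_at_infinity z =
    (if z = 0 then None else Some (inverse z))"
  by (rule inv_into_f_eq[OF inj_on_sphere_charts(2)]) (auto simp: sphere_chart_at_infinity_def)

theorem compact_riemann_surface_riemann_sphere:
  "compact_riemann_surface riemann_sphere"
proof -
  have top: "topspace sphere_topology = UNIV" using UNIV_option_conv by auto
  have "sphere_topology closure_of range Some = topspace sphere_topology"
    using Alexandroff_compactification_dense[of "euclidean :: complex topology"]
      by (simp add: compact_space_def)
  moreover have "connectedin sphere_topology (sphere_topology closure_of range Some)"
    by (intro connectedin_closure_of connectedin_continuous_map_image[OF continuous_map_Some]) auto
  ultimately have conn: "connected_space sphere_topology" by (metis connectedin_topspace)
  have haus: "Hausdorff_space sphere_topology"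
    by (simp add: Hausdorff_space_Alexandroff_compactification locally_compact_space_euclidean)
  have op: "openin sphere_topology (UNIV - {w})" for w
    using haus top by (metis Hausdorff_imp_t1_space UNIV_I openin_topspace t1_space_openin_delete_alt)
  have id: "(\<lambda>z::complex. sphere_chart_at_infinity (if z = 0 then None else Some (inverse z)))
      holomorphic_on X" for X
    by (rule holomorphic_transform[of "\<lambda>z. z"]) (auto simp: sphere_chart_at_infinity_def)
  have inv: "(\<lambda>z::complex. the (if z = 0 then None else Some (inverse z))) holomorphic_on X"
    if "0 \<notin> X" for X
    by (rule holomorphic_transform[of inverse]) (use that in \<open>auto intro!: holomorphic_intros\<close>)
  have inv': "(\<lambda>z::complex. sphere_chart_at_infinity (Some z)) holomorphic_on X"
    if "0 \<notin> X" for X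
    unfolding sphere_chart_at_infinity_def option.case
    using that by (auto intro!: holomorphic_intros)
  have z: "0 \<notin> the ` ((UNIV - {None}) \<inter> (UNIV - {Some (0::complex)}))"
     "0 \<notin> sphere_chart_at_infinity ` ((UNIV - {Some 0}) \<inter> (UNIV - {None}))"
    by (auto simp: sphere_chart_at_infinity_def split: option.splits)
  have 1: "transition_holomorphic c d"
    if "c \<in> atlas riemann_sphere" "d \<in> atlas riemann_sphere" for c d
    using that id inv[OF z(2)] inv'[OF z(1)]
    unfolding riemann_sphere_def transition_holomorphic_def surface.simps insert_iff empty_iff simp_thms
    by (elim disjE)
      (simp_all only: prod.case inv_into_the inv_into_sphere_chart_at_infinity option.sel holomorphic_on_ident)
  have 2: "is_chart sphere_topology (UNIV - {None}, the)"
      "is_chart sphere_topology (UNIV - {Some 0}, sphere_chart_at_infinity)"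
    unfolding is_chart_def prod.case image_sphere_charts
    using op homeomorphic_map_the homeomorphic_map_sphere_chart_at_infinity by auto
  have 3: "(\<Union>(U, \<phi>)\<in>atlas riemann_sphere. U) = points riemann_sphere"
    unfolding riemann_sphere_def surface.simps top by auto
  show ?thesis unfolding compact_riemann_surface_def riemann_surface_def compatible_def
    using 1 2 3 conn haus top by (simp add: riemann_sphere_def)
qed

end

theory Submission
  imports Defs
begin

text \<open>
  Put \<open>h = cnj \<circ> f \<circ> \<tau>\<close>. If the divisor is invariant, then \<open>f\<close> and \<open>h\<close> have the same ramification
  numbers and the same preimage \<open>S\<close> of the critical values, and the claim is that \<open>h = \<psi> \<circ> f\<close>: then
  \<open>cnj \<circ> \<psi>\<close> is an antiholomorphic involution of the sphere, hence conjugate to \<open>z \<mapsto> cnj z\<close> if it has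
  a fixed point and to \<open>z \<mapsto> - 1 / cnj z\<close> otherwise, and the conjugating map makes \<open>f\<close> real or
  pseudoreal. A fixed point of \<open>\<tau>\<close> excludes the second case.

  If \<open>h\<close> is a function of \<open>f\<close> near every point, then the local functions continue analytically
  over the simply connected plane, which yields \<open>\<psi>\<close>; only the points of \<open>S\<close> are at issue. Outside
  \<open>S\<close> both maps are coverings of the complements of their critical values. If there are at least three
  critical values, the Kobayashi metrics of these complements are finite, and lifting shows that their
  pullbacks to the complement of \<open>S\<close> coincide; for the two critical values \<open>0\<close> and \<open>\<infinity>\<close> the same
  holds for the metric \<open>\<bar>dz\<bar> / \<bar>z\<bar>\<close>, by the maximum principle. Near \<open>p \<in> S\<close> the deck rotations of
  \<open>f\<close> and \<open>h\<close> preserve this common metric. The quotient of two such rotations is tangent to the identity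
  and preserves the metric; following an orbit in a Fatou coordinate shows that it is the identity. So
  the two rotations agree, and \<open>h\<close> is a function of \<open>f\<close> near \<open>p\<close>.
\<close>

section \<open>Invariant densities of germs tangent to the identity\<close>

text \<open>The obstacle lies at the points of \<open>S\<close>: near such a point \<open>f\<close>
  and \<open>h\<close> are branched coverings of the same degree, but nothing relates their deck
  groups, since a common domain does not make one covering a function of the other. The intrinsic
  metrics of the targets supply the relation. Little is asked of them: the reciprocal density
  \<open>m\<close>, a function on the target of \<open>f\<close>, must be bounded below by a
  multiple of the distance to the critical value. Affine maps provide this for the Kobayashi metric,
  and for \<open>m = norm\<close> it is trivial, so no asymptotics of the metric at the puncture
  enter. Continuation runs over the plane, not the sphere, so only points with finite value of
  \<open>f\<close> have to be treated locally. Therefore an automorphism first moves a critical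
  value to infinity and a second one, if there is one, to 0. With at most one critical value all
  finite points are then unramified; otherwise 0 and infinity are critical, and a third critical
  value separates the Kobayashi case from the metric with density 1 / norm z. Poles follow from the
  finite points because \<open>f\<close> is open.\<close>

lemma inverse_power_quotient_tendsto:
  "((\<lambda>y::complex. (1 / (1 + y) ^ k - 1) / y) \<longlongrightarrow> - of_nat k) (at 0)"
proof -
  have "((\<lambda>y::complex. 1 / (1 + y) ^ k) has_field_derivative - of_nat k) (at 0)"
    by (cases k) (auto intro!: derivative_eq_intros)
  then show ?thesis by (simp add: DERIV_def)
qed

text \<open>
  In the Fatou coordinate \<open>1 / z ^ j\<close> of \<open>T z = z + z ^ (j + 1) * g z\<close>, the map \<open>T\<close> is almost the
  translation by \<open>a = - j * g 0\<close>, and an orbit escapes linearly to infinity. The density expressed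
  in this coordinate changes along the orbit by factors \<open>1 + o(1 / n)\<close>, whereas the lower bound
  forces it to grow linearly.
\<close>

lemma invariant_density_tangent_identity:
  fixes T :: "complex \<Rightarrow> complex" and \<mu> :: "complex \<Rightarrow> real"
  assumes holT: "T holomorphic_on ball 0 r" and T0: "T 0 = 0" and T1: "deriv T 0 = 1"
    and c: "c > 0" and low: "\<And>z. z \<in> ball 0 r - {0} \<Longrightarrow> c * norm z \<le> \<mu> z"
    and inv: "\<And>z. z \<in> ball 0 r - {0} \<Longrightarrow> T z \<in> ball 0 r - {0} \<Longrightarrow> \<mu> (T z) = norm (deriv T z) * \<mu> z"
    and z: "z \<in> ball 0 r"
  shows "T z = z"
proof (rule ccontr)
  assume ne: "T z \<noteq> z"
  have r: "r > 0" using z by (auto intro: le_less_trans[OF norm_ge_zero])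
  have nc: "\<not> (\<lambda>w. T w - w) constant_on ball 0 r"
  proof
    assume "(\<lambda>w. T w - w) constant_on ball 0 r"
    then obtain k where "\<And>w. w \<in> ball 0 r \<Longrightarrow> T w - w = k" unfolding constant_on_def by blast
    from this[of 0] this[of z] show False using ne T0 z r by auto
  qed
  have hD: "(\<lambda>w. T w - w) holomorphic_on ball 0 r"
    by (intro holomorphic_intros holT)
  have in0: "0 \<in> ball (0::complex) r" and D0: "T 0 - 0 = 0" using r T0 by auto
  \<comment> \<open>\<open>n\<close> is the order of vanishing of \<open>T w - w\<close>. It is at
    least 2 because \<open>deriv T 0 = 1\<close>, and \<open>n - 1\<close> is the exponent of the
    Fatou coordinate.\<close>
  obtain g s n where n: "0 < n" and s: "0 < s" "ball (0::complex) s \<subseteq> ball 0 r"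
      and holg: "g holomorphic_on ball 0 s"
      and eq0: "\<And>w. w \<in> ball 0 s \<Longrightarrow> T w - w = (w - 0) ^ n * g w"
      and g0: "\<And>w. w \<in> ball 0 s \<Longrightarrow> g w \<noteq> 0"
    by (rule holomorphic_factor_zero_nonconstant[OF hD open_ball connected_ball in0 D0 nc]) (rule that)
  have eq: "T w = w + w ^ n * g w" if "w \<in> ball 0 s" for w using eq0[OF that] by (simp add: algebra_simps)
  have dg: "(g has_field_derivative deriv g w) (at w)" if "w \<in> ball 0 s" for w
    using holg that holomorphic_derivI open_ball by blast
  have dT: "deriv T w = 1 + (of_nat n * w ^ (n - 1) * g w + w ^ n * deriv g w)" if "w \<in> ball 0 s" for w
  proof -
    have "((\<lambda>w. w + w ^ n * g w) has_field_derivative 1 + (of_nat n * w ^ (n - 1) * g w + w ^ n * deriv g w)) (at w)"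
      using dg[OF that] by (auto intro!: derivative_eq_intros simp: n)
    then have "(T has_field_derivative 1 + (of_nat n * w ^ (n - 1) * g w + w ^ n * deriv g w)) (at w)"
      by (rule has_field_derivative_transform_within_open[where S="ball 0 s"]) (use that eq in auto)
    then show ?thesis by (rule DERIV_imp_deriv)
  qed
  have "n \<noteq> 1"
  proof
    assume "n = 1"
    then show False using dT[of 0] T1 g0[of 0] s by auto
  qed
  then obtain j where j: "n = Suc j" "j > 0" using n by (cases n) auto
  define x where "x w = w ^ j * g w" for w
  have Tx: "T w = w * (1 + x w)" if "w \<in> ball 0 s" for w
    using eq[OF that] by (simp add: j x_def algebra_simps)
  have gl: "(g \<longlongrightarrow> g 0) (at 0)"
    by (metis DERIV_isCont centre_in_ball continuous_within dg s(1))
  have "continuous_on (ball 0 s) (deriv g)"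
    by (intro holomorphic_on_imp_continuous_on holomorphic_deriv holg) auto
  then have "isCont (deriv g) 0" using s by (simp add: continuous_on_eq_continuous_at)
  then have dgl: "(deriv g \<longlongrightarrow> deriv g 0) (at 0)" by (simp add: isCont_def)
  have xl: "(x \<longlongrightarrow> 0) (at 0)" unfolding x_def using j by (auto intro!: tendsto_eq_intros gl)
  have ev: "\<forall>\<^sub>F w in at 0. w \<in> ball 0 s - {0}" using s by (intro eventually_at_in_open) auto
  have xl': "filterlim x (at 0) (at 0)"
    using xl by (rule filterlim_atI) (use ev in eventually_elim, use g0 in \<open>auto simp: x_def\<close>)
  \<comment> \<open>For \<open>k = j\<close> the quotient is the increment of
    \<open>1 / w ^ j\<close> under \<open>T\<close>, with limit \<open>a\<close>; for
    \<open>k = n\<close> it enters the derivative \<open>lam\<close>.\<close>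
  have q: "((\<lambda>w. (1 / (1 + x w) ^ k - 1) / w ^ j) \<longlongrightarrow> - of_nat k * g 0) (at 0)" for k
  proof -
    have "((\<lambda>w. (1 / (1 + x w) ^ k - 1) / x w * g w) \<longlongrightarrow> - of_nat k * g 0) (at 0)"
      by (intro tendsto_mult gl filterlim_compose[OF inverse_power_quotient_tendsto xl'])
    then show ?thesis
      by (rule Lim_transform_eventually) (use ev in eventually_elim, use g0 in \<open>auto simp: x_def\<close>)
  qed
  define a where "a = - of_nat j * g 0"
  have a: "a \<noteq> 0" using g0[of 0] s j by (simp add: a_def)
  \<comment> \<open>The derivative of \<open>T\<close> in the coordinate \<open>1 / w ^ j\<close>.
    It differs from 1 by less than the order of \<open>w ^ j\<close>, because the two terms with
    \<open>of_nat n * g 0\<close> cancel in the limit.\<close>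
  define lam where "lam w = deriv T w / (1 + x w) ^ n" for w
  have lam: "((\<lambda>w. (lam w - 1) / w ^ j) \<longlongrightarrow> 0) (at 0)"
  proof -
    have "((\<lambda>w. (1 / (1 + x w) ^ n - 1) / w ^ j + (of_nat n * g w + w * deriv g w) / (1 + x w) ^ n) \<longlongrightarrow> - of_nat n * g 0 + (of_nat n * g 0 + 0 * deriv g 0) / (1 + 0) ^ n) (at 0)"
      by (intro tendsto_intros q gl xl dgl) auto
    then have *: "((\<lambda>w. (1 / (1 + x w) ^ n - 1) / w ^ j + (of_nat n * g w + w * deriv g w) / (1 + x w) ^ n) \<longlongrightarrow> 0) (at 0)" by simp
    have "(1 / (1 + x w) ^ n - 1) / w ^ j + (of_nat n * g w + w * deriv g w) / (1 + x w) ^ n = (lam w - 1) / w ^ j"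
      if w: "w \<in> ball 0 s - {0}" for w
    proof -
      have "lam w = (1 + w ^ j * (of_nat n * g w + w * deriv g w)) / (1 + x w) ^ n"
        using dT[of w] w by (simp add: lam_def j algebra_simps)
      then show ?thesis using w by (simp add: diff_divide_distrib add_divide_distrib)
    qed
    then show ?thesis
      by (intro Lim_transform_eventually[OF *] eventually_mono[OF ev])
  qed
  have "\<forall>\<^sub>F w in at 0. norm ((1 / (1 + x w) ^ j - 1) / w ^ j - a) < norm a / 2"
    using tendstoD[OF q[of j], of "norm a / 2"] a by (simp add: a_def dist_norm)
  moreover have "\<forall>\<^sub>F w in at 0. norm ((lam w - 1) / w ^ j) < norm a / 6"
    using tendstoD[OF lam, of "norm a / 6"] a by simp
  moreover have "\<forall>\<^sub>F w in at 0. norm (x w) < 1"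
    using tendstoD[OF xl, of 1] by simp
  ultimately have "\<forall>\<^sub>F w in at 0. w \<in> ball 0 s - {0} \<and> norm ((1 / (1 + x w) ^ j - 1) / w ^ j - a) < norm a / 2
     \<and> norm ((lam w - 1) / w ^ j) < norm a / 6 \<and> norm (x w) < 1"
    using ev by eventually_elim auto
  \<comment> \<open>The thresholds: \<open>norm a / 2\<close> keeps the orbit in a sector around the
    ray through \<open>a\<close>, and \<open>norm a / 6\<close> leads to the factor
    \<open>1 + 1 / (3 * (N + k))\<close> per step.\<close>
  then obtain d where d: "d > 0" and D: "\<And>w. w \<noteq> 0 \<Longrightarrow> norm w < d \<Longrightarrow> w \<in> ball 0 s - {0} \<and> norm ((1 / (1 + x w) ^ j - 1) / w ^ j - a) < norm a / 2
     \<and> norm ((lam w - 1) / w ^ j) < norm a / 6 \<and> norm (x w) < 1"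
    unfolding eventually_at by (auto simp: dist_norm)
  \<comment> \<open>The first summand forces points with coordinate near \<open>(N + k) * a\<close>
    into the ball of radius \<open>d\<close>; the second gives \<open>N > 1\<close>, used when the
    step factor is squared.\<close>
  define N where "N = 2 / (norm a * d ^ j) + 1"
  have N: "N > 2 / (norm a * d ^ j)" "N > 0" "N > 1" using a d by (auto simp: N_def add_pos_pos)
  \<comment> \<open>A root chosen so that the coordinate of the starting point is exactly
    \<open>N * a\<close>.\<close>
  define z0 where "z0 = exp (- Ln (of_real N * a) / of_nat j)"
  have z0: "1 / z0 ^ j = of_real N * a"
  proof -
    have "z0 ^ j = exp (- Ln (of_real N * a))" unfolding z0_def
      using j by (simp add: exp_of_nat_mult[symmetric])
    also have "\<dots> = inverse (of_real N * a)" using a N by (simp add: exp_minus)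
    finally show ?thesis by (simp add: inverse_eq_divide)
  qed
  define zs where "zs k = (T ^^ k) z0" for k
  have small: "norm w < d \<and> norm w ^ j \<le> 2 / (norm a * (N + k)) \<and> norm a * (N + k) / 2 \<le> 1 / norm w ^ j"
    if "w \<noteq> 0" "norm (1 / w ^ j - of_real (N + of_nat k) * a) \<le> of_nat k * norm a / 2" for w k
  proof -
    have "norm (of_real (N + of_nat k) * a) = (N + k) * norm a" using N by (simp add: norm_mult del: of_real_add)
    then have "(N + k) * norm a - of_nat k * norm a / 2 \<le> norm (1 / w ^ j)"
      using that(2) norm_triangle_ineq2[of "of_real (N + of_nat k) * a" "1 / w ^ j"] by (simp add: norm_minus_commute)
    moreover have "norm a * (N + k) / 2 \<le> (N + k) * norm a - of_nat k * norm a / 2"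
      using mult_pos_pos[of N "norm a"] N a by (simp add: algebra_simps add_divide_distrib)
    ultimately have 1: "norm a * (N + k) / 2 \<le> 1 / norm w ^ j" unfolding norm_divide norm_power norm_one by linarith
    have pos: "norm a * (N + k) > 0" using a N by auto
    have w: "norm w ^ j > 0" using that by simp
    have 2: "norm w ^ j \<le> 2 / (norm a * (N + k))" using 1 pos w by (simp add: field_simps)
    have "2 / (norm a * d ^ j) < N + k" using N by auto
    then have "2 / (norm a * (N + k)) < d ^ j" using pos a d N by (simp add: field_simps)
    then have "norm w ^ j < d ^ j" using 2 by simp
    then have "norm w < d" using d by (simp add: power_less_imp_less_base)
    then show ?thesis using 1 2 by simp
  qed
  \<comment> \<open>Each step adds \<open>a\<close> to the coordinate up to an error of
    \<open>norm a / 2\<close>, and \<open>small\<close> then keeps the next point within the range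
    of the estimates.\<close>
  have orbit: "zs k \<noteq> 0 \<and> norm (1 / zs k ^ j - of_real (N + of_nat k) * a) \<le> of_nat k * norm a / 2" for k
  proof (induction k)
    case 0
    then show ?case using z0 by (auto simp: zs_def z0_def)
  next
    case (Suc k)
    define w where "w = zs k"
    have w: "w \<noteq> 0" "norm w < d" using Suc small unfolding w_def by blast+
    note Dw = D[OF w]
    have Tw: "zs (Suc k) = w * (1 + x w)" using Tx Dw by (simp add: zs_def w_def)
    have x1: "1 + x w \<noteq> 0" using Dw by (metis add.commute add_eq_0_iff norm_minus_cancel norm_one order_less_irrefl)
    define e where "e = (1 / (1 + x w) ^ j - 1) / w ^ j"
    have "1 / zs (Suc k) ^ j = 1 / w ^ j + e" unfolding Tw e_def power_mult_distrib
      by (simp add: diff_divide_distrib mult.commute)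
    then have "1 / zs (Suc k) ^ j - of_real (N + of_nat (Suc k)) * a = (1 / w ^ j - of_real (N + of_nat k) * a) + (e - a)"
      by (simp add: algebra_simps)
    moreover have "norm (e - a) \<le> norm a / 2" using Dw by (simp add: e_def)
    ultimately have "norm (1 / zs (Suc k) ^ j - of_real (N + of_nat (Suc k)) * a) \<le> of_nat k * norm a / 2 + norm a / 2"
      using Suc by (metis (no_types, lifting) add_mono norm_triangle_le w_def)
    moreover have "zs (Suc k) \<noteq> 0" using Tw w x1 by simp
    ultimately show ?case by (simp add: field_simps)
  qed
  \<comment> \<open>Up to the factor \<open>j\<close> this is \<mu> in the coordinate
    \<open>1 / z ^ j\<close>. It transforms like a tangent vector, so a step multiplies it by
    \<open>norm (lam w)\<close>.\<close>
  define v where "v k = \<mu> (zs k) / norm (zs k) ^ n" for k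
  have vlow: "c * norm a * (N + k) / 2 \<le> v k" for k
  proof -
    have zk: "zs k \<noteq> 0" "norm (zs k) < d" and b: "norm a * (N + k) / 2 \<le> 1 / norm (zs k) ^ j"
      using orbit[of k] small by blast+
    have "c * norm (zs k) \<le> \<mu> (zs k)" using D[OF zk] s low by blast
    then have "c * norm (zs k) / norm (zs k) ^ n \<le> v k" unfolding v_def by (intro divide_right_mono) auto
    moreover have "c * norm (zs k) / norm (zs k) ^ n = c * (1 / norm (zs k) ^ j)" using zk by (simp add: j)
    moreover have "c * (norm a * (N + k) / 2) \<le> c * (1 / norm (zs k) ^ j)" using b c by (intro mult_left_mono) auto
    ultimately have "c * (norm a * (N + k) / 2) \<le> v k" by linarith
    then show ?thesis by (simp add: mult.assoc)
  qed
  have vpos: "v k > 0" for k using vlow[of k] a c N by (smt (verit) mult_pos_pos of_nat_0_le_iff zero_less_norm_iff divide_pos_pos)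
  have vstep: "v (Suc k) \<le> v k * (1 + 1 / (3 * (N + k)))" for k
  proof -
    define w where "w = zs k"
    have w: "w \<noteq> 0" "norm w < d" and b: "norm w ^ j \<le> 2 / (norm a * (N + k))"
      using orbit[of k] small unfolding w_def by blast+
    have w': "zs (Suc k) \<noteq> 0" "norm (zs (Suc k)) < d" using orbit[of "Suc k"] small by blast+
    note Dw = D[OF w]
    have Tw: "zs (Suc k) = T w" by (simp add: zs_def w_def)
    have Tw': "T w = w * (1 + x w)" using Tx Dw by simp
    have x1: "1 + x w \<noteq> 0" using w' Tw Tw' by auto
    have "\<mu> (T w) = norm (deriv T w) * \<mu> w" using D[OF w'] Dw s unfolding Tw by (intro inv) blast+
    then have "v (Suc k) = v k * norm (lam w)" unfolding v_def Tw
      unfolding lam_def w_def[symmetric] norm_divide norm_power by (simp add: Tw' norm_mult power_mult_distrib)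
    moreover have "norm (lam w) \<le> 1 + 1 / (3 * (N + k))"
    proof -
      have "norm (lam w - 1) \<le> norm a / 6 * norm w ^ j"
        using Dw w by (auto simp: norm_divide norm_power field_simps)
      also have "\<dots> \<le> norm a / 6 * (2 / (norm a * (N + k)))" using b by (intro mult_left_mono) auto
      also have "\<dots> = 1 / (3 * (N + k))" using a by (simp add: divide_simps)
      finally show ?thesis using norm_triangle_ineq2[of "lam w" 1] by simp
    qed
    ultimately show ?thesis using vpos[of k] by (simp add: mult_left_mono)
  qed
  \<comment> \<open>The step factors multiply to a growth of order at most
    \<open>(N + k) powr (1 / 3)\<close>, so this quotient does not increase, whereas
    \<open>vlow\<close> makes it grow at least linearly.\<close>
  define y where "y k = v k ^ 2 / (N + of_nat k)" for k
  have ystep: "y (Suc k) \<le> y k" for k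
  proof -
    define M where "M = N + of_nat k"
    have M: "M > 1" using N by (simp add: M_def)
    have "v (Suc k) ^ 2 \<le> (v k * (1 + 1 / (3 * M))) ^ 2" using vstep[of k] vpos[of "Suc k"] by (intro power_mono) (auto simp: M_def)
    also have "\<dots> = v k ^ 2 * (1 + 1 / (3 * M)) ^ 2" by (simp add: power_mult_distrib)
    also have "(1 + 1 / (3 * M)) ^ 2 \<le> (M + 1) / M"
      using M by (simp add: power2_eq_square divide_simps) (simp add: algebra_simps)
    finally have "v (Suc k) ^ 2 \<le> v k ^ 2 * ((M + 1) / M)" by (simp add: mult_left_mono)
    then have "v (Suc k) ^ 2 / (M + 1) \<le> v k ^ 2 / M" using M by (simp add: field_simps)
    then show ?thesis by (simp add: y_def M_def algebra_simps)
  qed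
  have ybound: "y k \<le> y 0" for k by (induction k) (use ystep order_trans in blast)+
  define C where "C = (c * norm a / 2) ^ 2"
  have C: "C > 0" using c a by (simp add: C_def)
  have "C * k \<le> y 0" for k :: nat
  proof -
    have M: "N + of_nat k > 0" using N by simp
    have "(c * norm a * (N + k) / 2) ^ 2 \<le> v k ^ 2" using vlow[of k] c a N by (intro power_mono) auto
    then have "(c * norm a * (N + k) / 2) ^ 2 / (N + k) \<le> y k" unfolding y_def using M by (intro divide_right_mono) auto
    moreover have "(c * norm a * (N + k) / 2) ^ 2 / (N + k) = C * (N + k)"
      unfolding C_def using M by (simp add: power2_eq_square field_simps)
    moreover have "C * k \<le> C * (N + k)" using C N by simp
    ultimately show ?thesis using ybound[of k] by simp
  qed
  moreover obtain k :: nat where "y 0 / C < k" using reals_Archimedean2 by blast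
  ultimately show False using C by (smt (verit) pos_divide_less_eq mult.commute)
qed

text \<open>Away from 0, such a branch of the root turns a function of \<open>z ^ m\<close> into a
  function of \<open>z\<close>.\<close>

lemma local_power_root:
  fixes z0 :: complex
  assumes "z0 \<noteq> 0" "m > 0"
  obtains \<rho> A where "open A" "z0 ^ m \<in> A" "\<rho> holomorphic_on A" "\<rho> (z0 ^ m) = z0"
    "\<And>t. t \<in> A \<Longrightarrow> \<rho> t ^ m = t"
proof
  define t0 where "t0 = z0 ^ m"
  have t0: "t0 \<noteq> 0" using assms by (simp add: t0_def)
  define \<rho> where "\<rho> t = z0 * exp (Ln (t / t0) / of_nat m)" for t
  \<comment> \<open>On this ball \<open>t / t0\<close> stays within distance 1 of 1, hence in the
    right half plane, away from the cut of \<open>Ln\<close>.\<close>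
  define A where "A = ball t0 (norm t0)"
  have np: "t / t0 \<notin> \<real>\<^sub>\<le>\<^sub>0" "t \<noteq> 0" if "t \<in> A" for t
  proof -
    have "norm (t / t0 - 1) = norm (t - t0) / norm t0"
      using t0 by (simp add: diff_divide_distrib flip: norm_divide)
    then have "norm (t / t0 - 1) < 1"
      using that t0 by (simp add: A_def dist_norm norm_minus_commute)
    then have "Re (t / t0) > 0" using abs_Re_le_cmod[of "t / t0 - 1"] by simp
    then show "t / t0 \<notin> \<real>\<^sub>\<le>\<^sub>0" by (auto simp: complex_nonpos_Reals_iff)
    then show "t \<noteq> 0" by auto
  qed
  show "open A" by (simp add: A_def)
  show "z0 ^ m \<in> A" using t0 by (simp add: A_def t0_def)
  show "\<rho> holomorphic_on A" unfolding \<rho>_def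
    by (intro holomorphic_intros) (use np t0 in auto)
  show "\<rho> (z0 ^ m) = z0" using t0 by (simp add: \<rho>_def t0_def)
  show "\<rho> t ^ m = t" if "t \<in> A" for t
  proof -
    have "exp (Ln (t / t0) / of_nat m) ^ m = t / t0"
      using assms np[OF that] t0 by (simp add: exp_of_nat_mult[symmetric])
    then show ?thesis using t0 by (simp add: \<rho>_def power_mult_distrib t0_def)
  qed
qed

section \<open>Continuation of local sections over the plane\<close>

text \<open>
  The members \<open>(V, u)\<close> of the family are the local sections of a covering of the plane whose
  fibre over \<open>t\<close> consists of the values at \<open>t\<close>. The set of values carries no topology.
\<close>

locale local_sections =
  fixes F :: "(complex set \<times> (complex \<Rightarrow> 'x)) set"
  assumes agree: "(V, u) \<in> F \<Longrightarrow> (V', u') \<in> F \<Longrightarrow> t \<in> V \<inter> V' \<Longrightarrow> u t = u' t \<Longrightarrow>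
      t' \<in> V \<inter> V' \<Longrightarrow> u t' = u' t'"
    and ext: "\<exists>W. open W \<and> t0 \<in> W \<and>
      (\<forall>t\<in>W. \<forall>V u. (V, u) \<in> F \<longrightarrow> t \<in> V \<longrightarrow> (\<exists>V' u'. (V', u') \<in> F \<and> W \<subseteq> V' \<and> u' t = u t))"
begin

text \<open>Agreement with a member of \<open>F\<close> is demanded only on
  \<open>A \<inter> W\<close>, so that sections over closed rectangles make sense and can be glued
  along an edge.\<close>

definition section_on :: "complex set \<Rightarrow> (complex \<Rightarrow> 'x) \<Rightarrow> bool" where
  "section_on A s \<longleftrightarrow>
     (\<forall>t\<in>A. \<exists>V u W. (V, u) \<in> F \<and> open W \<and> t \<in> W \<and> W \<subseteq> V \<and> (\<forall>t'\<in>A \<inter> W. s t' = u t'))"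

text \<open>The condition covers every value at every point of \<open>A\<close>, so that an
  extension can be handed on from one piece to the next.\<close>

definition extendable_on :: "complex set \<Rightarrow> bool" where
  "extendable_on A \<longleftrightarrow> (\<forall>t\<in>A. \<forall>V u. (V, u) \<in> F \<longrightarrow> t \<in> V \<longrightarrow> (\<exists>s. section_on A s \<and> s t = u t))"

lemma section_onE:
  assumes "section_on A s" and "t \<in> A"
  obtains V u W where "(V, u) \<in> F" "open W" "t \<in> W" "W \<subseteq> V" "\<And>t'. t' \<in> A \<Longrightarrow> t' \<in> W \<Longrightarrow> s t' = u t'"
  using assms unfolding section_on_def by blast

lemma extendable_onI:
  assumes "\<And>t V u. t \<in> A \<Longrightarrow> (V, u) \<in> F \<Longrightarrow> t \<in> V \<Longrightarrow> \<exists>s. section_on A s \<and> s t = u t"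
  shows "extendable_on A"
  using assms by (auto simp: extendable_on_def)

lemma section_on_subset: "section_on A s \<Longrightarrow> B \<subseteq> A \<Longrightarrow> section_on B s"
  unfolding section_on_def by (intro ballI) (drule bspec, erule (1) subsetD, elim exE conjE, intro exI conjI, assumption+, blast)

text \<open>By \<open>agree\<close>, whether two sections coincide is a locally constant property of
  the point.\<close>

lemma section_on_unique:
  assumes s: "section_on A s" "section_on A s'" and A: "connected A" and t: "t \<in> A" "s t = s' t" "t' \<in> A"
  shows "s t' = s' t'"
proof -
  have "(s t = s' t) = (s t' = s' t')"
  proof (rule connected_local_const[OF A t(1,3)], intro ballI)
    fix a assume a: "a \<in> A"
    obtain V u W where 1: "(V, u) \<in> F" "open W" "a \<in> W" "W \<subseteq> V" "\<And>t'. t' \<in> A \<Longrightarrow> t' \<in> W \<Longrightarrow> s t' = u t'"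
      by (rule section_onE[OF s(1) a]) (rule that)
    obtain V' u' W' where 2: "(V', u') \<in> F" "open W'" "a \<in> W'" "W' \<subseteq> V'" "\<And>t'. t' \<in> A \<Longrightarrow> t' \<in> W' \<Longrightarrow> s' t' = u' t'"
      by (rule section_onE[OF s(2) a]) (rule that)
    have "(s a = s' a) = (s b = s' b)" if "b \<in> A" "b \<in> W \<inter> W'" for b
      using agree[OF 1(1) 2(1), of a b] agree[OF 1(1) 2(1), of b a] 1 2 that a by auto
    moreover have "\<forall>\<^sub>F b in at a within A. b \<in> A \<and> b \<in> W \<inter> W'"
      unfolding eventually_at_topological using 1 2 by (intro exI[of _ "W \<inter> W'"]) auto
    ultimately show "\<forall>\<^sub>F b in at a within A. (s a = s' a) = (s b = s' b)"
      by (auto elim: eventually_mono)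
  qed
  then show ?thesis using t by simp
qed

text \<open>Closedness lets the neighbourhood of a point outside one of the sets be shrunk to miss
  that set. At a common point the two local members have the same value, so \<open>agree\<close>
  identifies them nearby.\<close>

lemma section_on_glue:
  assumes s: "section_on A s" "section_on B s'" and cl: "closed A" "closed B"
    and eq: "\<And>t. t \<in> A \<Longrightarrow> t \<in> B \<Longrightarrow> s t = s' t"
  shows "section_on (A \<union> B) (\<lambda>t. if t \<in> A then s t else s' t)"
  unfolding section_on_def
proof
  fix t assume t: "t \<in> A \<union> B"
  let ?r = "\<lambda>t. if t \<in> A then s t else s' t"
  consider "t \<in> A" "t \<notin> B" | "t \<in> B" "t \<notin> A" | "t \<in> A" "t \<in> B" using t by blast
  then show "\<exists>V u W. (V, u) \<in> F \<and> open W \<and> t \<in> W \<and> W \<subseteq> V \<and> (\<forall>t'\<in>(A \<union> B) \<inter> W. ?r t' = u t')"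
  proof cases
    case 1
    obtain V u W where 1: "(V, u) \<in> F" "open W" "t \<in> W" "W \<subseteq> V" "\<And>t'. t' \<in> A \<Longrightarrow> t' \<in> W \<Longrightarrow> s t' = u t'"
      by (rule section_onE[OF s(1) 1(1)]) (rule that)
    then have "open (W - B) \<and> t \<in> W - B \<and> W - B \<subseteq> V \<and> (\<forall>t'\<in>(A \<union> B) \<inter> (W - B). ?r t' = u t')"
      using cl \<open>t \<notin> B\<close> by auto
    with 1(1) show ?thesis by blast
  next
    case 2
    obtain V u W where 1: "(V, u) \<in> F" "open W" "t \<in> W" "W \<subseteq> V" "\<And>t'. t' \<in> B \<Longrightarrow> t' \<in> W \<Longrightarrow> s' t' = u t'"
      by (rule section_onE[OF s(2) 2(1)]) (rule that)
    then have "open (W - A) \<and> t \<in> W - A \<and> W - A \<subseteq> V \<and> (\<forall>t'\<in>(A \<union> B) \<inter> (W - A). ?r t' = u t')"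
      using cl \<open>t \<notin> A\<close> by auto
    with 1(1) show ?thesis by blast
  next
    case 3
    obtain V u W where 1: "(V, u) \<in> F" "open W" "t \<in> W" "W \<subseteq> V" "\<And>t'. t' \<in> A \<Longrightarrow> t' \<in> W \<Longrightarrow> s t' = u t'"
      by (rule section_onE[OF s(1) 3(1)]) (rule that)
    obtain V' u' W' where 2: "(V', u') \<in> F" "open W'" "t \<in> W'" "W' \<subseteq> V'" "\<And>t'. t' \<in> B \<Longrightarrow> t' \<in> W' \<Longrightarrow> s' t' = u' t'"
      by (rule section_onE[OF s(2) 3(2)]) (rule that)
    have "u t = u' t" using 1 2 3 eq[of t] by auto
    then have "u t' = u' t'" if "t' \<in> W \<inter> W'" for t'
      using agree[OF 1(1) 2(1), of t t'] 1 2 that by auto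
    then have "open (W \<inter> W') \<and> t \<in> W \<inter> W' \<and> W \<inter> W' \<subseteq> V \<and> (\<forall>t'\<in>(A \<union> B) \<inter> (W \<inter> W'). ?r t' = u t')"
      using 1 2 by auto
    with 1(1) show ?thesis by blast
  qed
qed

text \<open>A section over one piece is carried to the other through its value at \<open>t1\<close>.
  Connectedness of the intersection makes the two sections agree on all of it, which is where simple
  connectedness enters.\<close>

lemma extendable_on_Un:
  assumes E: "extendable_on A" "extendable_on B" and cl: "closed A" "closed B"
    and conn: "connected (A \<inter> B)" and t1: "t1 \<in> A \<inter> B"
  shows "extendable_on (A \<union> B)"
proof -
  have main: "\<exists>r. section_on (A \<union> B) r \<and> r t = u t"
    if E: "extendable_on A" "extendable_on B" and cl: "closed A" "closed B"
      and conn: "connected (A \<inter> B)" and t1: "t1 \<in> A \<inter> B"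
      and t: "t \<in> A" "(V, u) \<in> F" "t \<in> V" for A B t V u
  proof -
    obtain s where s: "section_on A s" "s t = u t" using E(1) t unfolding extendable_on_def by blast
    have "t1 \<in> A" using t1 by blast
    from section_onE[OF s(1) this] obtain V' u' where 1: "(V', u') \<in> F" "t1 \<in> V'" "s t1 = u' t1"
      by (metis \<open>t1 \<in> A\<close> subsetD)
    then obtain s' where s': "section_on B s'" "s' t1 = s t1" using E(2) t1 unfolding extendable_on_def by fastforce
    have "s t = s' t" if "t \<in> A" "t \<in> B" for t
      by (rule section_on_unique[of "A \<inter> B" s s' t1]) (use s s' conn t1 that in \<open>auto intro: section_on_subset\<close>)
    from section_on_glue[OF s(1) s'(1) cl this] show ?thesis using s t by fastforce
  qed
  show ?thesis
  proof (rule extendable_onI)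
    fix t V u assume t: "t \<in> A \<union> B" "(V, u) \<in> F" "t \<in> V"
    show "\<exists>s. section_on (A \<union> B) s \<and> s t = u t"
    proof (cases "t \<in> A")
      case True
      then show ?thesis using main[OF E cl conn t1 _ t(2,3)] by blast
    next
      case False
      then show ?thesis using main[OF E(2,1) cl(2,1) _ _ _ t(2,3)] conn t1 t by (simp add: Int_commute Un_commute)
    qed
  qed
qed

lemma extendable_on_small:
  "\<exists>W. open W \<and> t0 \<in> W \<and> (\<forall>A\<subseteq>W. extendable_on A)"
proof -
  obtain W where W: "open W" "t0 \<in> W"
    and W': "\<forall>t\<in>W. \<forall>V u. (V, u) \<in> F \<longrightarrow> t \<in> V \<longrightarrow> (\<exists>V' u'. (V', u') \<in> F \<and> W \<subseteq> V' \<and> u' t = u t)"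
    using ext[of t0] by (elim exE conjE) (rule that)
  have "extendable_on A" if AW: "A \<subseteq> W" for A
  proof (rule extendable_onI)
    fix t V u assume "t \<in> A" "(V, u) \<in> F" "t \<in> V"
    then obtain V' u' where "(V', u') \<in> F" "W \<subseteq> V'" "u' t = u t" using W' AW by (meson subsetD)
    then show "\<exists>s. section_on A s \<and> s t = u t" using W AW
      unfolding section_on_def by (intro exI[of _ u'] conjI ballI exI[of _ V'] exI[of _ W]) auto
  qed
  with W show ?thesis by blast
qed

text \<open>Bisection reduces the claim to small rectangles, which \<open>ext\<close> provides. Two
  adjacent rectangles meet in a segment, which is connected, so extendability passes to their
  union.\<close>

lemma extendable_on_cbox: "extendable_on (cbox p q)"
proof -
  define R where "R a b c d = cbox (Complex a c) (Complex b d)" for a b c d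
  have R: "z \<in> R a b c d \<longleftrightarrow> a \<le> Re z \<and> Re z \<le> b \<and> c \<le> Im z \<and> Im z \<le> d" for z a b c d
    by (auto simp: R_def in_cbox_complex_iff)
  have cl: "closed (R a b c d)" "connected (R a b c d)" for a b c d
    by (auto simp: R_def closed_cbox convex_connected)
  have "extendable_on (R a b c d)" if "a \<le> b" "c \<le> d" for a b c d
    using that(1)
  proof (induction rule: Bolzano)
    case (trans a b e)
    have "R a b c d \<union> R b e c d = R a e c d" "R a b c d \<inter> R b e c d = R b b c d"
      using trans by (auto simp: R)
    with extendable_on_Un[of "R a b c d" "R b e c d" "Complex b c"] trans cl that
    show ?case by (auto simp: R)
  next
    case (local x)
    \<comment> \<open>All narrow rectangles around the abscissa \<open>x\<close> must be extendable
      over the full height. A second bisection, now vertical, shows it; the admissible width shrinks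
      to the smaller one when two heights are joined.\<close>
    show ?case using that(2)
    proof (induction rule: Bolzano)
      case (trans c d e)
      then obtain d1 d2 where d: "d1 > 0" "\<And>a b. a \<le> x \<Longrightarrow> x \<le> b \<Longrightarrow> b - a < d1 \<Longrightarrow> extendable_on (R a b c d)"
          "d2 > 0" "\<And>a b. a \<le> x \<Longrightarrow> x \<le> b \<Longrightarrow> b - a < d2 \<Longrightarrow> extendable_on (R a b d e)" by blast
      have "extendable_on (R a b c e)" if "a \<le> x" "x \<le> b" "b - a < min d1 d2" for a b
      proof -
        have "R a b c d \<union> R a b d e = R a b c e" "R a b c d \<inter> R a b d e = R a b d d"
          using trans by (auto simp: R)
        with extendable_on_Un[of "R a b c d" "R a b d e" "Complex a d"] trans cl that d
        show ?thesis by (auto simp: R)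
      qed
      then show ?case using d by (intro exI[of _ "min d1 d2"]) auto
    next
      case (local y)
      obtain W where W: "open W" "Complex x y \<in> W" "\<And>A. A \<subseteq> W \<Longrightarrow> extendable_on A"
        using extendable_on_small by blast
      then obtain e where e: "e > 0" "ball (Complex x y) e \<subseteq> W" using open_contains_ball by blast
      have "R a b c d \<subseteq> W" if "c \<le> y" "y \<le> d" "d - c < e / 2" "a \<le> x" "x \<le> b" "b - a < e / 2" for a b c d
      proof
        fix z assume "z \<in> R a b c d"
        then have "\<bar>Re (z - Complex x y)\<bar> < e / 2" "\<bar>Im (z - Complex x y)\<bar> < e / 2" using that by (auto simp: R abs_if)
        then have "norm (z - Complex x y) < e" using cmod_le[of "z - Complex x y"] by linarith
        then show "z \<in> W" using e by (auto simp: dist_norm norm_minus_commute)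
      qed
      then show ?case using e W by (intro exI[of _ "e / 2"] conjI allI impI) auto
    qed
  qed
  from this[of "Re p" "Re q" "Im p" "Im q"] show ?thesis
    by (cases "Re p \<le> Re q \<and> Im p \<le> Im q") (auto simp: R_def extendable_on_def in_cbox_complex_iff)
qed

text \<open>The plane is exhausted by boxes, and uniqueness makes the sections with the prescribed
  value at \<open>t0\<close> restrict to one another.\<close>

theorem section_exists:
  assumes "(V, u) \<in> F" "t0 \<in> V"
  obtains s where "section_on UNIV s" "s t0 = u t0"
proof -
  define R where "R n = cbox (- Complex (real n) (real n)) (Complex (real n) (real n))" for n
  have R: "z \<in> R n \<longleftrightarrow> \<bar>Re z\<bar> \<le> n \<and> \<bar>Im z\<bar> \<le> n" for z n
    by (auto simp: R_def in_cbox_complex_iff)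
  obtain n0 :: nat where n0: "norm t0 \<le> n0" using real_arch_simple by blast
  have inR: "z \<in> R n" if "norm z \<le> n" for z n
    using that abs_Re_le_cmod[of z] abs_Im_le_cmod[of z] by (auto simp: R)
  have mono: "R m \<subseteq> R n" if "m \<le> n" for m n using that by (force simp: R)
  have "\<exists>s. section_on (R n) s \<and> s t0 = u t0" if "n \<ge> n0" for n
    using extendable_on_cbox assms inR[of t0 n] n0 that unfolding extendable_on_def R_def by force
  then obtain S where S: "\<And>n. n \<ge> n0 \<Longrightarrow> section_on (R n) (S n)" "\<And>n. n \<ge> n0 \<Longrightarrow> S n t0 = u t0" by metis
  have SS: "S m z = S n z" if "n0 \<le> m" "m \<le> n" "z \<in> R m" for m n z
  proof (rule section_on_unique[of "R m" _ _ t0])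
    show "section_on (R m) (S m)" using S that by blast
    show "section_on (R m) (S n)" using S(1)[of n] mono[OF that(2)] that section_on_subset by auto
    show "connected (R m)" by (simp add: R_def convex_connected)
    show "t0 \<in> R m" using inR n0 that by auto
    show "S m t0 = S n t0" using S(2) that by auto
    show "z \<in> R m" by fact
  qed
  define k where "k z = max n0 (nat \<lceil>norm z\<rceil>)" for z :: complex
  have k: "n0 \<le> k z" "norm z \<le> k z" for z
    unfolding k_def by (auto simp: le_max_iff_disj) linarith
  define s where "s z = S (k z) z" for z
  have sS: "s z = S n z" if "n0 \<le> n" "z \<in> R n" for n z
    unfolding s_def using SS[of n "k z" z] SS[of "k z" n z] k[of z] inR[of z "k z"] that
    by (metis nle_le)
  show ?thesis
  proof
    show "section_on UNIV s" unfolding section_on_def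
    proof
      fix t :: complex
      \<comment> \<open>The extra 1 leaves room for the unit ball about \<open>t\<close>, on which
        \<open>s\<close> is then the single section \<open>S n\<close>.\<close>
      define n where "n = Suc (k t)"
      have n: "n \<ge> n0" using k[of t] by (simp add: n_def)
      have "norm z \<le> n" if "z \<in> ball t 1" for z
        using that k(2)[of t] norm_triangle_ineq2[of z t] by (simp add: n_def dist_norm norm_minus_commute)
      then have nR: "ball t 1 \<subseteq> R n" using inR by blast
      have tn: "t \<in> R n" using nR by auto
      obtain V u W where 1: "(V, u) \<in> F" "open W" "t \<in> W" "W \<subseteq> V" "\<And>t'. t' \<in> R n \<Longrightarrow> t' \<in> W \<Longrightarrow> S n t' = u t'"
        by (rule section_onE[OF S(1)[OF n] tn]) (rule that)
      have "open (W \<inter> ball t 1) \<and> t \<in> W \<inter> ball t 1 \<and> W \<inter> ball t 1 \<subseteq> V \<and> (\<forall>t'\<in>UNIV \<inter> (W \<inter> ball t 1). s t' = u t')"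
        using 1 nR sS[OF n] by auto
      then show "\<exists>V u W. (V, u) \<in> F \<and> open W \<and> t \<in> W \<and> W \<subseteq> V \<and> (\<forall>t'\<in>UNIV \<inter> W. s t' = u t')"
        using 1(1) by blast
    qed
    show "s t0 = u t0" using sS[of n0 t0] S(2) n0 inR by auto
  qed
qed

end

lemma holomorphic_on_local:
  assumes "\<And>z. z \<in> S \<Longrightarrow> \<exists>T. open T \<and> z \<in> T \<and> f holomorphic_on T"
  shows "f holomorphic_on S"
  unfolding holomorphic_on_def
proof
  fix z assume "z \<in> S"
  then obtain T where "open T" "z \<in> T" "f holomorphic_on T" using assms by blast
  then show "f field_differentiable at z within S"
    by (metis field_differentiable_at_within holomorphic_on_imp_differentiable_at)
qed

section \<open>Discs in Riemann surfaces\<close>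

text \<open>The conditions on the atlas alone, so that \<open>plane V\<close> qualifies for every
  open \<open>V\<close>, connected or not.\<close>

definition complex_atlas :: "'a surface \<Rightarrow> bool" where
  "complex_atlas P \<longleftrightarrow> (\<forall>c\<in>atlas P. is_chart (topo P) c) \<and> (\<Union>(U, \<phi>)\<in>atlas P. U) = points P \<and>
     (\<forall>c\<in>atlas P. \<forall>d\<in>atlas P. compatible c d)"

lemma riemann_surface_complex_atlas: "riemann_surface P \<Longrightarrow> complex_atlas P"
  by (simp add: riemann_surface_def complex_atlas_def)

lemma chart_at:
  assumes "complex_atlas P" "p \<in> points P"
  obtains U \<phi> where "(U, \<phi>) \<in> atlas P" "p \<in> U"
proof -
  from assms have "p \<in> (\<Union>(U, \<phi>)\<in>atlas P. U)" by (simp add: complex_atlas_def)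
  then show ?thesis using that by auto
qed

lemma is_chartD:
  assumes "is_chart X (U, \<phi>)"
  shows "openin X U" "open (\<phi> ` U)" "inj_on \<phi> U" "U \<subseteq> topspace X"
    "continuous_map (subtopology X U) euclidean \<phi>"
    "continuous_map (top_of_set (\<phi> ` U)) X (inv_into U \<phi>)"
    "openin X W \<Longrightarrow> W \<subseteq> U \<Longrightarrow> open (\<phi> ` W)"
proof -
  have 1: "openin X U" "open (\<phi> ` U)" and h: "homeomorphic_map (subtopology X U) (top_of_set (\<phi> ` U)) \<phi>"
    using assms by (auto simp: is_chart_def)
  have t: "topspace (subtopology X U) = U" using openin_subset[OF 1(1)] by auto
  show "openin X U" "open (\<phi> ` U)" "U \<subseteq> topspace X" using 1 openin_subset by auto
  show inj: "inj_on \<phi> U" using homeomorphic_imp_injective_map[OF h] t by simp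
  show "continuous_map (subtopology X U) euclidean \<phi>"
    using homeomorphic_imp_continuous_map[OF h] continuous_map_in_subtopology by blast
  obtain g where g: "homeomorphic_maps (subtopology X U) (top_of_set (\<phi> ` U)) \<phi> g"
    using h homeomorphic_map_maps by blast
  have eq: "g z = inv_into U \<phi> z" if "z \<in> \<phi> ` U" for z
  proof -
    obtain p where p: "p \<in> U" "z = \<phi> p" using \<open>z \<in> \<phi> ` U\<close> by blast
    then show ?thesis using g t inj unfolding homeomorphic_maps_def by (metis inv_into_f_f)
  qed
  have "continuous_map (top_of_set (\<phi> ` U)) X g"
    using g by (auto simp: homeomorphic_maps_def continuous_map_in_subtopology)
  then show "continuous_map (top_of_set (\<phi> ` U)) X (inv_into U \<phi>)"
    by (rule continuous_map_eq) (use eq in auto)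
  assume W: "openin X W" "W \<subseteq> U"
  then have "openin (subtopology X U) W" by (metis inf.absorb_iff2 openin_subtopology_Int2)
  then have "openin (top_of_set (\<phi> ` U)) (\<phi> ` W)"
    using homeomorphic_imp_open_map[OF h] by (simp add: open_map_def)
  then show "open (\<phi> ` W)" using 1 openin_open_eq by blast
qed

lemma chart_is_chart: "complex_atlas P \<Longrightarrow> (U, \<phi>) \<in> atlas P \<Longrightarrow> is_chart (topo P) (U, \<phi>)"
  by (simp add: complex_atlas_def)

lemmas chartD = is_chartD[OF chart_is_chart]

lemma openin_preimage:
  "continuous_map X Y f \<Longrightarrow> openin X U \<Longrightarrow> openin Y V \<Longrightarrow> openin X {p \<in> U. f p \<in> V}"
proof -
  assume "continuous_map X Y f" "openin X U" "openin Y V"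
  then have "openin X (U \<inter> {p \<in> topspace X. f p \<in> V})"
    using openin_continuous_map_preimage by blast
  moreover have "U \<inter> {p \<in> topspace X. f p \<in> V} = {p \<in> U. f p \<in> V}"
    using openin_subset[OF \<open>openin X U\<close>] by auto
  ultimately show ?thesis by simp
qed

lemma openin_chart_preimage:
  assumes c: "is_chart X (U, \<phi>)" and "open B"
  shows "openin X {p \<in> U. \<phi> p \<in> B}"
proof -
  have "openin (subtopology X U) {p \<in> topspace (subtopology X U). \<phi> p \<in> B}"
    using is_chartD(5)[OF c] assms(2) openin_continuous_map_preimage by fastforce
  moreover have "{p \<in> topspace (subtopology X U). \<phi> p \<in> B} = {p \<in> U. \<phi> p \<in> B}"
    using is_chartD(4)[OF c] by auto
  ultimately show ?thesis using is_chartD(1)[OF c] by (metis openin_open_subtopology)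
qed

lemma holomorphic_mapD:
  assumes "holomorphic_map P Q f"
  shows "continuous_map (topo P) (topo Q) f"
    "(U, \<phi>) \<in> atlas P \<Longrightarrow> (V, \<psi>) \<in> atlas Q \<Longrightarrow>
      (\<lambda>z. \<psi> (f (inv_into U \<phi> z))) holomorphic_on \<phi> ` {p \<in> U. f p \<in> V}"
  using assms unfolding holomorphic_map_def by auto

lemma holomorphic_map_in: "holomorphic_map P Q f \<Longrightarrow> p \<in> points P \<Longrightarrow> f p \<in> points Q"
  using holomorphic_mapD(1) continuous_map_image_subset_topspace by blast

lemma holomorphic_mapI:
  assumes "continuous_map (topo P) (topo Q) f"
    "\<And>U \<phi> V \<psi>. (U, \<phi>) \<in> atlas P \<Longrightarrow> (V, \<psi>) \<in> atlas Q \<Longrightarrow>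
      (\<lambda>z. \<psi> (f (inv_into U \<phi> z))) holomorphic_on \<phi> ` {p \<in> U. f p \<in> V}"
  shows "holomorphic_map P Q f"
  using assms unfolding holomorphic_map_def by auto

text \<open>The intermediate chart depends on the point, so holomorphy is checked on the open set
  that a single chart of \<open>Q\<close> serves.\<close>

lemma holomorphic_map_compose:
  assumes P: "complex_atlas P" and Q: "complex_atlas Q" and R: "complex_atlas R"
    and f: "holomorphic_map P Q f" and g: "holomorphic_map Q R g"
  shows "holomorphic_map P R (g \<circ> f)"
proof (rule holomorphic_mapI)
  note cf = holomorphic_mapD(1)[OF f] and cg = holomorphic_mapD(1)[OF g]
  show cgf: "continuous_map (topo P) (topo R) (g \<circ> f)" using cf cg by (rule continuous_map_compose)
  fix U \<phi> W \<kappa> assume U: "(U, \<phi>) \<in> atlas P" and W: "(W, \<kappa>) \<in> atlas R"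
  show "(\<lambda>z. \<kappa> ((g \<circ> f) (inv_into U \<phi> z))) holomorphic_on \<phi> ` {p \<in> U. (g \<circ> f) p \<in> W}"
  proof (rule holomorphic_on_local)
    fix z assume "z \<in> \<phi> ` {p \<in> U. (g \<circ> f) p \<in> W}"
    then obtain p where p: "p \<in> U" "g (f p) \<in> W" "z = \<phi> p" by auto
    have "p \<in> points P" using p chartD(4)[OF P U] by blast
    then have "f p \<in> points Q" using holomorphic_map_in[OF f] by blast
    then obtain V \<psi> where V: "(V, \<psi>) \<in> atlas Q" "f p \<in> V" using chart_at[OF Q] by blast
    define N where "N = {p \<in> {p \<in> U. f p \<in> V}. (g \<circ> f) p \<in> W}"
    have N: "openin (topo P) N" unfolding N_def
      by (intro openin_preimage[OF cgf] openin_preimage[OF cf] chartD(1)[OF P U] chartD(1)[OF Q V(1)] chartD(1)[OF R W])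
    have "open (\<phi> ` N)" by (rule chartD(7)[OF P U N]) (auto simp: N_def)
    moreover have "z \<in> \<phi> ` N" using p V by (auto simp: N_def)
    moreover have "(\<lambda>z. \<kappa> ((g \<circ> f) (inv_into U \<phi> z))) holomorphic_on \<phi> ` N"
    proof (rule holomorphic_transform)
      show "((\<lambda>w. \<kappa> (g (inv_into V \<psi> w))) \<circ> (\<lambda>z. \<psi> (f (inv_into U \<phi> z)))) holomorphic_on \<phi> ` N"
      proof (rule holomorphic_on_compose_gen)
        show "(\<lambda>z. \<psi> (f (inv_into U \<phi> z))) holomorphic_on \<phi> ` N"
          by (rule holomorphic_on_subset[OF holomorphic_mapD(2)[OF f U V(1)]]) (auto simp: N_def)
        show "(\<lambda>w. \<kappa> (g (inv_into V \<psi> w))) holomorphic_on \<psi> ` {q \<in> V. g q \<in> W}"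
          by (rule holomorphic_mapD(2)[OF g V(1) W])
        show "(\<lambda>z. \<psi> (f (inv_into U \<phi> z))) ` \<phi> ` N \<subseteq> \<psi> ` {q \<in> V. g q \<in> W}"
          using chartD(3)[OF P U] by (auto simp: N_def)
      qed
      show "((\<lambda>w. \<kappa> (g (inv_into V \<psi> w))) \<circ> (\<lambda>z. \<psi> (f (inv_into U \<phi> z)))) w = \<kappa> ((g \<circ> f) (inv_into U \<phi> w))"
        if "w \<in> \<phi> ` N" for w
        using that chartD(3)[OF P U] chartD(3)[OF Q V(1)] by (auto simp: N_def)
    qed
    ultimately show "\<exists>T. open T \<and> z \<in> T \<and> (\<lambda>z. \<kappa> ((g \<circ> f) (inv_into U \<phi> z))) holomorphic_on T"
      by blast
  qed
qed

lemma holomorphic_map_id: "complex_atlas P \<Longrightarrow> holomorphic_map P P (\<lambda>p. p)"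
  unfolding complex_atlas_def compatible_def transition_holomorphic_def
  by (intro holomorphic_mapI) (fastforce simp: Int_def)+

lemma holomorphic_map_eq:
  assumes P: "complex_atlas P" and "holomorphic_map P Q f" "\<And>p. p \<in> points P \<Longrightarrow> f p = g p"
  shows "holomorphic_map P Q g"
proof (rule holomorphic_mapI)
  show "continuous_map (topo P) (topo Q) g" using assms holomorphic_mapD(1) continuous_map_eq by blast
  fix U \<phi> V \<psi> assume U: "(U, \<phi>) \<in> atlas P" "(V, \<psi>) \<in> atlas Q"
  have "U \<subseteq> points P" using chartD(4)[OF P U(1)] .
  then have eq: "\<And>p. p \<in> U \<Longrightarrow> f p = g p" using assms by blast
  then have eq': "{p \<in> U. f p \<in> V} = {p \<in> U. g p \<in> V}" by auto
  have "(\<lambda>z. \<psi> (f (inv_into U \<phi> z))) holomorphic_on \<phi> ` {p \<in> U. g p \<in> V}"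
    using holomorphic_mapD(2)[OF assms(2) U] unfolding eq' .
  then show "(\<lambda>z. \<psi> (g (inv_into U \<phi> z))) holomorphic_on \<phi> ` {p \<in> U. g p \<in> V}"
    by (rule holomorphic_transform) (use eq chartD(3)[OF P U(1)] in auto)
qed

text \<open>With plane domains as surfaces, parametrized discs and local expressions of maps are
  holomorphic maps too, and one composition lemma handles them all.\<close>

definition plane :: "complex set \<Rightarrow> complex surface" where
  "plane V = \<lparr>topo = top_of_set V, atlas = {(V, \<lambda>z. z)}\<rparr>"

lemma plane_simps [simp]: "topo (plane V) = top_of_set V" "atlas (plane V) = {(V, \<lambda>z. z)}"
  by (simp_all add: plane_def)

lemma inv_into_ident: "z \<in> V \<Longrightarrow> inv_into V (\<lambda>z. z) z = z"
  by (intro inv_into_f_eq) auto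

lemma complex_atlas_plane:
  assumes "open V"
  shows "complex_atlas (plane V)"
proof -
  have "homeomorphic_map (top_of_set V) (top_of_set V) (\<lambda>z. z)"
    using homeomorphic_map_id[of "top_of_set V"] by (simp add: id_def)
  moreover have "(\<lambda>z. inv_into V (\<lambda>z. z) z) holomorphic_on V"
    by (rule holomorphic_transform[OF holomorphic_on_ident]) (simp add: inv_into_ident)
  ultimately show ?thesis using assms
    unfolding complex_atlas_def is_chart_def compatible_def transition_holomorphic_def
    by (simp add: subtopology_subtopology)
qed

lemma holomorphic_map_from_plane:
  "holomorphic_map (plane V) Q \<gamma> \<longleftrightarrow> continuous_map (top_of_set V) (topo Q) \<gamma> \<and>
     (\<forall>W \<psi>. (W, \<psi>) \<in> atlas Q \<longrightarrow> (\<lambda>z. \<psi> (\<gamma> z)) holomorphic_on {z \<in> V. \<gamma> z \<in> W})"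
proof -
  have "(\<lambda>z. \<psi> (\<gamma> (inv_into V (\<lambda>z. z) z))) holomorphic_on {z \<in> V. \<gamma> z \<in> W} \<longleftrightarrow>
     (\<lambda>z. \<psi> (\<gamma> z)) holomorphic_on {z \<in> V. \<gamma> z \<in> W}" for W and \<psi> :: "'a \<Rightarrow> complex"
    by (rule holomorphic_cong) (auto simp: inv_into_ident)
  then show ?thesis unfolding holomorphic_map_def by auto
qed

lemma holomorphic_map_planes:
  "holomorphic_map (plane V) (plane W) F \<longleftrightarrow> F holomorphic_on V \<and> F ` V \<subseteq> W"
proof -
  have "continuous_map (top_of_set V) (top_of_set W) F \<longleftrightarrow> continuous_on V F \<and> F ` V \<subseteq> W"
    by (auto simp: continuous_map_in_subtopology)
  moreover have "{z \<in> V. F z \<in> W} = V" if "F ` V \<subseteq> W" using that by auto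
  ultimately show ?thesis unfolding holomorphic_map_from_plane
    by (auto simp: holomorphic_on_imp_continuous_on)
qed

text \<open>The inverse of a local coordinate centred at \<open>p\<close>, on a round ball. Discs
  replace charts throughout, since maps on \<open>P\<close> can be composed with them
  directly.\<close>

definition disc :: "'a surface \<Rightarrow> 'a \<Rightarrow> real \<Rightarrow> (complex \<Rightarrow> 'a) \<Rightarrow> bool" where
  "disc P p r \<gamma> \<longleftrightarrow> 0 < r \<and> \<gamma> 0 = p \<and> inj_on \<gamma> (ball 0 r) \<and> holomorphic_map (plane (ball 0 r)) P \<gamma>"

lemma discD:
  assumes "disc P p r \<gamma>"
  shows "0 < r" "\<gamma> 0 = p" "inj_on \<gamma> (ball 0 r)" "holomorphic_map (plane (ball 0 r)) P \<gamma>"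
    "continuous_map (top_of_set (ball 0 r)) (topo P) \<gamma>"
    "(W, \<psi>) \<in> atlas P \<Longrightarrow> (\<lambda>z. \<psi> (\<gamma> z)) holomorphic_on {z \<in> ball 0 r. \<gamma> z \<in> W}"
    "z \<in> ball 0 r \<Longrightarrow> \<gamma> z \<in> points P"
  using assms holomorphic_map_in[of "plane (ball 0 r)" P \<gamma> z]
  unfolding disc_def holomorphic_map_from_plane by auto

lemma open_plane_preimage:
  assumes "continuous_map (top_of_set V) X \<gamma>" "open V" "openin X W"
  shows "open {z \<in> V. \<gamma> z \<in> W}"
  using openin_continuous_map_preimage[OF assms(1,3)] assms(2) by (simp add: openin_open_eq)

text \<open>Read in a chart, \<open>\<gamma>\<close> is an injective holomorphic function and
  therefore open.\<close>

lemma disc_open_image: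
  assumes P: "complex_atlas P" and d: "disc P p r \<gamma>" and A: "open A" "A \<subseteq> ball 0 r"
  shows "openin (topo P) (\<gamma> ` A)"
proof (subst openin_subopen, intro ballI)
  fix q assume "q \<in> \<gamma> ` A"
  then obtain z where z: "z \<in> A" "q = \<gamma> z" by blast
  then have "q \<in> points P" using discD(7)[OF d] A by auto
  then obtain U \<phi> where U: "(U, \<phi>) \<in> atlas P" "q \<in> U" using chart_at[OF P] by blast
  define N where "N = A \<inter> {z \<in> ball 0 r. \<gamma> z \<in> U}"
  have N: "open N" unfolding N_def
    by (intro open_Int A open_plane_preimage[OF discD(5)[OF d]] chartD(1)[OF P U(1)]) auto
  have inj: "inj_on (\<lambda>z. \<phi> (\<gamma> z)) N"
    using discD(3)[OF d] chartD(3)[OF P U(1)] by (auto simp: inj_on_def N_def)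
  have "(\<lambda>z. \<phi> (\<gamma> z)) holomorphic_on N"
    by (rule holomorphic_on_subset[OF discD(6)[OF d U(1)]]) (auto simp: N_def)
  then have o: "open ((\<lambda>z. \<phi> (\<gamma> z)) ` N)" using N inj open_mapping_thm3 by blast
  have "{p \<in> U. \<phi> p \<in> (\<lambda>z. \<phi> (\<gamma> z)) ` N} = \<gamma> ` N"
    using chartD(3)[OF P U(1)] by (auto simp: N_def inj_on_def)
  then have "openin (topo P) (\<gamma> ` N)"
    using openin_chart_preimage[OF chart_is_chart[OF P U(1)] o] by simp
  then show "\<exists>T. openin (topo P) T \<and> q \<in> T \<and> T \<subseteq> \<gamma> ` A"
    using z U A by (intro exI[of _ "\<gamma> ` N"]) (auto simp: N_def)
qed

lemma disc_neighbourhood: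
  assumes "complex_atlas P" "disc P p r \<gamma>"
  shows "openin (topo P) (\<gamma> ` ball 0 r)" "p \<in> \<gamma> ` ball 0 r" "p \<in> points P"
  using disc_open_image[OF assms open_ball] discD(1,2)[OF assms(2)] discD(7)[OF assms(2), of 0]
  by (auto intro: image_eqI[of _ _ 0])

lemma disc_exists:
  assumes P: "complex_atlas P" and p: "p \<in> points P"
  obtains r \<gamma> where "disc P p r \<gamma>"
proof -
  obtain U \<phi> where U: "(U, \<phi>) \<in> atlas P" "p \<in> U" using chart_at[OF P p] .
  note c = chartD[OF P U(1)]
  obtain r where r: "r > 0" "ball (\<phi> p) r \<subseteq> \<phi> ` U" using c(2) U open_contains_ball by blast
  define \<gamma> where "\<gamma> z = inv_into U \<phi> (\<phi> p + z)" for z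
  have in1: "\<phi> p + z \<in> \<phi> ` U" if "z \<in> ball 0 r" for z
    by (rule subsetD[OF r(2)]) (use that in \<open>simp add: dist_norm\<close>)
  have \<gamma>: "\<gamma> z \<in> U" "\<phi> (\<gamma> z) = \<phi> p + z" if "z \<in> ball 0 r" for z
    using in1[OF that] by (auto simp: \<gamma>_def inv_into_into f_inv_into_f)
  have hid: "holomorphic_map (plane (\<phi> ` U)) P (inv_into U \<phi>)"
    unfolding holomorphic_map_from_plane
  proof (intro conjI allI impI c(6))
    fix W \<psi> assume W: "(W, \<psi>) \<in> atlas P"
    have "(\<lambda>z. \<psi> (inv_into U \<phi> z)) holomorphic_on \<phi> ` (U \<inter> W)"
      using P U W unfolding complex_atlas_def compatible_def transition_holomorphic_def by fastforce
    moreover have "\<phi> ` (U \<inter> W) = {z \<in> \<phi> ` U. inv_into U \<phi> z \<in> W}" using c(3) by auto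
    ultimately show "(\<lambda>z. \<psi> (inv_into U \<phi> z)) holomorphic_on {z \<in> \<phi> ` U. inv_into U \<phi> z \<in> W}" by simp
  qed
  have "holomorphic_map (plane (ball 0 r)) P (inv_into U \<phi> \<circ> (\<lambda>z. \<phi> p + z))"
    by (rule holomorphic_map_compose[OF complex_atlas_plane complex_atlas_plane P _ hid])
      (use c(2) in1 in \<open>auto simp: holomorphic_map_planes image_subset_iff simp del: image_add_ball intro!: holomorphic_intros\<close>)
  then have "holomorphic_map (plane (ball 0 r)) P \<gamma>" by (simp add: o_def \<gamma>_def[abs_def])
  moreover have "inj_on \<gamma> (ball 0 r)" using \<gamma> by (metis add_left_cancel inj_onI)
  moreover have "\<gamma> 0 = p" using c(3) U by (simp add: \<gamma>_def)
  ultimately show ?thesis using that r by (auto simp: disc_def)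
qed

lemma disc_compose:
  assumes P: "complex_atlas P" and d: "disc P p r \<gamma>" and s: "s > 0"
    and k: "k holomorphic_on ball 0 s" "inj_on k (ball 0 s)" "k ` ball 0 s \<subseteq> ball 0 r"
  shows "disc P (\<gamma> (k 0)) s (\<lambda>z. \<gamma> (k z))"
proof -
  have "holomorphic_map (plane (ball 0 s)) P (\<gamma> \<circ> k)"
    by (rule holomorphic_map_compose[OF complex_atlas_plane complex_atlas_plane P _ discD(4)[OF d]])
      (use k in \<open>auto simp: holomorphic_map_planes\<close>)
  moreover have "inj_on (\<gamma> \<circ> k) (ball 0 s)"
    using discD(3)[OF d] k by (meson comp_inj_on inj_on_subset)
  ultimately show ?thesis using s by (simp add: disc_def o_def)
qed

lemma disc_shift:
  assumes "complex_atlas P" "disc P p r \<gamma>" "z0 \<in> ball 0 r" "0 < s" "s \<le> r - norm z0"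
  shows "disc P (\<gamma> z0) s (\<lambda>z. \<gamma> (z0 + z))"
proof -
  have "z0 + z \<in> ball 0 r" if "z \<in> ball 0 s" for z
    using that norm_triangle_ineq[of z0 z] assms by simp
  moreover have "(\<lambda>z. z0 + z) holomorphic_on ball 0 s" by (intro holomorphic_intros)
  ultimately show ?thesis
    using disc_compose[OF assms(1,2,4), of "\<lambda>z. z0 + z"] by (simp add: image_subset_iff del: image_add_ball)
qed

lemma disc_shrink:
  assumes "complex_atlas P" "disc P p r \<gamma>" "0 < s" "s \<le> r"
  shows "disc P p s \<gamma>"
  using disc_shift[OF assms(1,2) _ assms(3), of 0] assms discD[OF assms(2)] by simp

lemma disc_shrink_into:
  assumes P: "complex_atlas P" and d: "disc P p r \<gamma>" and W: "openin (topo P) W" "p \<in> W"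
  obtains s where "0 < s" "s \<le> r" "disc P p s \<gamma>" "\<gamma> ` ball 0 s \<subseteq> W"
proof -
  have "open {z \<in> ball 0 r. \<gamma> z \<in> W}"
    using open_plane_preimage[OF discD(5)[OF d] open_ball W(1)] .
  moreover have "0 \<in> {z \<in> ball 0 r. \<gamma> z \<in> W}" using W discD[OF d] by auto
  ultimately obtain e where e: "e > 0" "ball 0 e \<subseteq> {z \<in> ball 0 r. \<gamma> z \<in> W}"
    using open_contains_ball by blast
  show ?thesis
    by (rule that[of "min e r"]) (use e discD[OF d] disc_shrink[OF P d] in auto)
qed

lemma disc_image:
  assumes "complex_atlas P" "complex_atlas Q" "disc P p r \<gamma>" "holomorphic_map P Q g" "inj_on g (points P)"
  shows "disc Q (g p) r (g \<circ> \<gamma>)"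
proof -
  note d = discD[OF assms(3)]
  have "holomorphic_map (plane (ball 0 r)) Q (g \<circ> \<gamma>)"
    by (rule holomorphic_map_compose[OF complex_atlas_plane assms(1,2) d(4) assms(4)]) auto
  moreover have "inj_on (g \<circ> \<gamma>) (ball 0 r)"
    using d(3) d(7) assms(5) by (intro comp_inj_on) (auto intro: inj_on_subset)
  ultimately show ?thesis using d by (auto simp: disc_def)
qed

text \<open>Read in the chart, \<open>\<gamma>\<close> is injective and holomorphic, and such
  functions have holomorphic inverses.\<close>

lemma disc_inverse_chart:
  assumes P: "complex_atlas P" and d: "disc P p r \<gamma>" and U: "(U, \<phi>) \<in> atlas P"
  shows "(\<lambda>z. inv_into (ball 0 r) \<gamma> (inv_into U \<phi> z)) holomorphic_on \<phi> ` (U \<inter> \<gamma> ` ball 0 r)"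
proof -
  note c = chartD[OF P U]
  define N where "N = {z \<in> ball 0 r. \<gamma> z \<in> U}"
  have N: "open N" unfolding N_def
    by (intro open_plane_preimage[OF discD(5)[OF d]] c(1)) auto
  have hol: "(\<lambda>z. \<phi> (\<gamma> z)) holomorphic_on N" using discD(6)[OF d U] by (simp add: N_def)
  have inj: "inj_on (\<lambda>z. \<phi> (\<gamma> z)) N"
    using discD(3)[OF d] c(3) by (auto simp: inj_on_def N_def)
  obtain g where g: "g holomorphic_on (\<lambda>z. \<phi> (\<gamma> z)) ` N" "\<And>z. z \<in> N \<Longrightarrow> g (\<phi> (\<gamma> z)) = z"
    using holomorphic_has_inverse[OF hol N inj] by metis
  have "\<phi> ` (U \<inter> \<gamma> ` ball 0 r) = (\<lambda>z. \<phi> (\<gamma> z)) ` N" by (auto simp: N_def)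
  moreover have "g w = inv_into (ball 0 r) \<gamma> (inv_into U \<phi> w)" if "w \<in> (\<lambda>z. \<phi> (\<gamma> z)) ` N" for w
    using that g(2) c(3) discD(3)[OF d] by (auto simp: N_def)
  ultimately show ?thesis using holomorphic_transform[OF g(1)] by simp
qed

text \<open>The normal forms of two maps at one point live in different discs; this change of
  coordinate compares them. Its derivative at 0 is nonzero because it is injective.\<close>

lemma disc_transition:
  assumes P: "complex_atlas P" and d: "disc P p r \<gamma>" and d': "disc P p r' \<gamma>'"
  obtains e \<alpha> where "0 < e" "e \<le> r" "\<alpha> holomorphic_on ball 0 e" "inj_on \<alpha> (ball 0 e)"
    "\<alpha> 0 = 0" "deriv \<alpha> 0 \<noteq> 0" "\<alpha> ` ball 0 e \<subseteq> ball 0 r'" "\<And>z. z \<in> ball 0 e \<Longrightarrow> \<gamma> z = \<gamma>' (\<alpha> z)"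
proof -
  note p = disc_neighbourhood(3)[OF P d]
  obtain U \<phi> where U: "(U, \<phi>) \<in> atlas P" "p \<in> U" using chart_at[OF P p] .
  note c = chartD[OF P U(1)]
  define I where "I = inv_into (ball 0 r') \<gamma>'"
  have o: "openin (topo P) (U \<inter> \<gamma>' ` ball 0 r')"
    by (intro openin_Int c(1) disc_neighbourhood(1)[OF P d'])
  have "p \<in> U \<inter> \<gamma>' ` ball 0 r'" using disc_neighbourhood(2)[OF P d'] U(2) by blast
  then obtain e where e: "0 < e" "e \<le> r" "disc P p e \<gamma>" "\<gamma> ` ball 0 e \<subseteq> U \<inter> \<gamma>' ` ball 0 r'"
    using disc_shrink_into[OF P d o] by blast
  have I: "\<gamma>' (I q) = q" "I q \<in> ball 0 r'" if "q \<in> \<gamma>' ` ball 0 r'" for q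
    unfolding I_def using that f_inv_into_f[of q \<gamma>'] inv_into_into[of q \<gamma>'] by blast+
  have hI: "(\<lambda>z. I (inv_into U \<phi> z)) holomorphic_on \<phi> ` (U \<inter> \<gamma>' ` ball 0 r')"
    using disc_inverse_chart[OF P d' U(1)] by (simp add: I_def)
  have "{z \<in> ball 0 e. \<gamma> z \<in> U} = ball 0 e" using e(4) by auto
  then have h2: "(\<lambda>z. \<phi> (\<gamma> z)) holomorphic_on ball 0 e" using discD(6)[OF e(3) U(1)] by simp
  have "((\<lambda>z. I (inv_into U \<phi> z)) \<circ> (\<lambda>z. \<phi> (\<gamma> z))) holomorphic_on ball 0 e"
    by (rule holomorphic_on_compose_gen[OF h2 hI]) (use e(4) in blast)
  then have hol: "(\<lambda>z. I (\<gamma> z)) holomorphic_on ball 0 e"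
  proof (rule holomorphic_transform)
    fix z :: complex assume "z \<in> ball 0 e"
    then have "\<gamma> z \<in> U" using e(4) by blast
    then show "((\<lambda>z. I (inv_into U \<phi> z)) \<circ> (\<lambda>z. \<phi> (\<gamma> z))) z = I (\<gamma> z)" using c(3) by simp
  qed
  have inj: "inj_on (\<lambda>z. I (\<gamma> z)) (ball 0 e)"
    by (rule inj_onI) (metis I(1) discD(3)[OF e(3)] e(4) image_subset_iff inf.boundedE inj_onD)
  have I0: "I (\<gamma> 0) = 0"
    using discD[OF d] discD[OF d'] by (metis I_def centre_in_ball inv_into_f_f)
  show ?thesis
  proof (rule that[of e "\<lambda>z. I (\<gamma> z)"])
    show "deriv (\<lambda>z. I (\<gamma> z)) 0 \<noteq> 0"
      by (rule holomorphic_injective_imp_regular[OF hol open_ball inj]) (use e in simp)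
    show "(\<lambda>z. I (\<gamma> z)) ` ball 0 e \<subseteq> ball 0 r'" using e(4) I(2) by blast
    show "\<gamma> z = \<gamma>' (I (\<gamma> z))" if "z \<in> ball 0 e" for z using I(1) e(4) that by (metis Int_iff image_subset_iff)
  qed (use e hol inj I0 in auto)
qed

lemma holomorphic_map_local:
  assumes P: "complex_atlas P" and Q: "complex_atlas Q"
    and f: "\<And>p. p \<in> points P \<Longrightarrow> \<exists>r \<gamma>. disc P p r \<gamma> \<and> holomorphic_map (plane (ball 0 r)) Q (f \<circ> \<gamma>)"
  shows "holomorphic_map P Q f"
proof (rule holomorphic_mapI)
  show cont: "continuous_map (topo P) (topo Q) f"
    unfolding continuous_map_def
  proof (intro conjI allI impI)
    show "f \<in> points P \<rightarrow> points Q"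
    proof
      fix p assume "p \<in> points P"
      then obtain r \<gamma> where d: "disc P p r \<gamma>" "holomorphic_map (plane (ball 0 r)) Q (f \<circ> \<gamma>)" using f by blast
      then show "f p \<in> points Q" using holomorphic_map_in[OF d(2), of 0] discD(1,2)[OF d(1)] by auto
    qed
    fix W assume W: "openin (topo Q) W"
    show "openin (topo P) {x \<in> points P. f x \<in> W}"
    proof (subst openin_subopen, intro ballI)
      fix p assume p: "p \<in> {x \<in> points P. f x \<in> W}"
      then obtain r \<gamma> where d: "disc P p r \<gamma>" "holomorphic_map (plane (ball 0 r)) Q (f \<circ> \<gamma>)" using f by blast
      have o: "open {z \<in> ball 0 r. (f \<circ> \<gamma>) z \<in> W}"
        using holomorphic_mapD(1)[OF d(2)] unfolding plane_simps
        by (rule open_plane_preimage) (auto simp: W)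
      show "\<exists>T. openin (topo P) T \<and> p \<in> T \<and> T \<subseteq> {x \<in> points P. f x \<in> W}"
      proof (intro exI conjI)
        show "openin (topo P) (\<gamma> ` {z \<in> ball 0 r. (f \<circ> \<gamma>) z \<in> W})"
          by (rule disc_open_image[OF P d(1) o]) auto
        show "p \<in> \<gamma> ` {z \<in> ball 0 r. (f \<circ> \<gamma>) z \<in> W}" using discD(1,2)[OF d(1)] p by force
      qed (use discD(7)[OF d(1)] in auto)
    qed
  qed
  fix U \<phi> V \<psi> assume U: "(U, \<phi>) \<in> atlas P" and V: "(V, \<psi>) \<in> atlas Q"
  note c = chartD[OF P U]
  show "(\<lambda>z. \<psi> (f (inv_into U \<phi> z))) holomorphic_on \<phi> ` {p \<in> U. f p \<in> V}"
  proof (rule holomorphic_on_local)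
    fix z assume "z \<in> \<phi> ` {p \<in> U. f p \<in> V}"
    then obtain p where p: "p \<in> U" "f p \<in> V" "z = \<phi> p" by blast
    then obtain r \<gamma> where d: "disc P p r \<gamma>" "holomorphic_map (plane (ball 0 r)) Q (f \<circ> \<gamma>)" using f c(4) by blast
    define N where "N = {p \<in> U \<inter> \<gamma> ` ball 0 r. f p \<in> V}"
    have N: "openin (topo P) N" unfolding N_def
      by (intro openin_preimage[OF cont] openin_Int c(1) disc_open_image[OF P d(1)] chartD(1)[OF Q V]) auto
    have "open (\<phi> ` N)" by (rule c(7)[OF N]) (auto simp: N_def)
    moreover have "z \<in> \<phi> ` N" using p discD(1,2)[OF d(1)] by (force simp: N_def)
    moreover have "(\<lambda>z. \<psi> (f (inv_into U \<phi> z))) holomorphic_on \<phi> ` N"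
    proof (rule holomorphic_transform)
      let ?I = "inv_into (ball 0 r) \<gamma>"
      show "((\<lambda>z. \<psi> ((f \<circ> \<gamma>) z)) \<circ> (\<lambda>z. ?I (inv_into U \<phi> z))) holomorphic_on \<phi> ` N"
      proof (rule holomorphic_on_compose_gen)
        show "(\<lambda>z. ?I (inv_into U \<phi> z)) holomorphic_on \<phi> ` N"
          by (rule holomorphic_on_subset[OF disc_inverse_chart[OF P d(1) U]]) (auto simp: N_def)
        show "(\<lambda>z. \<psi> ((f \<circ> \<gamma>) z)) holomorphic_on {z \<in> ball 0 r. (f \<circ> \<gamma>) z \<in> V}"
          using d(2) V unfolding holomorphic_map_from_plane by blast
        show "(\<lambda>z. ?I (inv_into U \<phi> z)) ` \<phi> ` N \<subseteq> {z \<in> ball 0 r. (f \<circ> \<gamma>) z \<in> V}"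
          using c(3) discD(3)[OF d(1)] by (auto simp: N_def)
      qed
    qed (use c(3) discD(3)[OF d(1)] in \<open>auto simp: N_def\<close>)
    ultimately show "\<exists>T. open T \<and> z \<in> T \<and> (\<lambda>z. \<psi> (f (inv_into U \<phi> z))) holomorphic_on T" by blast
  qed
qed

section \<open>Conjugate surfaces\<close>

text \<open>Passing to the conjugate target turns antiholomorphic maps into holomorphic ones, so
  that the results on composition and on discs apply to \<tau> and to complex conjugation.\<close>

definition conj_surface :: "'a surface \<Rightarrow> 'a surface" where
  "conj_surface P = \<lparr>topo = topo P, atlas = (\<lambda>(U, \<phi>). (U, \<lambda>p. cnj (\<phi> p))) ` atlas P\<rparr>"

lemma topo_conj [simp]: "topo (conj_surface P) = topo P"
  by (simp add: conj_surface_def)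

lemma atlas_conj: "(U, \<phi>) \<in> atlas (conj_surface P) \<longleftrightarrow> (\<exists>\<psi>. (U, \<psi>) \<in> atlas P \<and> \<phi> = (\<lambda>p. cnj (\<psi> p)))"
  by (auto simp: conj_surface_def image_iff split: prod.splits)

lemma conj_conj [simp]: "conj_surface (conj_surface P) = P"
proof -
  have "atlas (conj_surface (conj_surface P)) = atlas P"
    unfolding conj_surface_def by (force simp: image_image split_def)
  then show ?thesis by (cases P) (simp add: conj_surface_def)
qed

lemma inv_into_cnj:
  assumes "inj_on \<phi> U" "z \<in> cnj ` \<phi> ` U"
  shows "inv_into U (\<lambda>p. cnj (\<phi> p)) z = inv_into U \<phi> (cnj z)"
proof -
  obtain p where p: "p \<in> U" "z = cnj (\<phi> p)" using assms by blast
  have "inj_on (\<lambda>p. cnj (\<phi> p)) U" using assms(1) by (simp add: inj_on_def)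
  then show ?thesis using p assms(1) by (simp add: inv_into_f_f[of "\<lambda>p. cnj (\<phi> p)"])
qed

lemma cnj_image_cnj: "cnj ` cnj ` A = A"
  by (simp add: image_image)

lemma open_cnj_image: "open A \<Longrightarrow> open (cnj ` A)"
proof -
  assume "open A"
  then have "open (cnj -` A)" by (rule open_vimage) (intro continuous_intros)
  also have "cnj -` A = cnj ` A" by (force simp: image_iff intro: exI[of _ "cnj _"])
  finally show ?thesis .
qed

lemma holomorphic_cnj_cnj_image:
  assumes "g holomorphic_on A" "open A"
  shows "(\<lambda>z. cnj (g (cnj z))) holomorphic_on cnj ` A"
proof -
  have "cnj \<circ> g \<circ> cnj holomorphic_on cnj ` A"
    by (rule holomorphic_on_compose_cnj_cnj) (use assms open_cnj_image in \<open>auto simp: cnj_image_cnj\<close>)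
  then show ?thesis by (simp add: o_def)
qed

lemma is_chart_cnj:
  assumes "is_chart X (U, \<phi>)"
  shows "is_chart X (U, \<lambda>p. cnj (\<phi> p))"
proof -
  note c = is_chartD[OF assms]
  have h: "homeomorphic_map (subtopology X U) (top_of_set (\<phi> ` U)) \<phi>"
    using assms by (simp add: is_chart_def)
  have "homeomorphic_maps (top_of_set (\<phi> ` U)) (top_of_set (cnj ` \<phi> ` U)) cnj cnj"
    by (auto simp: homeomorphic_maps_def continuous_map_in_subtopology intro!: continuous_intros)
  then have "homeomorphic_map (top_of_set (\<phi> ` U)) (top_of_set (cnj ` \<phi> ` U)) cnj"
    using homeomorphic_maps_imp_map by blast
  then have "homeomorphic_map (subtopology X U) (top_of_set (cnj ` \<phi> ` U)) (cnj \<circ> \<phi>)"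
    using homeomorphic_map_compose[OF h] by blast
  then show ?thesis using c(1,2) by (simp add: is_chart_def image_comp[symmetric] o_def open_cnj_image image_image[symmetric])
qed

lemma transition_holomorphic_cnj:
  assumes "is_chart X (U, \<phi>)" "is_chart X (V, \<psi>)" "transition_holomorphic (U, \<phi>) (V, \<psi>)"
  shows "transition_holomorphic (U, \<lambda>p. cnj (\<phi> p)) (V, \<lambda>p. cnj (\<psi> p))"
proof -
  have "open (\<phi> ` (U \<inter> V))"
    by (rule is_chartD(7)[OF assms(1)]) (use is_chartD(1)[OF assms(1)] is_chartD(1)[OF assms(2)] in auto)
  with assms(3) have "(\<lambda>z. cnj (\<psi> (inv_into U \<phi> (cnj z)))) holomorphic_on cnj ` \<phi> ` (U \<inter> V)"
    unfolding transition_holomorphic_def by (intro holomorphic_cnj_cnj_image) auto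
  then have "(\<lambda>z. cnj (\<psi> (inv_into U (\<lambda>p. cnj (\<phi> p)) z))) holomorphic_on cnj ` \<phi> ` (U \<inter> V)"
    by (rule holomorphic_transform) (use is_chartD(3)[OF assms(1)] in \<open>auto simp: inv_into_cnj\<close>)
  then show ?thesis by (simp add: transition_holomorphic_def image_image)
qed

lemma complex_atlas_conj:
  assumes P: "complex_atlas P"
  shows "complex_atlas (conj_surface P)"
  unfolding complex_atlas_def
proof (intro conjI ballI)
  show "is_chart (topo (conj_surface P)) c" if "c \<in> atlas (conj_surface P)" for c
    using that chart_is_chart[OF P] by (cases c) (auto simp: atlas_conj is_chart_cnj)
  show "(\<Union>(U, \<phi>)\<in>atlas (conj_surface P). U) = points (conj_surface P)"
    using P by (auto simp: complex_atlas_def conj_surface_def split_def)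
  show "compatible c d" if cd: "c \<in> atlas (conj_surface P)" "d \<in> atlas (conj_surface P)" for c d
  proof -
    obtain U a V b where 0: "c = (U, a)" "d = (V, b)" by (cases c, cases d)
    from cd[unfolded 0 atlas_conj] obtain \<phi> \<psi> where "(U, \<phi>) \<in> atlas P" "a = (\<lambda>p. cnj (\<phi> p))" "(V, \<psi>) \<in> atlas P" "b = (\<lambda>p. cnj (\<psi> p))"
      by blast
    with 0 have *: "c = (U, \<lambda>p. cnj (\<phi> p))" "(U, \<phi>) \<in> atlas P" "d = (V, \<lambda>p. cnj (\<psi> p))" "(V, \<psi>) \<in> atlas P"
      by simp_all
    then have "compatible (U, \<phi>) (V, \<psi>)" using P by (auto simp: complex_atlas_def)
    then show ?thesis using * chart_is_chart[OF P]
      by (auto simp: compatible_def intro: transition_holomorphic_cnj)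
  qed
qed

lemma antiholomorphic_map_iff: "antiholomorphic_map P Q f \<longleftrightarrow> holomorphic_map P (conj_surface Q) f"
  unfolding antiholomorphic_map_def holomorphic_map_def by (simp add: conj_surface_def split_def)

lemma holomorphic_map_conj:
  assumes P: "complex_atlas P" and Q: "complex_atlas Q" and f: "holomorphic_map P Q f"
  shows "holomorphic_map (conj_surface P) (conj_surface Q) f"
proof (rule holomorphic_mapI)
  show cf: "continuous_map (topo (conj_surface P)) (topo (conj_surface Q)) f" using holomorphic_mapD(1)[OF f] by simp
  fix U \<phi> V \<psi> assume "(U, \<phi>) \<in> atlas (conj_surface P)" "(V, \<psi>) \<in> atlas (conj_surface Q)"
  then obtain \<phi>' \<psi>' where *: "\<phi> = (\<lambda>p. cnj (\<phi>' p))" "(U, \<phi>') \<in> atlas P" "\<psi> = (\<lambda>p. cnj (\<psi>' p))" "(V, \<psi>') \<in> atlas Q"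
    by (auto simp: atlas_conj)
  note c = chartD[OF P *(2)]
  have "openin (topo P) {p \<in> U. f p \<in> V}"
    using openin_preimage[OF cf] c(1) chartD(1)[OF Q *(4)] by simp
  then have "open (\<phi>' ` {p \<in> U. f p \<in> V})" by (rule c(7)) auto
  from holomorphic_cnj_cnj_image[OF holomorphic_mapD(2)[OF f *(2,4)] this]
  have "(\<lambda>z. \<psi> (f (inv_into U \<phi> z))) holomorphic_on cnj ` \<phi>' ` {p \<in> U. f p \<in> V}"
    by (rule holomorphic_transform) (use c(3) * in \<open>auto simp: inv_into_cnj\<close>)
  then show "(\<lambda>z. \<psi> (f (inv_into U \<phi> z))) holomorphic_on \<phi> ` {p \<in> U. f p \<in> V}"
    using * by (simp add: image_image)
qed

lemma holomorphic_map_plane_cnj: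
  assumes Q: "complex_atlas Q" and V: "open V" and f: "holomorphic_map (plane V) Q f"
  shows "holomorphic_map (plane (cnj ` V)) (conj_surface Q) (\<lambda>z. f (cnj z))"
  unfolding holomorphic_map_from_plane
proof (intro conjI allI impI)
  have c: "continuous_map (top_of_set V) (topo Q) f" using f by (simp add: holomorphic_map_from_plane)
  have "continuous_map (top_of_set (cnj ` V)) (topo Q) (f \<circ> cnj)"
    by (rule continuous_map_compose[OF _ c]) (auto simp: continuous_map_in_subtopology intro!: continuous_intros)
  then show "continuous_map (top_of_set (cnj ` V)) (topo (conj_surface Q)) (\<lambda>z. f (cnj z))" by (simp add: o_def)
  fix W \<psi> assume "(W, \<psi>) \<in> atlas (conj_surface Q)"
  then obtain \<psi>' where \<psi>: "\<psi> = (\<lambda>p. cnj (\<psi>' p))" "(W, \<psi>') \<in> atlas Q" by (auto simp: atlas_conj)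
  have "(\<lambda>z. \<psi>' (f z)) holomorphic_on {z \<in> V. f z \<in> W}" using f \<psi>(2) by (simp add: holomorphic_map_from_plane)
  moreover have "open {z \<in> V. f z \<in> W}" by (rule open_plane_preimage[OF c V chartD(1)[OF Q \<psi>(2)]])
  ultimately have "(\<lambda>z. cnj (\<psi>' (f (cnj z)))) holomorphic_on cnj ` {z \<in> V. f z \<in> W}"
    by (rule holomorphic_cnj_cnj_image)
  moreover have "cnj ` {z \<in> V. f z \<in> W} = {z \<in> cnj ` V. f (cnj z) \<in> W}" by force
  ultimately show "(\<lambda>z. \<psi> (f (cnj z))) holomorphic_on {z \<in> cnj ` V. f (cnj z) \<in> W}" by (simp add: \<psi>(1))
qed

lemma cnj_image_ball_0 [simp]: "cnj ` ball 0 r = ball 0 r"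
proof -
  have "z \<in> cnj ` ball 0 r" if "z \<in> ball 0 r" for z
    by (rule image_eqI[of _ _ "cnj z"]) (use that in auto)
  then show ?thesis by auto
qed

lemma disc_conj:
  assumes P: "complex_atlas P" and d: "disc P p r \<gamma>"
  shows "disc (conj_surface P) p r (\<lambda>z. \<gamma> (cnj z))"
proof -
  have "holomorphic_map (plane (ball 0 r)) (conj_surface P) (\<lambda>z. \<gamma> (cnj z))"
    using holomorphic_map_plane_cnj[OF P open_ball discD(4)[OF d]] by simp
  moreover have "inj_on (\<lambda>z. \<gamma> (cnj z)) (ball 0 r)"
  proof (rule inj_onI)
    fix x y :: complex assume "x \<in> ball 0 r" "y \<in> ball 0 r" "\<gamma> (cnj x) = \<gamma> (cnj y)"
    then have "cnj x = cnj y" using discD(3)[OF d] by (auto dest!: inj_onD)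
    then show "x = y" by simp
  qed
  ultimately show ?thesis using discD[OF d] by (simp add: disc_def)
qed

text \<open>Composition with \<open>g\<close> yields a disc of the conjugate surface; conjugating
  its parameter makes it a disc of \<open>Q\<close> itself.\<close>

lemma disc_antiholomorphic_image:
  assumes P: "complex_atlas P" and Q: "complex_atlas Q" and d: "disc P p r \<gamma>"
    and g: "antiholomorphic_map P Q g" "inj_on g (points P)"
  shows "disc Q (g p) r (\<lambda>z. g (\<gamma> (cnj z)))"
proof -
  have "disc (conj_surface Q) (g p) r (g \<circ> \<gamma>)"
    using disc_image[OF P complex_atlas_conj[OF Q] d] g by (simp add: antiholomorphic_map_iff)
  from disc_conj[OF complex_atlas_conj[OF Q] this] show ?thesis by (simp add: o_def)
qed


section \<open>Ramification in terms of discs\<close>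

text \<open>Up to shrinking, discs and local coordinates are inverse to each other; this lemma and
  \<open>local_coordinate_disc\<close> are the two directions.\<close>

lemma disc_local_coordinate:
  assumes P: "complex_atlas P" and d: "disc P p r \<gamma>"
  shows "local_coordinate P p (\<gamma> ` ball 0 r, inv_into (ball 0 r) \<gamma>)"
proof -
  let ?I = "inv_into (ball 0 r) \<gamma>"
  have img: "?I ` \<gamma> ` ball 0 r = ball 0 r" using discD(3)[OF d] by (auto simp: image_image)
  note o = disc_neighbourhood(1)[OF P d]
  have "homeomorphic_map (top_of_set (ball 0 r)) (subtopology (topo P) (\<gamma> ` ball 0 r)) \<gamma>"
  proof (rule bijective_open_imp_homeomorphic_map)
    show "continuous_map (top_of_set (ball 0 r)) (subtopology (topo P) (\<gamma> ` ball 0 r)) \<gamma>"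
      using discD(5)[OF d] by (auto simp: continuous_map_in_subtopology)
    show "open_map (top_of_set (ball 0 r)) (subtopology (topo P) (\<gamma> ` ball 0 r)) \<gamma>"
      unfolding open_map_def
    proof (intro allI impI)
      fix A :: "complex set" assume "openin (top_of_set (ball 0 r)) A"
      then have "open A" "A \<subseteq> ball 0 r" by (auto simp: openin_open_eq)
      then have "openin (topo P) (\<gamma> ` A)" "\<gamma> ` A \<subseteq> \<gamma> ` ball 0 r" using disc_open_image[OF P d] by auto
      then show "openin (subtopology (topo P) (\<gamma> ` ball 0 r)) (\<gamma> ` A)"
        using o by (simp add: openin_open_subtopology)
    qed
    show "\<gamma> ` topspace (top_of_set (ball 0 r)) = topspace (subtopology (topo P) (\<gamma> ` ball 0 r))"
      using discD(7)[OF d] by auto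
  qed (use discD(3)[OF d] in auto)
  then obtain g where g: "homeomorphic_maps (top_of_set (ball 0 r)) (subtopology (topo P) (\<gamma> ` ball 0 r)) \<gamma> g"
    using homeomorphic_map_maps by blast
  then have "homeomorphic_map (subtopology (topo P) (\<gamma> ` ball 0 r)) (top_of_set (ball 0 r)) g"
    using homeomorphic_maps_sym homeomorphic_maps_imp_map by blast
  then have "homeomorphic_map (subtopology (topo P) (\<gamma> ` ball 0 r)) (top_of_set (ball 0 r)) ?I"
    by (rule homeomorphic_map_eq) (use g discD(3)[OF d] in \<open>auto simp: homeomorphic_maps_def\<close>)
  then have chart: "is_chart (topo P) (\<gamma> ` ball 0 r, ?I)" using o by (simp add: is_chart_def img)
  have "compatible (\<gamma> ` ball 0 r, ?I) (V, \<psi>)" if V: "(V, \<psi>) \<in> atlas P" for V \<psi>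
  proof -
    have inv: "inv_into (\<gamma> ` ball 0 r) ?I z = \<gamma> z" if "z \<in> ball 0 r" for z
      by (rule inv_into_f_eq) (use that discD(3)[OF d] in \<open>auto simp: inj_on_inv_into\<close>)
    have "?I ` (\<gamma> ` ball 0 r \<inter> V) = {z \<in> ball 0 r. \<gamma> z \<in> V}"
      using discD(3)[OF d] by (force simp: image_iff)
    with discD(6)[OF d V] have "(\<lambda>z. \<psi> (\<gamma> z)) holomorphic_on ?I ` (\<gamma> ` ball 0 r \<inter> V)" by simp
    then have "transition_holomorphic (\<gamma> ` ball 0 r, ?I) (V, \<psi>)"
      unfolding transition_holomorphic_def prod.case
      by (rule holomorphic_transform) (use inv discD(3)[OF d] in auto)
    moreover have "transition_holomorphic (V, \<psi>) (\<gamma> ` ball 0 r, ?I)"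
      unfolding transition_holomorphic_def using disc_inverse_chart[OF P d V] by simp
    ultimately show ?thesis by (simp add: compatible_def)
  qed
  moreover have "p \<in> \<gamma> ` ball 0 r" "?I p = 0"
    using discD(1,2,3)[OF d] by (auto intro: image_eqI[of _ _ 0] inv_into_f_eq)
  ultimately show ?thesis using chart by (auto simp: local_coordinate_def)
qed

lemma local_coordinate_disc:
  assumes c: "local_coordinate P p (U, \<phi>)" and r: "r > 0" "ball 0 r \<subseteq> \<phi> ` U"
  shows "disc P p r (inv_into U \<phi>)"
proof -
  have ch: "is_chart (topo P) (U, \<phi>)" and comp: "\<And>d. d \<in> atlas P \<Longrightarrow> compatible (U, \<phi>) d"
    and p: "p \<in> U" "\<phi> p = 0" using c by (auto simp: local_coordinate_def)
  note c = is_chartD[OF ch]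
  have "holomorphic_map (plane (ball 0 r)) P (inv_into U \<phi>)"
    unfolding holomorphic_map_from_plane
  proof (intro conjI allI impI)
    show "continuous_map (top_of_set (ball 0 r)) (topo P) (inv_into U \<phi>)"
      using continuous_map_from_subtopology_mono[OF c(6) r(2)] .
    fix W \<psi> assume W: "(W, \<psi>) \<in> atlas P"
    have "(\<lambda>z. \<psi> (inv_into U \<phi> z)) holomorphic_on \<phi> ` (U \<inter> W)"
      using comp[OF W] unfolding compatible_def transition_holomorphic_def by simp
    moreover have "{z \<in> ball 0 r. inv_into U \<phi> z \<in> W} \<subseteq> \<phi> ` (U \<inter> W)"
      using r(2) c(3) by fastforce
    ultimately show "(\<lambda>z. \<psi> (inv_into U \<phi> z)) holomorphic_on {z \<in> ball 0 r. inv_into U \<phi> z \<in> W}"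
      using holomorphic_on_subset by blast
  qed
  moreover have "inj_on (inv_into U \<phi>) (ball 0 r)" using r(2) inj_on_inv_into by blast
  moreover have "inv_into U \<phi> 0 = p" using p c(3) by (metis inv_into_f_f)
  ultimately show ?thesis using r by (simp add: disc_def)
qed

text \<open>Ramification in terms of discs. The target radius is \<open>r ^ n\<close> because
  \<open>z ^ n\<close> maps the ball of radius \<open>r\<close> onto the ball of that
  radius.\<close>

definition power_form ::
    "'a surface \<Rightarrow> 'b surface \<Rightarrow> ('a \<Rightarrow> 'b) \<Rightarrow> 'a \<Rightarrow> nat \<Rightarrow> real \<Rightarrow> (complex \<Rightarrow> 'a) \<Rightarrow> (complex \<Rightarrow> 'b) \<Rightarrow> bool" where
  "power_form P Q f p n r \<gamma> \<delta> \<longleftrightarrow> n > 0 \<and> disc P p r \<gamma> \<and> disc Q (f p) (r ^ n) \<delta> \<and>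
     (\<forall>z\<in>ball 0 r. f (\<gamma> z) = \<delta> (z ^ n))"

lemma power_mem_ball_0: "z \<in> ball (0::complex) r \<Longrightarrow> n > 0 \<Longrightarrow> z ^ n \<in> ball 0 (r ^ n)"
  by (simp add: norm_power power_strict_mono)

lemma power_image_ball_0:
  assumes "r > 0" "n > 0"
  shows "(\<lambda>z::complex. z ^ n) ` ball 0 r = ball 0 (r ^ n)"
proof
  show "(\<lambda>z::complex. z ^ n) ` ball 0 r \<subseteq> ball 0 (r ^ n)" using power_mem_ball_0[OF _ assms(2)] by blast
  show "ball 0 (r ^ n) \<subseteq> (\<lambda>z::complex. z ^ n) ` ball 0 r"
  proof
    fix t :: complex assume t: "t \<in> ball 0 (r ^ n)"
    have "n \<noteq> 0" using assms by simp
    then obtain z where z: "t = z ^ n" by (rule exists_complex_root)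
    then have "norm z ^ n < r ^ n" using t by (simp add: norm_power)
    then have "norm z < r" using assms by (simp add: power_less_imp_less_base)
    then show "t \<in> (\<lambda>z. z ^ n) ` ball 0 r" using z by auto
  qed
qed

lemma has_ramification_iff_power_form:
  assumes P: "complex_atlas P" and Q: "complex_atlas Q"
  shows "has_ramification P Q f p n \<longleftrightarrow> (\<exists>r \<gamma> \<delta>. power_form P Q f p n r \<gamma> \<delta>)"
proof
  assume "has_ramification P Q f p n"
  then obtain U \<phi> V \<psi> where n: "n > 0" and U: "local_coordinate P p (U, \<phi>)" and V: "local_coordinate Q (f p) (V, \<psi>)"
      and f: "f ` U \<subseteq> V" "\<And>q. q \<in> U \<Longrightarrow> \<psi> (f q) = \<phi> q ^ n"
    unfolding has_ramification_def by blast
  have cU: "is_chart (topo P) (U, \<phi>)" and cV: "is_chart (topo Q) (V, \<psi>)"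
    using U V by (auto simp: local_coordinate_def)
  have 0: "0 \<in> \<phi> ` U" "0 \<in> \<psi> ` V" using U V by (force simp: local_coordinate_def)+
  obtain r1 where r1: "r1 > 0" "ball 0 r1 \<subseteq> \<phi> ` U" using is_chartD(2)[OF cU] 0 open_contains_ball by blast
  obtain r2 where r2: "r2 > 0" "ball 0 r2 \<subseteq> \<psi> ` V" using is_chartD(2)[OF cV] 0 open_contains_ball by blast
  \<comment> \<open>The bound 1 ensures \<open>r ^ n \<le> r\<close>, so that the target ball fits
    into the image of the coordinate \<psi> as well.\<close>
  define r where "r = min (min r1 r2) 1"
  have r: "0 < r" "r \<le> r1" "r \<le> 1" "r \<le> r2" using r1 r2 by (auto simp: r_def)
  have "r ^ n \<le> r ^ 1" by (rule power_decreasing) (use r n in auto)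
  then have rn: "r ^ n \<le> r2" "r ^ n > 0" using r by auto
  have sub: "ball 0 r \<subseteq> \<phi> ` U" "ball 0 (r ^ n) \<subseteq> \<psi> ` V" using r1 r2 r rn by (meson subset_ball subset_trans)+
  have "f (inv_into U \<phi> z) = inv_into V \<psi> (z ^ n)" if "z \<in> ball 0 r" for z
  proof -
    have z: "z \<in> \<phi> ` U" using that sub by blast
    have q: "inv_into U \<phi> z \<in> U" "\<phi> (inv_into U \<phi> z) = z" using z by (auto simp: inv_into_into f_inv_into_f)
    then have "\<psi> (f (inv_into U \<phi> z)) = z ^ n" "f (inv_into U \<phi> z) \<in> V" using f by auto
    then show ?thesis using is_chartD(3)[OF cV] by (metis inv_into_f_f)
  qed
  then have "power_form P Q f p n r (inv_into U \<phi>) (inv_into V \<psi>)"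
    using n local_coordinate_disc[OF U r(1) sub(1)] local_coordinate_disc[OF V rn(2) sub(2)]
    by (simp add: power_form_def)
  then show "\<exists>r \<gamma> \<delta>. power_form P Q f p n r \<gamma> \<delta>" by blast
next
  assume "\<exists>r \<gamma> \<delta>. power_form P Q f p n r \<gamma> \<delta>"
  then obtain r \<gamma> \<delta> where n: "n > 0" and d: "disc P p r \<gamma>" and d': "disc Q (f p) (r ^ n) \<delta>"
    and eq: "\<And>z. z \<in> ball 0 r \<Longrightarrow> f (\<gamma> z) = \<delta> (z ^ n)"
    by (auto simp: power_form_def)
  let ?U = "\<gamma> ` ball 0 r" and ?V = "\<delta> ` ball 0 (r ^ n)"
  have "f ` ?U \<subseteq> ?V" using eq power_mem_ball_0 n by fastforce
  moreover have "inv_into (ball 0 (r ^ n)) \<delta> (f q) = inv_into (ball 0 r) \<gamma> q ^ n" if q: "q \<in> ?U" for q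
  proof -
    obtain z where z: "z \<in> ball 0 r" "q = \<gamma> z" using q by blast
    then show ?thesis using eq[OF z(1)] discD(3)[OF d] discD(3)[OF d'] power_mem_ball_0[OF z(1) n] by simp
  qed
  ultimately show "has_ramification P Q f p n"
    unfolding has_ramification_def using n disc_local_coordinate[OF P d] disc_local_coordinate[OF Q d'] by blast
qed

text \<open>Both sides vanish at 0, to the exact orders \<open>n\<close> and \<open>m\<close>: after
  division by the respective power of \<open>z\<close> their limits are nonzero, and a surplus power
  of \<open>z\<close> would force one of them to be 0.\<close>

lemma power_order_unique:
  fixes \<alpha> \<beta> :: "complex \<Rightarrow> complex"
  assumes e: "e > 0" and a: "\<alpha> holomorphic_on ball 0 e" "\<alpha> 0 = 0" "deriv \<alpha> 0 \<noteq> 0"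
    and b: "\<beta> holomorphic_on ball 0 e" "\<beta> 0 = 0" "deriv \<beta> 0 \<noteq> 0"
    and nm: "n > 0" "m > 0" and eq: "\<forall>\<^sub>F z in at 0. \<beta> (z ^ n) = \<alpha> z ^ m"
  shows "n = m"
proof -
  have q: "((\<lambda>z. f z / z) \<longlongrightarrow> deriv f 0) (at 0)" if "f holomorphic_on ball 0 e" "f 0 = 0" for f :: "complex \<Rightarrow> complex"
  proof -
    have "(f has_field_derivative deriv f 0) (at 0)"
      using that e by (intro holomorphic_derivI[of f "ball 0 e"]) auto
    then show ?thesis using that by (simp add: DERIV_def)
  qed
  have pw: "filterlim (\<lambda>z::complex. z ^ n) (at 0) (at 0)"
  proof (rule filterlim_atI)
    show "((\<lambda>z::complex. z ^ n) \<longlongrightarrow> 0) (at 0)" using nm by (auto intro!: tendsto_eq_intros)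
    show "\<forall>\<^sub>F z::complex in at 0. z ^ n \<noteq> 0" unfolding eventually_at by (intro exI[of _ 1]) auto
  qed
  have B: "((\<lambda>z. \<beta> (z ^ n) / z ^ n) \<longlongrightarrow> deriv \<beta> 0) (at 0)"
    using filterlim_compose[OF q[OF b(1,2)] pw] .
  have A: "((\<lambda>z. (\<alpha> z / z) ^ m) \<longlongrightarrow> deriv \<alpha> 0 ^ m) (at 0)"
    by (intro tendsto_power q a)
  have ne: "\<forall>\<^sub>F z::complex in at 0. z \<noteq> 0" by (auto simp: eventually_at intro: exI[of _ 1])
  have vanish: "y = 0" if "k > 0" "(u \<longlongrightarrow> x) (at 0)" "(v \<longlongrightarrow> y) (at 0)" "\<forall>\<^sub>F z in at 0. z ^ k * u z = v z"
    for k x y and u v :: "complex \<Rightarrow> complex"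
  proof -
    have "((\<lambda>z. z ^ k * u z) \<longlongrightarrow> 0 ^ k * x) (at 0)" by (intro tendsto_mult tendsto_power tendsto_ident_at that)
    then have "(v \<longlongrightarrow> 0 ^ k * x) (at 0)" using that(4) by (rule Lim_transform_eventually)
    then show ?thesis using LIM_unique[OF that(3)] that(1) by (simp add: zero_power)
  qed
  show ?thesis
  proof (rule ccontr)
    assume "n \<noteq> m"
    then consider k where "k > 0" "n = m + k" | k where "k > 0" "m = n + k"
      by (metis less_imp_add_positive linorder_neqE_nat)
    then show False
    proof cases
      case 1
      have "\<forall>\<^sub>F z in at 0. z ^ k * (\<beta> (z ^ n) / z ^ n) = (\<alpha> z / z) ^ m"
        using eq ne by eventually_elim (simp add: 1 power_add power_divide)
      from vanish[OF \<open>k > 0\<close> B A this] show False using a by simp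
    next
      case 2
      have "\<forall>\<^sub>F z in at 0. z ^ k * (\<alpha> z / z) ^ m = \<beta> (z ^ n) / z ^ n"
        using eq ne by eventually_elim (simp add: 2 power_add power_divide)
      from vanish[OF \<open>k > 0\<close> A B this] show False using b by simp
    qed
  qed
qed

lemma power_form_unique:
  assumes P: "complex_atlas P" and Q: "complex_atlas Q"
    and f: "power_form P Q f p n r \<gamma> \<delta>" "power_form P Q f p n' r' \<gamma>' \<delta>'"
  shows "n = n'"
proof -
  have n: "n > 0" "n' > 0" and d: "disc P p r \<gamma>" "disc P p r' \<gamma>'"
    and D: "disc Q (f p) (r ^ n) \<delta>" "disc Q (f p) (r' ^ n') \<delta>'"
    and eq: "\<And>z. z \<in> ball 0 r \<Longrightarrow> f (\<gamma> z) = \<delta> (z ^ n)" "\<And>z. z \<in> ball 0 r' \<Longrightarrow> f (\<gamma>' z) = \<delta>' (z ^ n')"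
    using f by (auto simp: power_form_def)
  obtain e1 \<alpha> where \<alpha>: "0 < e1" "e1 \<le> r" "\<alpha> holomorphic_on ball 0 e1" "\<alpha> 0 = 0" "deriv \<alpha> 0 \<noteq> 0"
      "\<alpha> ` ball 0 e1 \<subseteq> ball 0 r'" "\<And>z. z \<in> ball 0 e1 \<Longrightarrow> \<gamma> z = \<gamma>' (\<alpha> z)"
    by (rule disc_transition[OF P d]) (rule that)
  obtain e2 \<beta> where \<beta>: "0 < e2" "e2 \<le> r ^ n" "\<beta> holomorphic_on ball 0 e2" "\<beta> 0 = 0" "deriv \<beta> 0 \<noteq> 0"
      "\<beta> ` ball 0 e2 \<subseteq> ball 0 (r' ^ n')" "\<And>z. z \<in> ball 0 e2 \<Longrightarrow> \<delta> z = \<delta>' (\<beta> z)"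
    by (rule disc_transition[OF Q D]) (rule that)
  define e where "e = min e1 e2"
  have "((\<lambda>z::complex. z ^ n) \<longlongrightarrow> 0) (at 0)" using n by (auto intro!: tendsto_eq_intros)
  then have "\<forall>\<^sub>F z::complex in at 0. z ^ n \<in> ball 0 e2" using \<beta>(1) by (auto dest!: tendstoD[where e=e2])
  moreover have "\<forall>\<^sub>F z::complex in at 0. z \<in> ball 0 e1" using \<alpha>(1) by (auto simp: eventually_at dist_norm)
  ultimately have ev: "\<forall>\<^sub>F z in at 0. \<beta> (z ^ n) = \<alpha> z ^ n'"
  proof eventually_elim
    case (elim z)
    have z: "z \<in> ball 0 r" "\<alpha> z \<in> ball 0 r'" "\<beta> (z ^ n) \<in> ball 0 (r' ^ n')"
      using elim \<alpha>(2) image_subset_iff[THEN iffD1, OF \<alpha>(6)] image_subset_iff[THEN iffD1, OF \<beta>(6)] by auto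
    have "\<delta>' (\<beta> (z ^ n)) = \<delta>' (\<alpha> z ^ n')"
      using eq(1)[OF z(1)] eq(2)[OF z(2)] \<alpha>(7)[OF elim(2)] \<beta>(7)[OF elim(1)] by simp
    then show ?case using discD(3)[OF D(2)] z(3) power_mem_ball_0[OF z(2) n(2)] by (auto dest: inj_onD)
  qed
  show ?thesis
    by (rule power_order_unique[of e \<alpha> \<beta>, OF _ _ \<alpha>(4,5) _ \<beta>(4,5) n ev])
      (use \<alpha> \<beta> in \<open>auto simp: e_def intro: holomorphic_on_subset\<close>)
qed

text \<open>Uniqueness of the exponent gives the description by \<open>THE\<close> in
  \<open>ramification\<close> its meaning.\<close>

lemma ramification_eq:
  assumes P: "complex_atlas P" and Q: "complex_atlas Q" and f: "power_form P Q f p n r \<gamma> \<delta>"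
  shows "ramification P Q f p = n"
  unfolding ramification_def has_ramification_iff_power_form[OF P Q]
  using f power_form_unique[OF P Q] by (intro the_equality) blast+

section \<open>Maps to and from the sphere\<close>

lemma points_sphere [simp]: "points riemann_sphere = UNIV"
  by (auto simp: riemann_sphere_def UNIV_option_conv)

lemma complex_atlas_sphere: "complex_atlas riemann_sphere"
  using compact_riemann_surface_riemann_sphere
  by (simp add: compact_riemann_surface_def riemann_surface_complex_atlas)

lemma atlas_sphere: "atlas riemann_sphere = {(UNIV - {None}, the), (UNIV - {Some 0}, sphere_chart_at_infinity)}"
  by (simp add: riemann_sphere_def)

lemma topo_sphere: "topo riemann_sphere = sphere_topology"
  by (simp add: riemann_sphere_def)

lemma sphere_recip_simps [simp]:
  "sphere_recip None = Some 0" "sphere_recip (Some 0) = None"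
  "z \<noteq> 0 \<Longrightarrow> sphere_recip (Some z) = Some (inverse z)"
  by (simp_all add: sphere_recip_def)

lemma sphere_recip_eq_None [simp]: "sphere_recip w = None \<longleftrightarrow> w = Some 0"
  by (auto simp: sphere_recip_def split: option.splits)

lemma inj_sphere_recip: "inj sphere_recip"
  by (metis injI sphere_recip_sphere_recip)

lemma holomorphic_map_Some: "holomorphic_map (plane UNIV) riemann_sphere Some"
  unfolding holomorphic_map_from_plane
proof (intro conjI allI impI)
  show "continuous_map (top_of_set UNIV) (topo riemann_sphere) Some"
    by (simp add: topo_sphere continuous_map_Some)
  fix W \<psi> assume "(W, \<psi>) \<in> atlas riemann_sphere"
  then consider "W = UNIV - {None}" "\<psi> = the" | "W = UNIV - {Some 0}" "\<psi> = sphere_chart_at_infinity"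
    by (auto simp: atlas_sphere)
  then show "(\<lambda>z. \<psi> (Some z)) holomorphic_on {z \<in> UNIV. Some z \<in> W}"
    by cases (auto simp: sphere_chart_at_infinity_def intro!: holomorphic_intros)
qed

lemma holomorphic_map_Some_comp:
  assumes "u holomorphic_on V" "open V"
  shows "holomorphic_map (plane V) riemann_sphere (\<lambda>z. Some (u z))"
  using holomorphic_map_compose[OF complex_atlas_plane complex_atlas_plane complex_atlas_sphere _ holomorphic_map_Some, of V u] assms
  by (simp add: holomorphic_map_planes o_def)

lemma holomorphic_map_recip_Some: "holomorphic_map (plane UNIV) riemann_sphere (\<lambda>z. sphere_recip (Some z))"
  unfolding holomorphic_map_from_plane
proof (intro conjI allI impI)
  show "continuous_map (top_of_set UNIV) (topo riemann_sphere) (\<lambda>z. sphere_recip (Some z))"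
    using continuous_map_compose[OF continuous_map_Some continuous_map_sphere_recip]
    by (simp add: topo_sphere o_def)
  fix W \<psi> assume "(W, \<psi>) \<in> atlas riemann_sphere"
  then consider "W = UNIV - {None}" "\<psi> = the" | "W = UNIV - {Some 0}" "\<psi> = sphere_chart_at_infinity"
    by (auto simp: atlas_sphere)
  then show "(\<lambda>z. \<psi> (sphere_recip (Some z))) holomorphic_on {z \<in> UNIV. sphere_recip (Some z) \<in> W}"
  proof cases
    case 1
    have "inverse holomorphic_on {z::complex. z \<noteq> 0}" by (intro holomorphic_intros) auto
    then show ?thesis using 1 by (auto intro: holomorphic_transform)
  next
    case 2
    have "(\<lambda>z. z) holomorphic_on {z \<in> UNIV. sphere_recip (Some z) \<in> W}" by (intro holomorphic_intros)
    then show ?thesis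
      by (rule holomorphic_transform) (auto simp: 2 sphere_chart_at_infinity_def sphere_recip_def)
  qed
qed

lemma holomorphic_map_recip_Some_comp:
  assumes "u holomorphic_on V" "open V"
  shows "holomorphic_map (plane V) riemann_sphere (\<lambda>z. sphere_recip (Some (u z)))"
  using holomorphic_map_compose[OF complex_atlas_plane complex_atlas_plane complex_atlas_sphere _ holomorphic_map_recip_Some, of V u] assms
  by (simp add: holomorphic_map_planes o_def)

lemma holomorphic_map_disc_comp:
  assumes "complex_atlas P" "complex_atlas Q" "holomorphic_map P Q k" "disc P p r \<gamma>"
  shows "holomorphic_map (plane (ball 0 r)) Q (\<lambda>z. k (\<gamma> z))"
  using holomorphic_map_compose[OF complex_atlas_plane[OF open_ball] assms(1,2) discD(4)[OF assms(4)] assms(3)]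
  by (simp add: o_def)

lemma holomorphic_on_the:
  assumes "holomorphic_map (plane V) riemann_sphere F" "\<And>z. z \<in> V \<Longrightarrow> F z \<noteq> None"
  shows "(\<lambda>z. the (F z)) holomorphic_on V"
proof -
  have "(\<lambda>z. the (F z)) holomorphic_on {z \<in> V. F z \<in> UNIV - {None}}"
    using assms(1) unfolding holomorphic_map_from_plane by (simp add: atlas_sphere)
  moreover have "{z \<in> V. F z \<in> UNIV - {None}} = V" using assms(2) by auto
  ultimately show ?thesis by simp
qed

lemma holomorphic_on_the_disc:
  assumes "complex_atlas P" "holomorphic_map P riemann_sphere k" "disc P p r \<gamma>" "\<And>z. z \<in> ball 0 r \<Longrightarrow> k (\<gamma> z) \<noteq> None"
  shows "(\<lambda>z. the (k (\<gamma> z))) holomorphic_on ball 0 r"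
  by (rule holomorphic_on_the[OF holomorphic_map_disc_comp[OF assms(1) complex_atlas_sphere assms(2,3)] assms(4)])

lemma openin_sphere_finite: "openin sphere_topology (UNIV - {None})"
  using chartD(1)[OF complex_atlas_sphere, of "UNIV - {None}" the] by (simp add: atlas_sphere topo_sphere)

text \<open>A parametrization of the sphere near \<open>c\<close> that sends 0 to \<open>c\<close>:
  a translation at a finite point, \<open>1 / t\<close> at infinity. It gives zeros and poles the
  same normal form.\<close>

definition sphere_shift :: "complex option \<Rightarrow> complex \<Rightarrow> complex option" where
  "sphere_shift c t = (case c of None \<Rightarrow> sphere_recip (Some t) | Some a \<Rightarrow> Some (a + t))"

lemma sphere_shift_simps [simp]:
  "sphere_shift None t = sphere_recip (Some t)" "sphere_shift (Some a) t = Some (a + t)"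
  by (simp_all add: sphere_shift_def)

lemma sphere_shift_0 [simp]: "sphere_shift c 0 = c"
  by (cases c) auto

lemma inj_sphere_shift: "inj (sphere_shift c)"
proof (cases c)
  case None
  then show ?thesis using inj_sphere_recip by (auto simp: inj_def)
qed (auto simp: inj_def)

lemma holomorphic_map_sphere_shift_comp:
  assumes "u holomorphic_on V" "open V"
  shows "holomorphic_map (plane V) riemann_sphere (\<lambda>z. sphere_shift c (u z))"
proof (cases c)
  case None
  then show ?thesis using holomorphic_map_recip_Some_comp[OF assms] by simp
next
  case (Some a)
  have "(\<lambda>z. a + u z) holomorphic_on V" by (intro holomorphic_intros assms)
  then show ?thesis using Some holomorphic_map_Some_comp[OF _ assms(2)] by simp
qed

lemma disc_sphere_shift: "r > 0 \<Longrightarrow> disc riemann_sphere c r (sphere_shift c)"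
  unfolding disc_def using holomorphic_map_sphere_shift_comp[of "\<lambda>z. z" "ball 0 r" c] inj_sphere_shift[of c]
  by (auto intro: inj_on_subset)

lemma holomorphic_map_from_sphere:
  assumes Q: "complex_atlas Q"
    and f: "\<And>c. \<exists>r>0. holomorphic_map (plane (ball 0 r)) Q (\<lambda>z. f (sphere_shift c z))"
  shows "holomorphic_map riemann_sphere Q f"
proof (rule holomorphic_map_local[OF complex_atlas_sphere Q])
  fix c
  obtain r where "r > 0" "holomorphic_map (plane (ball 0 r)) Q (\<lambda>z. f (sphere_shift c z))" using f by blast
  then show "\<exists>r \<gamma>. disc riemann_sphere c r \<gamma> \<and> holomorphic_map (plane (ball 0 r)) Q (f \<circ> \<gamma>)"
    by (intro exI[of _ r] exI[of _ "sphere_shift c"]) (auto simp: disc_sphere_shift o_def)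
qed

lemma holomorphic_map_sphere_recip: "holomorphic_map riemann_sphere riemann_sphere sphere_recip"
proof (rule holomorphic_map_from_sphere[OF complex_atlas_sphere])
  fix c :: "complex option"
  show "\<exists>r>0. holomorphic_map (plane (ball 0 r)) riemann_sphere (\<lambda>z. sphere_recip (sphere_shift c z))"
  proof (cases c)
    case None
    then show ?thesis using holomorphic_map_Some_comp[of "\<lambda>z. z" "ball 0 1"] by (intro exI[of _ 1]) simp
  next
    case (Some a)
    have "(\<lambda>z. a + z) holomorphic_on ball 0 1" by (intro holomorphic_intros)
    then show ?thesis using holomorphic_map_recip_Some_comp[of "\<lambda>z. a + z" "ball 0 1"] Some
      by (intro exI[of _ 1]) simp
  qed
qed

definition sphere_affine :: "complex \<Rightarrow> complex \<Rightarrow> complex option \<Rightarrow> complex option" where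
  "sphere_affine a b = map_option (\<lambda>z. a * z + b)"

lemma sphere_affine_simps [simp]:
  "sphere_affine a b None = None" "sphere_affine a b (Some z) = Some (a * z + b)"
  by (simp_all add: sphere_affine_def)

lemma holomorphic_map_sphere_affine:
  assumes a: "a \<noteq> 0"
  shows "holomorphic_map riemann_sphere riemann_sphere (sphere_affine a b)"
proof (rule holomorphic_map_from_sphere[OF complex_atlas_sphere])
  fix c :: "complex option"
  show "\<exists>r>0. holomorphic_map (plane (ball 0 r)) riemann_sphere (\<lambda>z. sphere_affine a b (sphere_shift c z))"
  proof (cases c)
    case None
    \<comment> \<open>In the coordinate \<open>1 / z\<close> at infinity the affine map becomes
      \<open>z / (a + b * z)\<close>, whose denominator has no zero for \<open>norm z < r\<close>;
      the 1 allows for \<open>b = 0\<close>.\<close>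
    define r where "r = norm a / (1 + norm b)"
    have r: "r > 0" using a by (auto simp: r_def intro!: divide_pos_pos add_pos_nonneg)
    have ne: "a + b * z \<noteq> 0" if "z \<in> ball 0 r" for z
    proof
      assume "a + b * z = 0"
      then have "norm a = norm b * norm z" by (metis add_eq_0_iff norm_minus_cancel norm_mult)
      also have "\<dots> \<le> (1 + norm b) * norm z" by (intro mult_right_mono) auto
      also have "\<dots> < (1 + norm b) * r" using that by (intro mult_strict_left_mono) (auto intro: add_pos_nonneg)
      also have "\<dots> = norm a" unfolding r_def by (simp add: add_pos_nonneg less_imp_neq[symmetric])
      finally show False by simp
    qed
    have "(\<lambda>z. z / (a + b * z)) holomorphic_on ball 0 r" by (intro holomorphic_intros ne)
    then have "holomorphic_map (plane (ball 0 r)) riemann_sphere (\<lambda>z. sphere_recip (Some (z / (a + b * z))))"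
      by (rule holomorphic_map_recip_Some_comp) auto
    then have "holomorphic_map (plane (ball 0 r)) riemann_sphere (\<lambda>z. sphere_affine a b (sphere_shift c z))"
    proof (rule holomorphic_map_eq[OF complex_atlas_plane[OF open_ball]])
      fix z assume "z \<in> points (plane (ball 0 r))"
      then have "a + b * z \<noteq> 0" using ne by simp
      then show "sphere_recip (Some (z / (a + b * z))) = sphere_affine a b (sphere_shift c z)"
        by (cases "z = 0") (auto simp: None field_simps)
    qed
    then show ?thesis using r by blast
  next
    case (Some d)
    have "(\<lambda>z. a * (d + z) + b) holomorphic_on ball 0 1" by (intro holomorphic_intros)
    then show ?thesis using holomorphic_map_Some_comp[of "\<lambda>z. a * (d + z) + b" "ball 0 1"] Some
      by (intro exI[of _ 1]) simp
  qed
qed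

lemma antiholomorphic_map_sphere_cnj: "antiholomorphic_map riemann_sphere riemann_sphere sphere_cnj"
  unfolding antiholomorphic_map_iff
proof (rule holomorphic_map_from_sphere[OF complex_atlas_conj[OF complex_atlas_sphere]])
  fix c :: "complex option"
  have "holomorphic_map (plane (cnj ` ball 0 1)) (conj_surface riemann_sphere) (\<lambda>z. sphere_shift (sphere_cnj c) (cnj z))"
    using holomorphic_map_plane_cnj[OF complex_atlas_sphere open_ball discD(4)[OF disc_sphere_shift[OF zero_less_one]]] .
  moreover have "sphere_shift (sphere_cnj c) (cnj z) = sphere_cnj (sphere_shift c z)" for z
    by (cases c; cases "z = 0") (auto simp: sphere_cnj_def)
  ultimately show "\<exists>r>0. holomorphic_map (plane (ball 0 r)) (conj_surface riemann_sphere) (\<lambda>z. sphere_cnj (sphere_shift c z))"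
    by (intro exI[of _ 1]) simp
qed

lemma holomorphic_map_sphere_cnj:
  "holomorphic_map (conj_surface riemann_sphere) riemann_sphere sphere_cnj"
  using holomorphic_map_conj[OF complex_atlas_sphere complex_atlas_conj[OF complex_atlas_sphere], of sphere_cnj]
    antiholomorphic_map_sphere_cnj by (simp add: antiholomorphic_map_iff)

lemma sphere_cnj_sphere_cnj [simp]: "sphere_cnj (sphere_cnj w) = w"
  by (cases w) (auto simp: sphere_cnj_def)

lemma inj_sphere_cnj: "inj sphere_cnj"
  by (metis injI sphere_cnj_sphere_cnj)

lemma sphere_cnj_simps [simp]: "sphere_cnj None = None" "sphere_cnj (Some z) = Some (cnj z)"
  by (simp_all add: sphere_cnj_def)

section \<open>Automorphisms of the sphere\<close>

abbreviation sphere_aut where "sphere_aut \<equiv> automorphisms riemann_sphere"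

lemma sphere_autI:
  assumes "holomorphic_map riemann_sphere riemann_sphere g" "holomorphic_map riemann_sphere riemann_sphere h"
    "\<And>w. h (g w) = w" "\<And>w. g (h w) = w"
  shows "g \<in> sphere_aut"
  using assms unfolding automorphisms_def by auto

lemma sphere_autE:
  assumes "g \<in> sphere_aut"
  obtains h where "h \<in> sphere_aut" "\<And>w. h (g w) = w" "\<And>w. g (h w) = w"
proof -
  obtain h where h: "holomorphic_map riemann_sphere riemann_sphere h" "\<forall>p. h (g p) = p \<and> g (h p) = p"
    and g: "holomorphic_map riemann_sphere riemann_sphere g"
    using assms unfolding automorphisms_def by auto
  then show ?thesis using that[of h] sphere_autI[of h g] by auto
qed

lemma sphere_aut_holomorphic: "g \<in> sphere_aut \<Longrightarrow> holomorphic_map riemann_sphere riemann_sphere g"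
  by (simp add: automorphisms_def)

lemma sphere_aut_inj: "g \<in> sphere_aut \<Longrightarrow> inj g"
  by (metis injI sphere_autE)

lemmas sphere_compose = holomorphic_map_compose[OF complex_atlas_sphere complex_atlas_sphere complex_atlas_sphere]

lemma sphere_aut_compose:
  assumes g: "g \<in> sphere_aut" and h: "h \<in> sphere_aut"
  shows "h \<circ> g \<in> sphere_aut"
proof -
  obtain g' where "g' \<in> sphere_aut" "\<And>w. g' (g w) = w" "\<And>w. g (g' w) = w"
    using sphere_autE[OF g] by blast
  moreover obtain h' where "h' \<in> sphere_aut" "\<And>w. h' (h w) = w" "\<And>w. h (h' w) = w"
    using sphere_autE[OF h] by blast
  ultimately show ?thesis
    using sphere_autI[OF sphere_compose[OF sphere_aut_holomorphic[OF g] sphere_aut_holomorphic[OF h]], of "g' \<circ> h'"]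
      sphere_compose[OF sphere_aut_holomorphic[of h'] sphere_aut_holomorphic[of g']] by simp
qed

lemma sphere_recip_aut: "sphere_recip \<in> sphere_aut"
  by (rule sphere_autI[OF holomorphic_map_sphere_recip holomorphic_map_sphere_recip]) auto

lemma sphere_affine_aut:
  assumes "a \<noteq> 0"
  shows "sphere_affine a b \<in> sphere_aut"
proof (rule sphere_autI[OF holomorphic_map_sphere_affine[OF assms] holomorphic_map_sphere_affine[of "inverse a" "- b / a"]])
  show "sphere_affine (inverse a) (- b / a) (sphere_affine a b w) = w" for w
    using assms by (cases w) (auto simp: field_simps)
  show "sphere_affine a b (sphere_affine (inverse a) (- b / a) w) = w" for w
    using assms by (cases w) (auto simp: field_simps)
qed (use assms in auto)

text \<open>Used to normalize two critical values, and a point together with its image under an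
  involution.\<close>

lemma sphere_aut_two_points:
  assumes "c \<noteq> d"
  obtains g where "g \<in> sphere_aut" "g c = None" "g d = Some 0"
proof -
  have *: "\<exists>g\<in>sphere_aut. g c = None" for c
  proof (cases c)
    case None
    then show ?thesis by (intro bexI[OF _ sphere_affine_aut[of 1 0]]) auto
  next
    case (Some a)
    then have "(sphere_recip \<circ> sphere_affine 1 (- a)) c = None" by simp
    then show ?thesis by (rule bexI[OF _ sphere_aut_compose[OF sphere_affine_aut sphere_recip_aut]]) simp
  qed
  then obtain g where g: "g \<in> sphere_aut" "g c = None" by blast
  then obtain b where b: "g d = Some b" using assms g(2) inj_eq[OF sphere_aut_inj[OF g(1)], of c d] by (cases "g d") auto
  have "sphere_affine 1 (- b) \<circ> g \<in> sphere_aut" using sphere_aut_compose[OF g(1) sphere_affine_aut] by auto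
  from that[OF this] g b show ?thesis by simp
qed

lemma sphere_neg_recip_eq: "sphere_neg_recip = sphere_affine (-1) 0 \<circ> sphere_recip"
proof
  fix w show "sphere_neg_recip w = (sphere_affine (-1) 0 \<circ> sphere_recip) w"
    by (cases w) (auto simp: sphere_neg_recip_def sphere_recip_def inverse_eq_divide)
qed

lemma sphere_neg_recip_aut: "sphere_neg_recip \<in> sphere_aut"
  unfolding sphere_neg_recip_eq by (intro sphere_aut_compose sphere_recip_aut sphere_affine_aut) simp

section \<open>Nonconstant maps to the sphere\<close>

text \<open>The germs of \<open>f\<close> and \<open>g\<close> agree on an open set; that this set is closed follows from the
  identity theorem in a disc around a boundary point.\<close>

lemma identity_theorem:
  assumes P: "complex_atlas P" and Q: "complex_atlas Q" and conn: "connected_space (topo P)"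
    and haus: "Hausdorff_space (topo Q)" and f: "holomorphic_map P Q f" and g: "holomorphic_map P Q g"
    and A: "openin (topo P) A" "A \<noteq> {}" "\<And>p. p \<in> A \<Longrightarrow> f p = g p" and p: "p \<in> points P"
  shows "f p = g p"
proof -
  define I where "I = \<Union>{A. openin (topo P) A \<and> (\<forall>p\<in>A. f p = g p)}"
  have oI: "openin (topo P) I" unfolding I_def by (intro openin_Union) auto
  have eqI: "f p = g p" if "p \<in> I" for p using that by (auto simp: I_def)
  note cf = holomorphic_mapD(1)[OF f] and cg = holomorphic_mapD(1)[OF g]
  have key: "q \<in> I" if q: "q \<in> points P" and cl: "\<And>T. openin (topo P) T \<Longrightarrow> q \<in> T \<Longrightarrow> T \<inter> I \<noteq> {}" for q
  proof -
    have fg: "f q = g q"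
    proof (rule ccontr)
      assume "f q \<noteq> g q"
      then obtain V W where VW: "openin (topo Q) V" "openin (topo Q) W" "f q \<in> V" "g q \<in> W" "disjnt V W"
        using haus holomorphic_map_in[OF f q] holomorphic_map_in[OF g q] unfolding Hausdorff_space_def by blast
      have "openin (topo P) {p \<in> {p \<in> points P. f p \<in> V}. g p \<in> W}"
        by (intro openin_preimage[OF cf] openin_preimage[OF cg] VW) auto
      from cl[OF this] q VW obtain p where "p \<in> I" "f p \<in> V" "g p \<in> W" by auto
      then show False using eqI[of p] VW(5) by (auto simp: disjnt_iff)
    qed
    obtain V \<psi> where V: "(V, \<psi>) \<in> atlas Q" "f q \<in> V" using chart_at[OF Q] holomorphic_map_in[OF f q] by metis
    obtain r \<gamma> where d: "disc P q r \<gamma>" using disc_exists[OF P q] .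
    have "openin (topo P) {p \<in> {p \<in> points P. f p \<in> V}. g p \<in> V}"
      by (intro openin_preimage[OF cf] openin_preimage[OF cg] chartD(1)[OF Q V(1)]) auto
    then obtain s where s: "0 < s" "s \<le> r" "disc P q s \<gamma>" "\<gamma> ` ball 0 s \<subseteq> {p \<in> {p \<in> points P. f p \<in> V}. g p \<in> V}"
      by (rule disc_shrink_into[OF P d]) (use q V fg that in auto)
    have inV: "f (\<gamma> z) \<in> V" "g (\<gamma> z) \<in> V" if "z \<in> ball 0 s" for z
      using image_subset_iff[THEN iffD1, OF s(4)] that by blast+
    have hol: "(\<lambda>z. \<psi> (h (\<gamma> z))) holomorphic_on ball 0 s"
      if h: "holomorphic_map P Q h" "\<And>z. z \<in> ball 0 s \<Longrightarrow> h (\<gamma> z) \<in> V" for h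
    proof -
      have "holomorphic_map (plane (ball 0 s)) Q (h \<circ> \<gamma>)"
        by (rule holomorphic_map_compose[OF complex_atlas_plane P Q discD(4)[OF s(3)] h(1)]) auto
      then have "(\<lambda>z. \<psi> (h (\<gamma> z))) holomorphic_on {z \<in> ball 0 s. (h \<circ> \<gamma>) z \<in> V}"
        unfolding holomorphic_map_from_plane using V(1) by auto
      moreover have "{z \<in> ball 0 s. (h \<circ> \<gamma>) z \<in> V} = ball 0 s" using h(2) by auto
      ultimately show ?thesis by simp
    qed
    define Z where "Z = {z \<in> ball 0 s. \<gamma> z \<in> I}"
    have oZ: "open Z" unfolding Z_def by (rule open_plane_preimage[OF discD(5)[OF s(3)] open_ball oI])
    note oball = disc_neighbourhood(1)[OF P s(3)] and qin = disc_neighbourhood(2)[OF P s(3)]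
    have "\<gamma> ` ball 0 s \<inter> I \<noteq> {}" by (rule cl[OF oball qin])
    then have Zne: "Z \<noteq> {}" by (auto simp: Z_def)
    have "\<psi> (f (\<gamma> z)) = \<psi> (g (\<gamma> z))" if "z \<in> ball 0 s" for z
      by (rule analytic_continuation_open[OF oZ open_ball Zne _ _ hol[OF f] hol[OF g] _ that])
        (use inV eqI in \<open>auto simp: Z_def\<close>)
    then have "f (\<gamma> z) = g (\<gamma> z)" if "z \<in> ball 0 s" for z
      using that inV chartD(3)[OF Q V(1)] by (metis inj_onD)
    then show "q \<in> I" unfolding I_def using oball qin by blast
  qed
  have "openin (topo P) (points P - I)"
  proof (subst openin_subopen, intro ballI)
    fix q assume "q \<in> points P - I"
    then obtain T where "openin (topo P) T" "q \<in> T" "T \<inter> I = {}" using key by blast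
    then show "\<exists>T. openin (topo P) T \<and> q \<in> T \<and> T \<subseteq> points P - I"
      using openin_subset by blast
  qed
  moreover have "A \<subseteq> I" using A by (auto simp: I_def)
  ultimately have "I = points P"
    using conn[unfolded connected_space_clopen_in, rule_format, of I] oI A(2) openin_subset[OF oI]
    by (auto simp: closedin_def)
  then show ?thesis using eqI p by blast
qed

lemma holomorphic_map_const: "complex_atlas P \<Longrightarrow> c \<in> points Q \<Longrightarrow> holomorphic_map P Q (\<lambda>_. c)"
  by (rule holomorphic_mapI) (auto simp: holomorphic_on_const)

lemma finite_locally_sparse:
  assumes "compact_space X"
    and "\<And>p. p \<in> topspace X \<Longrightarrow> \<exists>A. openin X A \<and> p \<in> A \<and> A \<inter> S \<subseteq> {p}" and S: "S \<subseteq> topspace X"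
  shows "finite S"
proof -
  obtain A where A: "\<And>p. p \<in> topspace X \<Longrightarrow> openin X (A p) \<and> p \<in> A p \<and> A p \<inter> S \<subseteq> {p}"
    using assms(2) by metis
  have "\<exists>\<F>. finite \<F> \<and> \<F> \<subseteq> A ` topspace X \<and> topspace X \<subseteq> \<Union>\<F>"
    using assms(1) A unfolding compact_space_alt by (elim allE[of _ "A ` topspace X"]) blast
  then obtain T where T: "finite T" "T \<subseteq> topspace X" "topspace X \<subseteq> \<Union>(A ` T)"
    by (metis finite_subset_image)
  have "S \<subseteq> T"
  proof
    fix q assume q: "q \<in> S"
    then obtain p where "p \<in> T" "q \<in> A p" using T S by blast
    then show "q \<in> T" using A[of p] T q by blast
  qed
  then show ?thesis using T finite_subset by blast
qed

lemma power_inj_on_ball_imp_1: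
  assumes "inj_on (\<lambda>z::complex. z ^ n) (ball 0 r)" "r > 0" "n > 0"
  shows "n = 1"
proof -
  have "deriv (\<lambda>z::complex. z ^ n) 0 \<noteq> 0"
    by (rule holomorphic_injective_imp_regular[OF _ open_ball assms(1)]) (use assms in \<open>auto intro!: holomorphic_intros\<close>)
  moreover have "deriv (\<lambda>z::complex. z ^ n) 0 = of_nat n * 0 ^ (n - 1)"
    by (rule DERIV_imp_deriv) (auto intro!: derivative_eq_intros)
  ultimately show ?thesis using assms by (cases "n = 1") (auto simp: zero_power)
qed

text \<open>Write \<open>u z - u 0\<close> as \<open>z ^ n * g z\<close> with \<open>g\<close> free
  of zeros. A logarithm of \<open>g\<close> on the ball supplies an \<open>n\<close>-th root, and
  \<open>z\<close> times this root is a coordinate in which \<open>u - u 0\<close> is the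
  \<open>n\<close>-th power; \<open>k\<close> is its inverse.\<close>

lemma holomorphic_power_form:
  assumes u: "u holomorphic_on ball 0 s" and s: "s > 0" and nc: "\<not> u constant_on ball 0 s"
  obtains n t k where "n > 0" "t > 0" "k holomorphic_on ball 0 t" "inj_on k (ball 0 t)" "k 0 = 0"
    "k ` ball 0 t \<subseteq> ball 0 s" "\<And>y. y \<in> ball 0 t \<Longrightarrow> u (k y) = u 0 + y ^ n"
proof -
  have hD: "(\<lambda>z. u z - u 0) holomorphic_on ball 0 s" by (intro holomorphic_intros u)
  have ncD: "\<not> (\<lambda>z. u z - u 0) constant_on ball 0 s"
    using nc unfolding constant_on_def by (metis diff_add_cancel)
  have in0: "0 \<in> ball (0::complex) s" "u 0 - u 0 = 0" using s by auto
  obtain g r n where n: "0 < n" and r: "0 < r" "ball (0::complex) r \<subseteq> ball 0 s" and g: "g holomorphic_on ball 0 r"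
    and eq: "\<And>w. w \<in> ball 0 r \<Longrightarrow> u w - u 0 = (w - 0) ^ n * g w" and g0: "\<And>w. w \<in> ball 0 r \<Longrightarrow> g w \<noteq> 0"
    by (rule holomorphic_factor_zero_nonconstant[OF hD open_ball connected_ball in0 ncD]) (rule that)
  obtain l where l: "l holomorphic_on ball 0 r" "\<And>z. z \<in> ball 0 r \<Longrightarrow> g z = exp (l z)"
    using contractible_imp_holomorphic_log[OF g _ g0] by (metis convex_ball convex_imp_contractible)
  define h where "h z = z * exp (l z / of_nat n)" for z
  have h: "h holomorphic_on ball 0 r" unfolding h_def by (intro holomorphic_intros l) (use n in auto)
  have uh: "u z = u 0 + h z ^ n" if "z \<in> ball 0 r" for z
  proof -
    have "exp (l z / of_nat n) ^ n = g z" using n l(2)[OF that] by (simp add: exp_of_nat_mult[symmetric])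
    then have "u z - u 0 = h z ^ n" using eq[OF that] by (simp add: h_def power_mult_distrib)
    then show ?thesis by (simp add: algebra_simps)
  qed
  have "((\<lambda>z. z * exp (l z / of_nat n)) has_field_derivative exp (l 0 / of_nat n)) (at 0)"
  proof -
    have "(l has_field_derivative deriv l 0) (at 0)" using l(1) r by (intro holomorphic_derivI[of l "ball 0 r"]) auto
    then show ?thesis using n by (auto intro!: derivative_eq_intros)
  qed
  then have dh: "deriv h 0 \<noteq> 0" unfolding h_def[abs_def] by (simp add: DERIV_imp_deriv)
  have "0 \<in> ball (0::complex) r" using r by simp
  then obtain e where e: "e > 0" "ball (0::complex) e \<subseteq> ball 0 r" "inj_on h (ball 0 e)"
    by (rule has_complex_derivative_locally_injective[OF h _ open_ball dh]) (rule that)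
  have he: "h holomorphic_on ball 0 e" using holomorphic_on_subset[OF h e(2)] .
  obtain k where k: "k holomorphic_on h ` ball 0 e" "\<And>z. z \<in> ball 0 e \<Longrightarrow> k (h z) = z"
    using holomorphic_has_inverse[OF he open_ball e(3)] by metis
  have "open (h ` ball 0 e)" using open_mapping_thm3[OF he open_ball e(3)] .
  moreover have "0 \<in> h ` ball 0 e" using e by (auto simp: h_def intro!: image_eqI[of _ _ 0])
  ultimately obtain t where t: "t > 0" "ball 0 t \<subseteq> h ` ball 0 e" using open_contains_ball by blast
  have kk: "k y \<in> ball 0 e" "h (k y) = y" if "y \<in> ball 0 t" for y using t(2) that k(2) by force+
  show ?thesis
  proof (rule that[OF n t(1)])
    show "k holomorphic_on ball 0 t" using k(1) t(2) holomorphic_on_subset by blast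
    show "inj_on k (ball 0 t)" by (rule inj_onI) (metis kk(2))
    show "k 0 = 0" using k(2)[of 0] e by (simp add: h_def)
    show "k ` ball 0 t \<subseteq> ball 0 s" using kk(1) e(2) r(2) by blast
    show "u (k y) = u 0 + y ^ n" if "y \<in> ball 0 t" for y
      using uh[of "k y"] kk[OF that] e(2) by auto
  qed
qed

lemma Hausdorff_sphere: "Hausdorff_space (topo riemann_sphere)"
  and connected_sphere: "connected_space (topo riemann_sphere)"
  using compact_riemann_surface_riemann_sphere
  by (simp_all add: compact_riemann_surface_def riemann_surface_def)

locale sphere_map =
  fixes P :: "'a surface" and f :: "'a \<Rightarrow> complex option"
  assumes compact: "compact_riemann_surface P" and hol: "holomorphic_map P riemann_sphere f"
    and nonconst: "\<not> f constant_on points P"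
begin

lemma P: "complex_atlas P" and connected: "connected_space (topo P)" and haus: "Hausdorff_space (topo P)"
    and compact_topo: "compact_space (topo P)"
  using compact riemann_surface_complex_atlas[of P]
  by (auto simp: compact_riemann_surface_def riemann_surface_def)

lemma cont: "continuous_map (topo P) sphere_topology f"
  using holomorphic_mapD(1)[OF hol] by (simp add: topo_sphere)

lemma disc_nonconst:
  assumes d: "disc P p r \<gamma>"
  shows "\<exists>z\<in>ball 0 r. f (\<gamma> z) \<noteq> f p"
proof (rule ccontr)
  assume *: "\<not> ?thesis"
  note A = disc_neighbourhood(1)[OF P d]
  have ne: "\<gamma> ` ball 0 r \<noteq> {}" using discD(1)[OF d] by auto
  have eq: "f q = f p" if "q \<in> \<gamma> ` ball 0 r" for q using that * by auto
  have c: "f p \<in> points riemann_sphere" by simp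
  have "f q = f p" if "q \<in> points P" for q
    by (rule identity_theorem[OF P complex_atlas_sphere connected Hausdorff_sphere hol holomorphic_map_const[OF P c] A ne eq that])
  then show False using nonconst by (auto simp: constant_on_def)
qed

lemma sphere_recip_sphere_map: "sphere_map P (sphere_recip \<circ> f)"
proof
  show "holomorphic_map P riemann_sphere (sphere_recip \<circ> f)"
    by (rule holomorphic_map_compose[OF P complex_atlas_sphere complex_atlas_sphere hol holomorphic_map_sphere_recip])
  show "\<not> (sphere_recip \<circ> f) constant_on points P"
    using nonconst inj_sphere_recip unfolding constant_on_def by (metis comp_apply sphere_recip_sphere_recip)
qed (rule compact)

lemma power_form_finite:
  assumes p: "p \<in> points P" and a: "f p = Some a"
  obtains n r \<gamma> where "n > 0" "disc P p r \<gamma>" "\<And>z. z \<in> ball 0 r \<Longrightarrow> f (\<gamma> z) = Some (a + z ^ n)"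
proof -
  obtain r \<gamma> where d: "disc P p r \<gamma>" using disc_exists[OF P p] .
  have "openin (topo P) {p \<in> points P. f p \<in> UNIV - {None}}" by (intro openin_preimage[OF cont] openin_sphere_finite) auto
  then obtain s where s: "0 < s" "s \<le> r" "disc P p s \<gamma>" "\<gamma> ` ball 0 s \<subseteq> {p \<in> points P. f p \<in> UNIV - {None}}"
    by (rule disc_shrink_into[OF P d]) (use p a in auto)
  have ne: "f (\<gamma> z) \<noteq> None" if "z \<in> ball 0 s" for z
    using image_subset_iff[THEN iffD1, OF s(4)] that by auto
  define u where "u z = the (f (\<gamma> z))" for z
  have fu: "f (\<gamma> z) = Some (u z)" if "z \<in> ball 0 s" for z using ne[OF that] by (simp add: u_def)
  have u: "u holomorphic_on ball 0 s"
    unfolding u_def by (rule holomorphic_on_the_disc[OF P hol s(3) ne])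
  have u0: "u 0 = a" using discD(2)[OF d] a by (simp add: u_def)
  have "\<not> u constant_on ball 0 s"
  proof
    assume "u constant_on ball 0 s"
    then have "u z = u 0" if "z \<in> ball 0 s" for z using that s(1) unfolding constant_on_def by auto
    then show False using disc_nonconst[OF s(3)] fu a u0 by auto
  qed
  then obtain n t k where k: "n > 0" "t > 0" "k holomorphic_on ball 0 t" "inj_on k (ball 0 t)" "k 0 = 0"
    "k ` ball 0 t \<subseteq> ball 0 s" "\<And>y. y \<in> ball 0 t \<Longrightarrow> u (k y) = u 0 + y ^ n"
    by (rule holomorphic_power_form[OF u s(1)]) (rule that)
  have "disc P p t (\<lambda>y. \<gamma> (k y))"
    using disc_compose[OF P s(3) k(2,3,4,6)] k(5) discD(2)[OF d] by simp
  moreover have "f (\<gamma> (k y)) = Some (a + y ^ n)" if "y \<in> ball 0 t" for y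
    using fu[of "k y"] k(6,7) that u0 by (simp add: image_subset_iff)
  ultimately show ?thesis using that[OF k(1)] by blast
qed

lemma power_form_shift:
  assumes p: "p \<in> points P"
  obtains n r \<gamma> where "n > 0" "disc P p r \<gamma>" "\<And>z. z \<in> ball 0 r \<Longrightarrow> f (\<gamma> z) = sphere_shift (f p) (z ^ n)"
proof (cases "f p")
  case (Some a)
  show ?thesis by (rule power_form_finite[OF p Some]) (rule that, use Some in auto)
next
  case None
  interpret R: sphere_map P "sphere_recip \<circ> f" by (rule sphere_recip_sphere_map)
  obtain n r \<gamma> where 1: "n > 0" "disc P p r \<gamma>" "\<And>z. z \<in> ball 0 r \<Longrightarrow> (sphere_recip \<circ> f) (\<gamma> z) = Some (0 + z ^ n)"
    by (rule R.power_form_finite[OF p, of 0]) (use None in \<open>auto intro: that\<close>)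
  have "f (\<gamma> z) = sphere_shift (f p) (z ^ n)" if "z \<in> ball 0 r" for z
    using 1(3)[OF that] None by (metis add_0 comp_apply sphere_recip_sphere_recip sphere_shift_simps(1))
  then show ?thesis using that 1 by blast
qed

definition "ord p = ramification P riemann_sphere f p"

lemma ord_eqI:
  assumes "n > 0" "disc P p r \<gamma>" "\<And>z. z \<in> ball 0 r \<Longrightarrow> f (\<gamma> z) = sphere_shift (f p) (z ^ n)"
  shows "ord p = n"
  unfolding ord_def
  by (rule ramification_eq[OF P complex_atlas_sphere, of f p n r \<gamma> "sphere_shift (f p)"])
    (use assms discD(1)[OF assms(2)] in \<open>auto simp: power_form_def disc_sphere_shift\<close>)

lemma normal_form:
  assumes p: "p \<in> points P"
  obtains r \<gamma> where "ord p > 0" "disc P p r \<gamma>" "\<And>z. z \<in> ball 0 r \<Longrightarrow> f (\<gamma> z) = sphere_shift (f p) (z ^ ord p)"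
proof -
  obtain n r \<gamma> where *: "n > 0" "disc P p r \<gamma>" "\<And>z. z \<in> ball 0 r \<Longrightarrow> f (\<gamma> z) = sphere_shift (f p) (z ^ n)"
    by (rule power_form_shift[OF p]) (rule that)
  then have "ord p = n" by (rule ord_eqI)
  then show ?thesis using that * by blast
qed

lemma ord_pos: "p \<in> points P \<Longrightarrow> ord p > 0"
  by (rule normal_form)

lemma normal_form_shrink:
  assumes p: "p \<in> points P" and W: "openin (topo P) W" "p \<in> W"
  obtains r \<gamma> where "disc P p r \<gamma>" "\<And>z. z \<in> ball 0 r \<Longrightarrow> f (\<gamma> z) = sphere_shift (f p) (z ^ ord p)"
    "\<gamma> ` ball 0 r \<subseteq> W"
proof -
  obtain r \<gamma> where d: "disc P p r \<gamma>" "\<And>z. z \<in> ball 0 r \<Longrightarrow> f (\<gamma> z) = sphere_shift (f p) (z ^ ord p)"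
    by (rule normal_form[OF p]) (rule that)
  obtain s where "0 < s" "s \<le> r" "disc P p s \<gamma>" "\<gamma> ` ball 0 s \<subseteq> W"
    by (rule disc_shrink_into[OF P d(1) W]) (rule that)
  then show ?thesis using that[of s \<gamma>] d(2) by auto
qed

lemma ord_1_if_inj:
  assumes A: "openin (topo P) A" "p \<in> A" "inj_on f A"
  shows "ord p = 1"
proof -
  have p: "p \<in> points P" using A openin_subset by blast
  obtain r \<gamma> where d: "disc P p r \<gamma>" "\<And>z. z \<in> ball 0 r \<Longrightarrow> f (\<gamma> z) = sphere_shift (f p) (z ^ ord p)"
    "\<gamma> ` ball 0 r \<subseteq> A" by (rule normal_form_shrink[OF p A(1,2)]) (rule that)
  have "inj_on (\<lambda>z::complex. z ^ ord p) (ball 0 r)"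
  proof (rule inj_onI)
    fix x y :: complex assume xy: "x \<in> ball 0 r" "y \<in> ball 0 r" "x ^ ord p = y ^ ord p"
    then have "f (\<gamma> x) = f (\<gamma> y)" using d(2) by simp
    then have "\<gamma> x = \<gamma> y" using A(3) d(3) xy by (meson image_subset_iff inj_onD)
    then show "x = y" using discD(3)[OF d(1)] xy by (auto dest: inj_onD)
  qed
  then show ?thesis using power_inj_on_ball_imp_1 discD(1)[OF d(1)] ord_pos[OF p] by blast
qed

lemma inj_if_ord_1:
  assumes p: "p \<in> points P" "ord p = 1"
  obtains A where "openin (topo P) A" "p \<in> A" "inj_on f A"
proof -
  obtain r \<gamma> where d: "disc P p r \<gamma>" "\<And>z. z \<in> ball 0 r \<Longrightarrow> f (\<gamma> z) = sphere_shift (f p) (z ^ ord p)"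
    by (rule normal_form[OF p(1)]) (rule that)
  show ?thesis
  proof (rule that)
    show "openin (topo P) (\<gamma> ` ball 0 r)" "p \<in> \<gamma> ` ball 0 r" by (rule disc_neighbourhood[OF P d(1)])+
    show "inj_on f (\<gamma> ` ball 0 r)"
      using d(2) p(2) inj_sphere_shift[of "f p"] by (auto simp: inj_on_def inj_def)
  qed
qed

lemma normal_form_ord:
  assumes d: "disc P p r \<gamma>" "\<And>z. z \<in> ball 0 r \<Longrightarrow> f (\<gamma> z) = sphere_shift (f p) (z ^ n)"
    and z: "z \<in> ball 0 r" "z \<noteq> 0" and n: "n > 0"
  shows "ord (\<gamma> z) = 1"
proof -
  have "deriv (\<lambda>z::complex. z ^ n) z = of_nat n * z ^ (n - 1)"
    by (rule DERIV_imp_deriv) (auto intro!: derivative_eq_intros)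
  then have "deriv (\<lambda>z::complex. z ^ n) z \<noteq> 0" using z n by simp
  moreover have "(\<lambda>z::complex. z ^ n) holomorphic_on ball 0 r" by (intro holomorphic_intros)
  ultimately obtain e where e: "e > 0" "ball z e \<subseteq> ball 0 r" "inj_on (\<lambda>z::complex. z ^ n) (ball z e)"
    using has_complex_derivative_locally_injective[OF _ z(1) open_ball, of "\<lambda>z. z ^ n"] by blast
  show ?thesis
  proof (rule ord_1_if_inj)
    show "openin (topo P) (\<gamma> ` ball z e)" by (rule disc_open_image[OF P d(1)]) (use e in auto)
    show "\<gamma> z \<in> \<gamma> ` ball z e" using e by auto
    show "inj_on f (\<gamma> ` ball z e)"
    proof (rule inj_onI, elim imageE)
      fix p q x y assume *: "p = \<gamma> x" "q = \<gamma> y" "x \<in> ball z e" "y \<in> ball z e" "f p = f q"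
      then have "x ^ n = y ^ n" using d(2) e(2) inj_sphere_shift[of "f p"] by (metis injD inj_sphere_shift subsetD)
      then show "p = q" using e(3) * by (auto dest: inj_onD)
    qed
  qed
qed

lemma normal_form_fibre:
  assumes d: "disc P p r \<gamma>" "\<And>z. z \<in> ball 0 r \<Longrightarrow> f (\<gamma> z) = sphere_shift (f p) (z ^ n)"
    and z: "z \<in> ball 0 r" "z \<noteq> 0"
  shows "f (\<gamma> z) \<noteq> f p"
  using d(2)[OF z(1)] z(2) inj_eq[OF inj_sphere_shift, of "f p" "z ^ n" 0] by simp

lemma finite_fibre: "finite {p \<in> points P. f p = c}"
proof (rule finite_locally_sparse[OF compact_topo])
  fix p assume p: "p \<in> points P"
  obtain r \<gamma> where d: "disc P p r \<gamma>" "\<And>z. z \<in> ball 0 r \<Longrightarrow> f (\<gamma> z) = sphere_shift (f p) (z ^ ord p)"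
    by (rule normal_form[OF p]) (rule that)
  show "\<exists>A. openin (topo P) A \<and> p \<in> A \<and> A \<inter> {p \<in> points P. f p = c} \<subseteq> {p}"
  proof (cases "f p = c")
    case True
    show ?thesis
    proof (intro exI conjI)
      show "openin (topo P) (\<gamma> ` ball 0 r)" "p \<in> \<gamma> ` ball 0 r" by (rule disc_neighbourhood[OF P d(1)])+
      show "\<gamma> ` ball 0 r \<inter> {p \<in> points P. f p = c} \<subseteq> {p}"
      proof
        fix q assume "q \<in> \<gamma> ` ball 0 r \<inter> {p \<in> points P. f p = c}"
        then obtain z where "z \<in> ball 0 r" "q = \<gamma> z" "f q = f p" using True by auto
        then show "q \<in> {p}" using normal_form_fibre[OF d, of z] discD(2)[OF d(1)] by auto
      qed
    qed
  next
    case False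
    have "closedin sphere_topology {c}"
      using Hausdorff_sphere points_sphere by (intro closedin_Hausdorff_singleton) (simp_all add: topo_sphere)
    then have "openin sphere_topology (UNIV - {c})" using points_sphere by (simp add: closedin_def topo_sphere)
    then have "openin (topo P) {p \<in> points P. f p \<in> UNIV - {c}}" by (intro openin_preimage[OF cont]) auto
    then show ?thesis using False p by (intro exI[of _ "{p \<in> points P. f p \<in> UNIV - {c}}"]) auto
  qed
qed auto

lemma finite_critical_points: "finite (critical_points P riemann_sphere f)"
proof (rule finite_locally_sparse[OF compact_topo])
  fix p assume p: "p \<in> points P"
  obtain r \<gamma> where d: "disc P p r \<gamma>" "\<And>z. z \<in> ball 0 r \<Longrightarrow> f (\<gamma> z) = sphere_shift (f p) (z ^ ord p)"
    by (rule normal_form[OF p]) (rule that)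
  show "\<exists>A. openin (topo P) A \<and> p \<in> A \<and> A \<inter> critical_points P riemann_sphere f \<subseteq> {p}"
  proof (intro exI conjI)
    show "openin (topo P) (\<gamma> ` ball 0 r)" "p \<in> \<gamma> ` ball 0 r" by (rule disc_neighbourhood[OF P d(1)])+
    show "\<gamma> ` ball 0 r \<inter> critical_points P riemann_sphere f \<subseteq> {p}"
    proof
      fix q assume "q \<in> \<gamma> ` ball 0 r \<inter> critical_points P riemann_sphere f"
      then obtain z where z: "z \<in> ball 0 r" "q = \<gamma> z" "ord q \<noteq> 1" by (auto simp: critical_points_def ord_def)
      then show "q \<in> {p}" using normal_form_ord[OF d _ _ ord_pos[OF p], of z] discD(2)[OF d(1)] by auto
    qed
  qed
qed (auto simp: critical_points_def)

lemma finite_critical_preimage: "finite (critical_preimage P riemann_sphere f)"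
proof -
  have "critical_preimage P riemann_sphere f = (\<Union>c\<in>critical_values P riemann_sphere f. {p \<in> points P. f p = c})"
    by (auto simp: critical_preimage_def)
  then show ?thesis using finite_critical_points finite_fibre by (simp add: critical_values_def)
qed

lemma critical_preimageI: "p \<in> points P \<Longrightarrow> ord p \<noteq> 1 \<Longrightarrow> p \<in> critical_preimage P riemann_sphere f"
  using ord_pos[of p] by (auto simp: critical_preimage_def critical_values_def critical_points_def ord_def)

text \<open>Properness of \<open>f\<close>: it is a closed map from a compact to a Hausdorff space,
  so the image of the points missed by all \<open>U q\<close> is closed and does not contain
  \<open>b\<close>. With finite fibres this gives radii that serve a whole fibre.\<close>

lemma fibre_neighbourhood:
  assumes U: "\<And>q. q \<in> points P \<Longrightarrow> f q = b \<Longrightarrow> openin (topo P) (U q) \<and> q \<in> U q"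
  obtains W where "openin sphere_topology W" "b \<in> W"
    "\<And>p. p \<in> points P \<Longrightarrow> f p \<in> W \<Longrightarrow> \<exists>q\<in>points P. f q = b \<and> p \<in> U q"
proof -
  define N where "N = \<Union>(U ` {q \<in> points P. f q = b})"
  have "openin (topo P) N" unfolding N_def using U by (intro openin_Union) auto
  then have "closedin (topo P) (points P - N)" by blast
  moreover have "closed_map (topo P) sphere_topology f"
    using continuous_imp_closed_map[OF cont compact_topo] Hausdorff_sphere by (simp add: topo_sphere)
  ultimately have "closedin sphere_topology (f ` (points P - N))" by (simp add: closed_map_def)
  then have o: "openin sphere_topology (UNIV - f ` (points P - N))"
    using points_sphere by (simp add: closedin_def topo_sphere)
  show ?thesis
    by (rule that[OF o]) (use U in \<open>auto simp: N_def\<close>)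
qed

lemma fibre_neighbourhood_ball:
  assumes U: "\<And>q. q \<in> points P \<Longrightarrow> f q = Some b \<Longrightarrow> openin (topo P) (U q) \<and> q \<in> U q"
  obtains e where "e > 0"
    "\<And>p w. p \<in> points P \<Longrightarrow> w \<in> ball b e \<Longrightarrow> f p = Some w \<Longrightarrow> \<exists>q\<in>points P. f q = Some b \<and> p \<in> U q"
proof -
  obtain W where W: "openin sphere_topology W" "Some b \<in> W"
    "\<And>p. p \<in> points P \<Longrightarrow> f p \<in> W \<Longrightarrow> \<exists>q\<in>points P. f q = Some b \<and> p \<in> U q"
    by (rule fibre_neighbourhood[of "Some b" U]) (erule (1) U, rule that)
  then have "open {z. Some z \<in> W}" by (simp add: openin_sphere_topology)
  then obtain e where "e > 0" "ball b e \<subseteq> {z. Some z \<in> W}" using W(2) open_contains_ball by blast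
  then show ?thesis by (intro that[of e] W(3)) auto
qed

lemma open_map: "openin (topo P) A \<Longrightarrow> openin sphere_topology (f ` A)"
proof (subst openin_subopen, intro ballI)
  fix c assume A: "openin (topo P) A" "c \<in> f ` A"
  then obtain p where p: "p \<in> A" "c = f p" by blast
  have pP: "p \<in> points P" using p A openin_subset by blast
  obtain r \<gamma> where d: "disc P p r \<gamma>" "\<And>z. z \<in> ball 0 r \<Longrightarrow> f (\<gamma> z) = sphere_shift (f p) (z ^ ord p)"
    "\<gamma> ` ball 0 r \<subseteq> A" by (rule normal_form_shrink[OF pP A(1) p(1)]) (rule that)
  note n = ord_pos[OF pP]
  have rn: "r ^ ord p > 0" using discD(1)[OF d(1)] by simp
  have "ball 0 (r ^ ord p) \<subseteq> (\<lambda>z. z ^ ord p) ` ball (0::complex) r"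
    using power_image_ball_0[OF discD(1)[OF d(1)] n] by simp
  then have "sphere_shift c ` ball 0 (r ^ ord p) \<subseteq> f ` A"
    using d(2,3) p(2) by (force simp: image_subset_iff)
  moreover have "openin sphere_topology (sphere_shift c ` ball 0 (r ^ ord p))"
    using disc_open_image[OF complex_atlas_sphere disc_sphere_shift[OF rn], of "ball 0 (r ^ ord p)"] by (simp add: topo_sphere)
  moreover have "c \<in> sphere_shift c ` ball 0 (r ^ ord p)" using rn by (force intro: image_eqI[of _ _ 0])
  ultimately show "\<exists>T. openin sphere_topology T \<and> c \<in> T \<and> T \<subseteq> f ` A" by blast
qed

text \<open>The image is open since \<open>f\<close> is open, closed since \<open>P\<close> is
  compact, and the sphere is connected.\<close>

lemma surj: "f ` points P = UNIV"
proof -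
  have S: "connected_space sphere_topology" "topspace sphere_topology = UNIV" "Hausdorff_space sphere_topology"
    using connected_sphere Hausdorff_sphere points_sphere by (simp_all add: topo_sphere)
  have "openin sphere_topology (f ` points P)" by (rule open_map) auto
  moreover have "closedin sphere_topology (f ` points P)"
    using continuous_imp_closed_map[OF cont compact_topo S(3)] by (auto simp: closed_map_def)
  moreover have "points P \<noteq> {}" using nonconst by (auto simp: constant_on_def)
  ultimately show ?thesis using S unfolding connected_space_clopen_in by fastforce
qed

end

section \<open>Factorization through a map to the sphere\<close>

lemma holomorphic_map_plane_subset:
  assumes "holomorphic_map (plane V) Q g" "W \<subseteq> V"
  shows "holomorphic_map (plane W) Q g"
  unfolding holomorphic_map_from_plane
proof (intro conjI allI impI)
  show "continuous_map (top_of_set W) (topo Q) g"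
    using assms continuous_map_from_subtopology_mono unfolding holomorphic_map_from_plane by blast
  fix U \<psi> assume "(U, \<psi>) \<in> atlas Q"
  then have "(\<lambda>z. \<psi> (g z)) holomorphic_on {z \<in> V. g z \<in> U}"
    using assms(1) unfolding holomorphic_map_from_plane by blast
  then show "(\<lambda>z. \<psi> (g z)) holomorphic_on {z \<in> W. g z \<in> U}"
    by (rule holomorphic_on_subset) (use assms in auto)
qed

text \<open>Away from 0, a branch of the \<open>m\<close>-th root expresses \<open>K\<close> through
  \<open>k\<close>. Continuity of \<open>K\<close> comes from openness of the power map, and it
  makes the singularity at 0 removable.\<close>

lemma holomorphic_map_power_quotient:
  assumes Q: "complex_atlas Q" and k: "holomorphic_map (plane (ball 0 r)) Q k" and r: "r > 0" and m: "m > 0"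
    and K: "\<And>z. z \<in> ball 0 r \<Longrightarrow> k z = K (z ^ m)"
  shows "holomorphic_map (plane (ball 0 (r ^ m))) Q K"
proof -
  have root: "\<exists>z\<in>ball 0 r. t = z ^ m" if "t \<in> ball 0 (r ^ m)" for t :: complex
    using that unfolding power_image_ball_0[OF r m, symmetric] by auto
  have nc: "\<not> (\<lambda>z::complex. z ^ m) constant_on ball 0 r"
  proof
    assume "(\<lambda>z::complex. z ^ m) constant_on ball 0 r"
    then obtain c where c: "\<And>z. z \<in> ball (0::complex) r \<Longrightarrow> z ^ m = c" unfolding constant_on_def by blast
    from c[of 0] c[of "of_real (r / 2)"] show False using r m by (simp add: zero_power)
  qed
  have op: "open ((\<lambda>z. z ^ m) ` A)" if "open A" "A \<subseteq> ball 0 r" for A :: "complex set"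
    by (rule open_mapping_thm[OF _ open_ball connected_ball that nc]) (intro holomorphic_intros)
  have ck: "continuous_map (top_of_set (ball 0 r)) (topo Q) k" using k by (simp add: holomorphic_map_from_plane)
  have oN: "open {t \<in> ball 0 (r ^ m). K t \<in> W}" if W: "openin (topo Q) W" for W
  proof -
    have "{t \<in> ball 0 (r ^ m). K t \<in> W} = (\<lambda>z. z ^ m) ` {z \<in> ball 0 r. k z \<in> W}"
    proof (intro set_eqI iffI)
      fix t assume t: "t \<in> {t \<in> ball 0 (r ^ m). K t \<in> W}"
      then obtain z where "z \<in> ball 0 r" "t = z ^ m" using root by blast
      then show "t \<in> (\<lambda>z. z ^ m) ` {z \<in> ball 0 r. k z \<in> W}" using t K by auto
    next
      fix t assume "t \<in> (\<lambda>z. z ^ m) ` {z \<in> ball 0 r. k z \<in> W}"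
      then obtain z where "z \<in> ball 0 r" "t = z ^ m" "k z \<in> W" by blast
      then show "t \<in> {t \<in> ball 0 (r ^ m). K t \<in> W}" using K power_mem_ball_0[OF _ m] by simp
    qed
    moreover have "open ((\<lambda>z. z ^ m) ` {z \<in> ball 0 r. k z \<in> W})"
      by (rule op[OF open_plane_preimage[OF ck open_ball W]]) auto
    ultimately show ?thesis by simp
  qed
  have cK: "continuous_map (top_of_set (ball 0 (r ^ m))) (topo Q) K"
    unfolding continuous_map_def
  proof (intro conjI allI impI)
    show "K \<in> topspace (top_of_set (ball 0 (r ^ m))) \<rightarrow> points Q"
    proof
      fix t assume "t \<in> topspace (top_of_set (ball 0 (r ^ m)) :: complex topology)"
      then have "t \<in> ball 0 (r ^ m)" by simp
      then obtain z where z: "z \<in> ball 0 r" "t = z ^ m" using root by blast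
      then show "K t \<in> points Q" using holomorphic_map_in[OF k, of z] K[of z] by simp
    qed
    fix W assume "openin (topo Q) W"
    then show "openin (top_of_set (ball 0 (r ^ m))) {x \<in> topspace (top_of_set (ball 0 (r ^ m))). K x \<in> W}"
      using oN[of W] by (simp add: openin_open_eq) (auto intro: open_subset)
  qed
  show ?thesis unfolding holomorphic_map_from_plane
  proof (intro conjI allI impI cK)
    fix W \<psi> assume W: "(W, \<psi>) \<in> atlas Q"
    define N where "N = {t \<in> ball 0 (r ^ m). K t \<in> W}"
    have N: "open N" unfolding N_def by (rule oN[OF chartD(1)[OF Q W]])
    have "continuous_map (top_of_set N) (subtopology (topo Q) W) K"
    proof -
      have "N \<subseteq> ball 0 (r ^ m)" by (auto simp: N_def)
      from continuous_map_from_subtopology_mono[OF cK this] show ?thesis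
        by (auto simp: continuous_map_in_subtopology) (simp add: N_def)
    qed
    from continuous_map_compose[OF this chartD(5)[OF Q W]]
    have cont: "continuous_on N (\<lambda>t. \<psi> (K t))" by (simp add: o_def)
    have hk: "(\<lambda>z. \<psi> (k z)) holomorphic_on {z \<in> ball 0 r. k z \<in> W}"
      using k W by (simp add: holomorphic_map_from_plane)
    have "(\<lambda>t. \<psi> (K t)) holomorphic_on (N - {0})"
    proof (rule holomorphic_on_local)
      fix t0 assume t0: "t0 \<in> N - {0}"
      then obtain z0 where z0: "z0 \<in> ball 0 r" "t0 = z0 ^ m" using root[of t0] unfolding N_def by blast
      then have "z0 \<noteq> 0" using t0 m by auto
      then obtain \<rho> A where A: "open A" "z0 ^ m \<in> A" "\<rho> holomorphic_on A" "\<rho> (z0 ^ m) = z0" "\<And>t. t \<in> A \<Longrightarrow> \<rho> t ^ m = t"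
        by (rule local_power_root[OF _ m]) (rule that)
      have \<rho>: "\<rho> t \<in> ball 0 r" if "t \<in> A \<inter> N" for t
      proof -
        have "norm (\<rho> t) ^ m < r ^ m" using A(5)[of t] that by (simp add: N_def norm_power[symmetric])
        then show ?thesis using r by (simp add: power_less_imp_less_base)
      qed
      have "((\<lambda>z. \<psi> (k z)) \<circ> \<rho>) holomorphic_on (A \<inter> N)"
      proof (rule holomorphic_on_compose_gen[OF _ hk])
        show "\<rho> holomorphic_on (A \<inter> N)" using A(3) by (rule holomorphic_on_subset) auto
        show "\<rho> ` (A \<inter> N) \<subseteq> {z \<in> ball 0 r. k z \<in> W}"
        proof
          fix z assume "z \<in> \<rho> ` (A \<inter> N)"
          then obtain t where t: "t \<in> A \<inter> N" "z = \<rho> t" by blast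
          then show "z \<in> {z \<in> ball 0 r. k z \<in> W}" using \<rho>[OF t(1)] K[OF \<rho>[OF t(1)]] A(5)[of t] by (simp add: N_def)
        qed
      qed
      moreover have "((\<lambda>z. \<psi> (k z)) \<circ> \<rho>) t = \<psi> (K t)" if "t \<in> A \<inter> N" for t
        using K[OF \<rho>[OF that]] A(5)[of t] that by simp
      ultimately have "(\<lambda>t. \<psi> (K t)) holomorphic_on (A \<inter> N)" by (rule holomorphic_transform)
      then show "\<exists>T. open T \<and> t0 \<in> T \<and> (\<lambda>t. \<psi> (K t)) holomorphic_on T"
        using A N t0 z0 by (intro exI[of _ "A \<inter> N"]) auto
    qed
    then have "(\<lambda>t. \<psi> (K t)) holomorphic_on N"
      by (intro no_isolated_singularity[OF cont _ N, of "{0}"]) auto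
    then show "(\<lambda>t. \<psi> (K t)) holomorphic_on {t \<in> ball 0 (r ^ m). K t \<in> W}" by (simp add: N_def)
  qed
qed

text \<open>Connectedness of the surface without one fibre: fibre points are isolated and punctured
  discs are connected, so each fibre point can be added to exactly one of the two sets, which would
  separate the surface.\<close>

lemma (in sphere_map) connected_finite_part:
  assumes G: "openin (topo P) G" "openin (topo P) G'" "G \<inter> G' = {}" "G \<union> G' = {p \<in> points P. f p \<noteq> c}" "G \<noteq> {}"
  shows "G' = {}"
proof -
  define N where "N = {p \<in> points P. f p = c}"
  \<comment> \<open>Adds the fibre points that have a punctured neighbourhood in
    \<open>G\<close>.\<close>
  define ext where "ext G = G \<union> {p \<in> N. \<exists>A. openin (topo P) A \<and> p \<in> A \<and> A - {p} \<subseteq> G}" for G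
  have o: "openin (topo P) (ext G)" if G: "openin (topo P) G" for G
  proof (subst openin_subopen, intro ballI)
    fix p assume p: "p \<in> ext G"
    show "\<exists>T. openin (topo P) T \<and> p \<in> T \<and> T \<subseteq> ext G"
    proof (cases "p \<in> G")
      case False
      then obtain A where "openin (topo P) A" "p \<in> A" "A - {p} \<subseteq> G" "p \<in> N" using p unfolding ext_def by blast
      then show ?thesis by (intro exI[of _ A]) (auto simp: ext_def)
    qed (use G in \<open>auto simp: ext_def\<close>)
  qed
  have cov: "p \<in> ext G \<union> ext G'" if p: "p \<in> N" for p
  proof -
    have pP: "p \<in> points P" "f p = c" using p by (auto simp: N_def)
    obtain r \<gamma> where d: "disc P p r \<gamma>" "\<And>z. z \<in> ball 0 r \<Longrightarrow> f (\<gamma> z) = sphere_shift (f p) (z ^ ord p)"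
      by (rule normal_form[OF pP(1)]) (rule that)
    let ?B = "ball (0::complex) r - {0}"
    have cB: "connected ?B" by (rule connected_punctured_ball) simp
    have "\<gamma> ` ?B \<subseteq> G \<union> G'" using normal_form_fibre[OF d] discD(7)[OF d(1)] pP(2) unfolding G(4) by auto
    then have B: "?B \<subseteq> {z \<in> ball 0 r. \<gamma> z \<in> G} \<union> {z \<in> ball 0 r. \<gamma> z \<in> G'}" by blast
    have "open {z \<in> ball 0 r. \<gamma> z \<in> G}" "open {z \<in> ball 0 r. \<gamma> z \<in> G'}"
      using open_plane_preimage[OF discD(5)[OF d(1)] open_ball] G by blast+
    then have "{z \<in> ball 0 r. \<gamma> z \<in> G} \<inter> ?B = {} \<or> {z \<in> ball 0 r. \<gamma> z \<in> G'} \<inter> ?B = {}"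
      using connectedD[OF cB] B G(3) by blast
    then have "\<gamma> ` ?B \<subseteq> G \<or> \<gamma> ` ?B \<subseteq> G'" using B by blast
    moreover have "\<gamma> ` ball 0 r - {p} \<subseteq> \<gamma> ` ?B" using discD(2)[OF d(1)] by auto
    ultimately show ?thesis using p disc_neighbourhood(1,2)[OF P d(1)] unfolding ext_def by blast
  qed
  have dis: "ext G \<inter> ext G' = {}"
  proof (rule ccontr)
    assume "ext G \<inter> ext G' \<noteq> {}"
    then obtain p where p: "p \<in> ext G" "p \<in> ext G'" by blast
    have "p \<in> N"
    proof (rule ccontr)
      assume "p \<notin> N"
      then show False using p G(3) by (auto simp: ext_def)
    qed
    then have "p \<notin> G" "p \<notin> G'" using G(4) by (auto simp: N_def)
    then obtain A A' where A: "openin (topo P) A" "p \<in> A" "A - {p} \<subseteq> G" "openin (topo P) A'" "p \<in> A'" "A' - {p} \<subseteq> G'"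
      using p unfolding ext_def by blast
    have pP: "p \<in> points P" using \<open>p \<in> N\<close> by (simp add: N_def)
    obtain r \<gamma> where d: "disc P p r \<gamma>" using disc_exists[OF P pP] .
    have "openin (topo P) (A \<inter> A')" "p \<in> A \<inter> A'" using A by auto
    then obtain s where s: "0 < s" "s \<le> r" "disc P p s \<gamma>" "\<gamma> ` ball 0 s \<subseteq> A \<inter> A'"
      by (rule disc_shrink_into[OF P d]) (rule that)
    have "of_real (s / 2) \<in> ball (0::complex) s" using s by simp
    moreover have "\<gamma> (of_real (s / 2)) \<noteq> p" using inj_onD[OF discD(3)[OF s(3)], of "of_real (s / 2)" 0] discD(2)[OF d] s by auto
    ultimately show False using s(4) A(3,6) G(3) by blast
  qed
  have "ext G \<union> ext G' = points P"
  proof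
    show "ext G \<union> ext G' \<subseteq> points P" using o[OF G(1)] o[OF G(2)] openin_subset by blast
    show "points P \<subseteq> ext G \<union> ext G'"
    proof
      fix p assume "p \<in> points P"
      then have "p \<in> N \<or> p \<in> G \<union> G'" using G(4) by (auto simp: N_def)
      then show "p \<in> ext G \<union> ext G'" using cov by (auto simp: ext_def)
    qed
  qed
  moreover have "ext G \<noteq> {}" using G(5) by (auto simp: ext_def)
  ultimately have "ext G' = {}"
    using connected[unfolded connected_space_def not_ex, rule_format, of "ext G" "ext G'"] o[OF G(1)] o[OF G(2)] dis
    by auto
  then show ?thesis by (auto simp: ext_def)
qed

section \<open>Germs through which the second map factors\<close>

locale sphere_map_pair = sphere_map P f for P :: "'a surface" and f +
  fixes h :: "'a \<Rightarrow> complex option"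
  assumes hol_h: "holomorphic_map P riemann_sphere h"
begin

text \<open>By \<open>local_factor\<close>, this condition on fibres already yields a holomorphic
  factorization near \<open>p\<close>.\<close>

definition factors_at :: "'a \<Rightarrow> bool" where
  "factors_at p \<longleftrightarrow> (\<exists>A. openin (topo P) A \<and> p \<in> A \<and> (\<forall>q\<in>A. \<forall>q'\<in>A. f q = f q' \<longrightarrow> h q = h q'))"

lemma cont_h: "continuous_map (topo P) sphere_topology h"
  using holomorphic_mapD(1)[OF hol_h] by (simp add: topo_sphere)

lemmas holomorphic_map_disc_h = holomorphic_map_disc_comp[OF P complex_atlas_sphere hol_h]

lemma local_factor:
  assumes p: "p \<in> points P" and fac: "factors_at p"
  obtains r \<gamma> K where "disc P p r \<gamma>" "\<And>z. z \<in> ball 0 r \<Longrightarrow> f (\<gamma> z) = sphere_shift (f p) (z ^ ord p)"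
    "holomorphic_map (plane (ball 0 (r ^ ord p))) riemann_sphere K"
    "\<And>z. z \<in> ball 0 r \<Longrightarrow> h (\<gamma> z) = K (z ^ ord p)"
proof -
  obtain A where A: "openin (topo P) A" "p \<in> A" "\<And>q q'. q \<in> A \<Longrightarrow> q' \<in> A \<Longrightarrow> f q = f q' \<Longrightarrow> h q = h q'"
    using fac unfolding factors_at_def by blast
  obtain r \<gamma> where d: "disc P p r \<gamma>" "\<And>z. z \<in> ball 0 r \<Longrightarrow> f (\<gamma> z) = sphere_shift (f p) (z ^ ord p)"
    "\<gamma> ` ball 0 r \<subseteq> A" by (rule normal_form_shrink[OF p A(1,2)]) (rule that)
  define K where "K t = h (\<gamma> (SOME z. z \<in> ball 0 r \<and> z ^ ord p = t))" for t
  have K: "h (\<gamma> z) = K (z ^ ord p)" if z: "z \<in> ball 0 r" for z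
  proof -
    have "(SOME w. w \<in> ball 0 r \<and> w ^ ord p = z ^ ord p) \<in> ball 0 r \<and>
        (SOME w. w \<in> ball 0 r \<and> w ^ ord p = z ^ ord p) ^ ord p = z ^ ord p"
      by (rule someI[of _ z]) (use z in simp)
    then show ?thesis unfolding K_def using z d(2,3) by (intro A(3)) auto
  qed
  have "holomorphic_map (plane (ball 0 (r ^ ord p))) riemann_sphere K"
    by (rule holomorphic_map_power_quotient[OF complex_atlas_sphere holomorphic_map_disc_h[OF d(1)] discD(1)[OF d(1)] ord_pos[OF p] K])
  then show ?thesis using that d K by blast
qed

text \<open>The germ is attached to the point \<open>p\<close> and not to its value, since a priori
  different points over one value carry different germs.\<close>

definition germ_at :: "(complex \<Rightarrow> complex option) \<Rightarrow> 'a \<Rightarrow> bool" where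
  "germ_at \<psi> p \<longleftrightarrow> (\<exists>A. openin (topo P) A \<and> p \<in> A \<and> (\<forall>q\<in>A. \<exists>w. f q = Some w \<and> h q = \<psi> w))"

lemma germ_at_value: "germ_at \<psi> p \<Longrightarrow> f p = Some w \<Longrightarrow> h p = \<psi> w"
  unfolding germ_at_def by force

lemma openin_Some: "open B \<Longrightarrow> openin sphere_topology (Some ` B)"
  unfolding openin_sphere_topology by (auto simp: image_iff)

lemma openin_preimage_Some: "open B \<Longrightarrow> openin (topo P) A \<Longrightarrow> openin (topo P) {q \<in> A. f q \<in> Some ` B}"
  by (intro openin_preimage[OF cont] openin_Some)

text \<open>As \<open>f\<close> is open, \<psi> and \<open>\<psi>'\<close> agree on a neighbourhood
  of \<open>t\<close>; the intersection of the balls is convex, so the identity theorem spreads this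
  to \<open>w\<close>.\<close>

lemma germ_at_unique:
  assumes V: "holomorphic_map (plane (ball b e)) riemann_sphere \<psi>" "holomorphic_map (plane (ball b' e')) riemann_sphere \<psi>'"
    and g: "germ_at \<psi> p" "germ_at \<psi>' p" and p: "f p = Some t" "t \<in> ball b e" "t \<in> ball b' e'"
    and w: "w \<in> ball b e" "w \<in> ball b' e'"
  shows "\<psi> w = \<psi>' w"
proof -
  let ?V = "ball b e \<inter> ball b' e'"
  obtain A A' where A: "openin (topo P) A" "p \<in> A" "\<And>q. q \<in> A \<Longrightarrow> \<exists>w. f q = Some w \<and> h q = \<psi> w"
     "openin (topo P) A'" "p \<in> A'" "\<And>q. q \<in> A' \<Longrightarrow> \<exists>w. f q = Some w \<and> h q = \<psi>' w"
    using g unfolding germ_at_def by metis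
  have "openin sphere_topology (f ` (A \<inter> A'))" using A by (intro open_map) auto
  then have o: "open {z. Some z \<in> f ` (A \<inter> A')}" by (simp add: openin_sphere_topology)
  have oV: "open ?V" by auto
  have conn: "connected_space (topo (plane ?V))"
    using convex_connected[OF convex_Int[OF convex_ball convex_ball]]
    by (metis connectedin_topspace connectedin_iff_connected connectedin_subtopology plane_simps(1) topspace_euclidean_subtopology order_refl connectedin_absolute)
  show ?thesis
  proof (rule identity_theorem[OF complex_atlas_plane[OF oV] complex_atlas_sphere conn Hausdorff_sphere,
      where f = \<psi> and g = \<psi>' and A = "?V \<inter> {z. Some z \<in> f ` (A \<inter> A')}" and p = w])
    show "holomorphic_map (plane ?V) riemann_sphere \<psi>" "holomorphic_map (plane ?V) riemann_sphere \<psi>'"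
      using V holomorphic_map_plane_subset by blast+
    show "openin (topo (plane ?V)) (?V \<inter> {z. Some z \<in> f ` (A \<inter> A')})"
      using o by (simp add: openin_open_Int)
    show "?V \<inter> {z. Some z \<in> f ` (A \<inter> A')} \<noteq> {}" using p A(2,5) by force
    show "\<psi> x = \<psi>' x" if x: "x \<in> ?V \<inter> {z. Some z \<in> f ` (A \<inter> A')}" for x
    proof -
      obtain q where "q \<in> A" "q \<in> A'" "f q = Some x" using x by auto
      then show ?thesis using A(3)[of q] A(6)[of q] by auto
    qed
    show "w \<in> points (plane ?V)" using w by simp
  qed
qed

lemma germ_at_cong:
  assumes "germ_at \<psi> p" "open B" "f p \<in> Some ` B" "\<And>w. w \<in> B \<Longrightarrow> \<psi> w = \<psi>' w"
  shows "germ_at \<psi>' p"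
proof -
  obtain A where A: "openin (topo P) A" "p \<in> A" "\<And>q. q \<in> A \<Longrightarrow> \<exists>w. f q = Some w \<and> h q = \<psi> w"
    using assms(1) unfolding germ_at_def by blast
  show ?thesis unfolding germ_at_def
  proof (intro exI[of _ "{q \<in> A. f q \<in> Some ` B}"] conjI ballI)
    show "openin (topo P) {q \<in> A. f q \<in> Some ` B}" by (rule openin_preimage_Some[OF assms(2) A(1)])
    show "p \<in> {q \<in> A. f q \<in> Some ` B}" using A assms by simp
    fix q assume "q \<in> {q \<in> A. f q \<in> Some ` B}"
    then show "\<exists>w. f q = Some w \<and> h q = \<psi>' w" using A(3)[of q] assms(4) by auto
  qed
qed

text \<open>Every value in the ball must be taken at a point that carries \<psi>. Hence
  \<open>germ_points \<psi> v\<close> is nonempty there, and two branches with the same set at one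
  value share a germ.\<close>

definition branch :: "complex \<Rightarrow> real \<Rightarrow> (complex \<Rightarrow> complex option) \<Rightarrow> bool" where
  "branch b e \<psi> \<longleftrightarrow> holomorphic_map (plane (ball b e)) riemann_sphere \<psi> \<and>
     (\<forall>v\<in>ball b e. \<exists>p\<in>points P. f p = Some v \<and> germ_at \<psi> p)"

text \<open>Stands for the germ of \<psi> at \<open>v\<close>: a germ is recorded as the set of
  points over \<open>v\<close> that carry it.\<close>

definition germ_points :: "(complex \<Rightarrow> complex option) \<Rightarrow> complex \<Rightarrow> 'a set" where
  "germ_points \<psi> v = {p \<in> points P. f p = Some v \<and> germ_at \<psi> p}"

definition branches :: "(complex set \<times> (complex \<Rightarrow> 'a set)) set" where
  "branches = {(V, u). \<exists>b e \<psi>. V = ball b e \<and> u = germ_points \<psi> \<and> branch b e \<psi>}"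

lemma germ_points_eq:
  assumes V: "branch b e \<psi>" "branch b' e' \<psi>'"
    and g: "germ_at \<psi> p" "germ_at \<psi>' p" and p: "f p = Some t" "t \<in> ball b e" "t \<in> ball b' e'"
    and v: "v \<in> ball b e" "v \<in> ball b' e'"
  shows "germ_points \<psi> v = germ_points \<psi>' v"
proof -
  have eq: "\<psi> w = \<psi>' w" if "w \<in> ball b e \<inter> ball b' e'" for w
    by (rule germ_at_unique[of b e \<psi> b' e' \<psi>', OF _ _ g p]) (use V that in \<open>auto simp: branch_def\<close>)
  have o: "open (ball b e \<inter> ball b' e')" by auto
  have "germ_at \<psi> q \<longleftrightarrow> germ_at \<psi>' q" if "f q = Some v" for q
    using germ_at_cong[OF _ o, of \<psi> q \<psi>'] germ_at_cong[OF _ o, of \<psi>' q \<psi>] eq v that by auto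
  then show ?thesis by (auto simp: germ_points_def)
qed

lemma branch_at:
  assumes p: "p \<in> points P" "f p = Some b" and fac: "factors_at p"
  obtains e A \<psi> where "e > 0" "branch b e \<psi>" "openin (topo P) A" "p \<in> A"
    "\<And>q. q \<in> A \<Longrightarrow> germ_at \<psi> q" "\<And>q. q \<in> A \<Longrightarrow> f q \<in> Some ` ball b e"
    "\<And>v. v \<in> ball b e \<Longrightarrow> \<exists>q\<in>A. f q = Some v"
proof -
  obtain r \<gamma> K where d: "disc P p r \<gamma>" "\<And>z. z \<in> ball 0 r \<Longrightarrow> f (\<gamma> z) = sphere_shift (f p) (z ^ ord p)"
    and K: "holomorphic_map (plane (ball 0 (r ^ ord p))) riemann_sphere K"
    "\<And>z. z \<in> ball 0 r \<Longrightarrow> h (\<gamma> z) = K (z ^ ord p)"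
    by (rule local_factor[OF p(1) fac]) (rule that)
  define e where "e = r ^ ord p"
  note n = ord_pos[OF p(1)]
  have r: "r > 0" using discD(1)[OF d(1)] .
  have e: "e > 0" using r by (simp add: e_def)
  define \<psi> where "\<psi> v = K (v - b)" for v
  define A where "A = \<gamma> ` ball 0 r"
  have A: "openin (topo P) A" "p \<in> A" unfolding A_def by (rule disc_neighbourhood[OF P d(1)])+
  have val: "\<exists>w\<in>ball b e. f q = Some w \<and> h q = \<psi> w" if "q \<in> A" for q
  proof -
    obtain z where z: "z \<in> ball 0 r" "q = \<gamma> z" using \<open>q \<in> A\<close> by (auto simp: A_def)
    then have "b + z ^ ord p \<in> ball b e" using power_mem_ball_0[OF z(1) n] by (simp add: e_def dist_norm)
    moreover have "f q = Some (b + z ^ ord p)" using d(2)[OF z(1)] z(2) p(2) by simp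
    moreover have "h q = \<psi> (b + z ^ ord p)" using K(2)[OF z(1)] z(2) by (simp add: \<psi>_def)
    ultimately show ?thesis by blast
  qed
  have g: "germ_at \<psi> q" if "q \<in> A" for q unfolding germ_at_def using A that val by blast
  have sur: "\<exists>q\<in>A. f q = Some v" if v: "v \<in> ball b e" for v
  proof -
    have "v - b \<in> ball 0 (r ^ ord p)" using v by (simp add: e_def dist_norm norm_minus_commute)
    then obtain z where "z \<in> ball 0 r" "v - b = z ^ ord p" unfolding power_image_ball_0[OF r n, symmetric] by blast
    then show ?thesis using d(2)[of z] p(2) by (auto simp: A_def algebra_simps intro!: bexI[of _ "\<gamma> z"])
  qed
  have "holomorphic_map (plane (ball b e)) riemann_sphere (K \<circ> (\<lambda>v. v - b))"
  proof (rule holomorphic_map_compose[OF complex_atlas_plane complex_atlas_plane complex_atlas_sphere _ K(1)])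
    show "holomorphic_map (plane (ball b e)) (plane (ball 0 (r ^ ord p))) (\<lambda>v. v - b)"
      unfolding holomorphic_map_planes by (auto simp: e_def dist_norm norm_minus_commute intro!: holomorphic_intros)
  qed auto
  then have "branch b e \<psi>" unfolding branch_def \<psi>_def[abs_def, symmetric] o_def
    using sur g A(1) openin_subset by (metis (no_types, lifting) \<psi>_def subsetD)
  then show ?thesis using that[of e \<psi> A] e A g val sur by blast
qed

text \<open>A common point in the two sets carries both germs, which gives \<open>agree\<close>. For
  \<open>ext\<close>, properness places every point over a nearby value in a neighbourhood of some
  point of the finite fibre over \<open>b\<close>, and the branch there is defined on a ball of
  uniform size.\<close>

lemma local_sections_branches:
  assumes fac: "\<And>p. p \<in> points P \<Longrightarrow> f p \<noteq> None \<Longrightarrow> factors_at p"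
  shows "local_sections branches"
proof
  fix V u V' u' t t'
  assume *: "(V, u) \<in> branches" "(V', u') \<in> branches" "t \<in> V \<inter> V'" "u t = u' t" "t' \<in> V \<inter> V'"
  from *(1) obtain b e \<psi> where 1: "V = ball b e" "u = germ_points \<psi>" "branch b e \<psi>" by (auto simp: branches_def)
  from *(2) obtain b' e' \<psi>' where 2: "V' = ball b' e'" "u' = germ_points \<psi>'" "branch b' e' \<psi>'" by (auto simp: branches_def)
  obtain p where p: "p \<in> points P" "f p = Some t" "germ_at \<psi> p" using 1 *(3) unfolding branch_def by blast
  then have "p \<in> u' t" using *(4) 1 by (auto simp: germ_points_def)
  then have "germ_at \<psi>' p" using 2 by (auto simp: germ_points_def)
  then show "u t' = u' t'" using germ_points_eq[OF 1(3) 2(3) p(3) _ p(2)] * 1 2 by auto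
next
  fix b :: complex
  let ?fib = "{q \<in> points P. f q = Some b}"
  define good where "good q x \<longleftrightarrow> (case x of (e, A, \<psi>) \<Rightarrow> e > 0 \<and> branch b e \<psi> \<and> openin (topo P) A \<and> q \<in> A \<and>
    (\<forall>q'\<in>A. germ_at \<psi> q'))" for q x
  have "\<exists>x. good q x" if q: "q \<in> ?fib" for q
  proof -
    have q': "q \<in> points P" "f q = Some b" "factors_at q" using q fac by auto
    obtain e A \<psi> where "e > 0" "branch b e \<psi>" "openin (topo P) A" "q \<in> A" "\<And>q'. q' \<in> A \<Longrightarrow> germ_at \<psi> q'"
      by (rule branch_at[OF q']) (rule that)
    then show ?thesis by (intro exI[of _ "(e, A, \<psi>)"]) (simp add: good_def)
  qed
  then obtain X where X: "\<forall>q\<in>?fib. good q (X q)" using bchoice[of ?fib good] by blast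
  define e where "e q = fst (X q)" for q
  define A where "A q = fst (snd (X q))" for q
  define \<psi> where "\<psi> q = snd (snd (X q))" for q
  have *: "e q > 0 \<and> branch b (e q) (\<psi> q) \<and> openin (topo P) (A q) \<and> q \<in> A q \<and> (\<forall>q'\<in>A q. germ_at (\<psi> q) q')"
    if "q \<in> ?fib" for q
    using X[rule_format, OF that] unfolding good_def e_def A_def \<psi>_def by (simp add: split_def)
  obtain e1 where e1: "e1 > 0"
    "\<And>p w. p \<in> points P \<Longrightarrow> w \<in> ball b e1 \<Longrightarrow> f p = Some w \<Longrightarrow> \<exists>q\<in>points P. f q = Some b \<and> p \<in> A q"
    by (rule fibre_neighbourhood_ball[of b A]) (use * in blast, rule that)
  \<comment> \<open>Small enough for all branches over the fibre, and at most \<open>e1\<close>, so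
    that each point over the ball lies in some \<open>A q\<close>.\<close>
  define E where "E = Min (insert e1 (e ` ?fib))"
  have fin: "finite (insert e1 (e ` ?fib))" using finite_fibre by simp
  have E: "E > 0" "E \<le> e1" "\<And>q. q \<in> ?fib \<Longrightarrow> E \<le> e q"
    unfolding E_def using fin e1(1) * by (auto simp: Min_gr_iff intro: Min_le)
  show "\<exists>W. open W \<and> b \<in> W \<and> (\<forall>t\<in>W. \<forall>V u. (V, u) \<in> branches \<longrightarrow> t \<in> V \<longrightarrow>
     (\<exists>V' u'. (V', u') \<in> branches \<and> W \<subseteq> V' \<and> u' t = u t))"
  proof (rule exI[of _ "ball b E"], intro conjI ballI allI impI)
    fix t V u assume t: "t \<in> ball b E" and Vu: "(V, u) \<in> branches" "t \<in> V"
    from Vu(1) obtain b2 e2 \<psi>2 where 2: "V = ball b2 e2" "u = germ_points \<psi>2" "branch b2 e2 \<psi>2" by (auto simp: branches_def)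
    obtain p where p: "p \<in> points P" "f p = Some t" "germ_at \<psi>2 p" using 2 Vu(2) unfolding branch_def by blast
    have "t \<in> ball b e1" using t E by auto
    then obtain q where q: "q \<in> ?fib" "p \<in> A q" using e1(2)[OF p(1) _ p(2)] by blast
    have "t \<in> ball b (e q)" using t E(3)[OF q(1)] by auto
    then have "germ_points (\<psi> q) t = u t" unfolding 2
      by (intro germ_points_eq[OF _ 2(3) _ p(3,2)]) (use *[OF q(1)] q(2) 2 Vu in auto)
    moreover have "(ball b (e q), germ_points (\<psi> q)) \<in> branches" using *[OF q(1)] by (auto simp: branches_def)
    moreover have "ball b E \<subseteq> ball b (e q)" using E(3)[OF q(1)] by (rule subset_ball)
    ultimately show "\<exists>V' u'. (V', u') \<in> branches \<and> ball b E \<subseteq> V' \<and> u' t = u t" by blast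
  qed (use E in auto)
qed

text \<open>
  The germs of \<open>\<psi>\<close> with \<open>h = \<psi> \<circ> f\<close> form a covering of the simply connected plane, so a
  germ at one point extends to a global section. The points carrying the germ selected by that
  section form a set that is open and closed outside the poles of \<open>f\<close>.
\<close>

lemma factor_finite:
  assumes fac: "\<And>p. p \<in> points P \<Longrightarrow> f p \<noteq> None \<Longrightarrow> factors_at p"
    and p0: "p0 \<in> points P" "f p0 = Some b0" and q0: "q0 \<in> points P" "f q0 = Some b0"
  shows "h p0 = h q0"
proof -
  interpret B: local_sections branches by (rule local_sections_branches[OF fac])
  obtain e0 A0 \<psi>0 where 0: "e0 > 0" "branch b0 e0 \<psi>0" "p0 \<in> A0" "\<And>q. q \<in> A0 \<Longrightarrow> germ_at \<psi>0 q"
  proof -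
    have "factors_at p0" using fac p0 by simp
    then show ?thesis by (rule branch_at[OF p0]) (rule that)
  qed
  have "(ball b0 e0, germ_points \<psi>0) \<in> branches" using 0 by (auto simp: branches_def)
  then obtain s where s: "B.section_on UNIV s" "s b0 = germ_points \<psi>0 b0"
    by (rule B.section_exists) (use 0 in auto)
  \<comment> \<open>The points that carry the germ selected by the section at their value, and those
    with finite value that do not.\<close>
  define G where "G = {p \<in> points P. \<exists>w. f p = Some w \<and> p \<in> s w}"
  define G' where "G' = {p \<in> points P. \<exists>w. f p = Some w \<and> p \<notin> s w}"
  have loc: "\<exists>b e \<psi> W. branch b e \<psi> \<and> open W \<and> w \<in> W \<and> W \<subseteq> ball b e \<and> (\<forall>v\<in>W. s v = germ_points \<psi> v)" for w
  proof -
    obtain V u W where 1: "(V, u) \<in> branches" "open W" "w \<in> W" "W \<subseteq> V" "\<And>t'. t' \<in> UNIV \<Longrightarrow> t' \<in> W \<Longrightarrow> s t' = u t'"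
      by (rule B.section_onE[OF s(1) UNIV_I[of w]]) (rule that)
    then show ?thesis unfolding branches_def by blast
  qed
  have oG: "openin (topo P) G"
  proof (subst openin_subopen, intro ballI)
    fix p assume "p \<in> G"
    then obtain w where p: "p \<in> points P" "f p = Some w" "p \<in> s w" by (auto simp: G_def)
    obtain b e \<psi> W where W: "branch b e \<psi>" "open W" "w \<in> W" "\<And>v. v \<in> W \<Longrightarrow> s v = germ_points \<psi> v"
      using loc[of w] by blast
    have "germ_at \<psi> p" using p W by (auto simp: germ_points_def)
    then obtain A where A: "openin (topo P) A" "p \<in> A" "\<And>q. q \<in> A \<Longrightarrow> \<exists>w. f q = Some w \<and> h q = \<psi> w"
      unfolding germ_at_def by blast
    then have gA: "germ_at \<psi> q" if "q \<in> A" for q using that unfolding germ_at_def by blast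
    show "\<exists>T. openin (topo P) T \<and> p \<in> T \<and> T \<subseteq> G"
    proof (intro exI conjI)
      show "openin (topo P) {q \<in> A. f q \<in> Some ` W}" by (rule openin_preimage_Some[OF W(2) A(1)])
      show "p \<in> {q \<in> A. f q \<in> Some ` W}" using A p W by simp
      show "{q \<in> A. f q \<in> Some ` W} \<subseteq> G"
      proof
        fix q assume "q \<in> {q \<in> A. f q \<in> Some ` W}"
        then obtain v where v: "q \<in> A" "v \<in> W" "f q = Some v" by auto
        then have "q \<in> points P" using A openin_subset by blast
        then show "q \<in> G" using v gA W(4)[OF v(2)] by (auto simp: G_def germ_points_def)
      qed
    qed
  qed
  have oG': "openin (topo P) G'"
  proof (subst openin_subopen, intro ballI)
    fix p assume "p \<in> G'"
    then obtain w where p: "p \<in> points P" "f p = Some w" "p \<notin> s w" by (auto simp: G'_def)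
    obtain b e \<psi> W where W: "branch b e \<psi>" "open W" "w \<in> W" "W \<subseteq> ball b e" "\<And>v. v \<in> W \<Longrightarrow> s v = germ_points \<psi> v"
      using loc[of w] by blast
    have ng: "\<not> germ_at \<psi> p" using p W by (auto simp: germ_points_def)
    have "factors_at p" using fac p by simp
    then obtain e1 A1 \<psi>1 where 1: "e1 > 0" "branch w e1 \<psi>1" "openin (topo P) A1" "p \<in> A1" "\<And>q. q \<in> A1 \<Longrightarrow> germ_at \<psi>1 q"
      by (rule branch_at[OF p(1,2)]) (rule that)
    show "\<exists>T. openin (topo P) T \<and> p \<in> T \<and> T \<subseteq> G'"
    proof (intro exI conjI)
      show "openin (topo P) {q \<in> A1. f q \<in> Some ` (W \<inter> ball w e1)}" by (rule openin_preimage_Some[OF _ 1(3)]) (use W in auto)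
      show "p \<in> {q \<in> A1. f q \<in> Some ` (W \<inter> ball w e1)}" using 1 p W by simp
      show "{q \<in> A1. f q \<in> Some ` (W \<inter> ball w e1)} \<subseteq> G'"
      proof
        fix q assume "q \<in> {q \<in> A1. f q \<in> Some ` (W \<inter> ball w e1)}"
        then obtain v where v: "q \<in> A1" "v \<in> W" "v \<in> ball w e1" "f q = Some v" by auto
        have qP: "q \<in> points P" using v 1 openin_subset by blast
        have "\<not> germ_at \<psi> q"
        proof
          assume g: "germ_at \<psi> q"
          \<comment> \<open>If the nearby point \<open>q\<close> carried \<psi>, then \<psi> would
            coincide with the branch at \<open>p\<close> on the overlap, and \<open>p\<close> would
            carry \<psi> as well.\<close>
          have "germ_points \<psi>1 w = germ_points \<psi> w"
            by (rule germ_points_eq[OF 1(2) W(1) 1(5)[OF v(1)] g v(4)]) (use v W 1 in auto)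
          then show False using ng 1(4,5) p by (auto simp: germ_points_def)
        qed
        then show "q \<in> G'" using qP v W(5)[OF v(2)] by (auto simp: G'_def germ_points_def)
      qed
    qed
  qed
  have "p0 \<in> G" using p0 s(2) 0 by (auto simp: G_def germ_points_def)
  moreover have "G \<inter> G' = {}" "G \<union> G' = {p \<in> points P. f p \<noteq> None}" by (auto simp: G_def G'_def)
  ultimately have "G' = {}" using connected_finite_part[OF oG oG'] by blast
  then have "q0 \<in> s b0" using q0 by (auto simp: G'_def)
  then have "germ_at \<psi>0 q0" using s(2) by (auto simp: germ_points_def)
  then show ?thesis using germ_at_value 0(3,4) p0 q0 by metis
qed

text \<open>At two poles with different values of \<open>h\<close>, openness of \<open>f\<close>
  produces points close to them with a common finite value of \<open>f\<close>, where
  \<open>h\<close> is already known to agree.\<close>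

theorem factor:
  assumes fac: "\<And>p. p \<in> points P \<Longrightarrow> f p \<noteq> None \<Longrightarrow> factors_at p"
    and pq: "p \<in> points P" "q \<in> points P" "f p = f q"
  shows "h p = h q"
proof (cases "f p")
  case (Some b)
  then show ?thesis using factor_finite[OF fac] pq by metis
next
  case None
  show ?thesis
  proof (rule ccontr)
    assume "h p \<noteq> h q"
    then obtain V W where V: "openin sphere_topology V" "openin sphere_topology W" "h p \<in> V" "h q \<in> W" "disjnt V W"
      using Hausdorff_sphere points_sphere unfolding Hausdorff_space_def topo_sphere by (metis UNIV_I)
    define A where "A = {x \<in> points P. h x \<in> V}"
    define B where "B = {x \<in> points P. h x \<in> W}"
    have "openin (topo P) A" "openin (topo P) B" unfolding A_def B_def
      by (intro openin_preimage[OF cont_h] V openin_topspace)+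
    then have "openin sphere_topology (f ` A \<inter> f ` B)" using open_map by blast
    moreover have "None \<in> f ` A \<inter> f ` B" using None pq V by (force simp: A_def B_def)
    ultimately have "compact {z. Some z \<notin> f ` A \<inter> f ` B}" by (simp add: openin_sphere_topology)
    \<comment> \<open>An open set containing infinity has compact complement in the plane, so it
      contains finite values.\<close>
    then have "{z. Some z \<notin> f ` A \<inter> f ` B} \<noteq> UNIV" using not_compact_UNIV by metis
    then obtain w where "Some w \<in> f ` A \<inter> f ` B" by blast
    then obtain x y where "x \<in> A" "y \<in> B" "f x = Some w" "f y = Some w" by auto
    then have "h x = h y" "h x \<in> V" "h y \<in> W" using factor_finite[OF fac] by (auto simp: A_def B_def)
    then show False using V(5) by (auto simp: disjnt_iff)
  qed
qed

end

section \<open>Factorization at ramification points\<close>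

lemma deriv_shift: "deriv (\<lambda>z. g (z0 + z)) 0 = deriv g (z0 :: complex)"
  using deriv_shift_0'[where f = g and z = z0] by (simp add: o_def)

text \<open>Here \<open>z\<close> and \<open>y = \<alpha> z\<close> are coordinates in which
  \<open>f\<close> and \<open>h\<close> are powers, and \<open>H\<close> is \<open>h\<close> in
  terms of \<open>z\<close>. The map turns \<open>z\<close> by \<omega> and then \<open>y\<close> by
  the inverse of \<omega>, so its derivative at 0 is 1. By \<open>E\<close> the density is a
  pullback under \<open>f\<close> as well as under \<open>h\<close>, hence preserved by both
  rotations.\<close>

lemma density_rotation:
  fixes \<alpha> \<beta> H :: "complex \<Rightarrow> complex" and m m' :: "complex \<Rightarrow> real"
  assumes e: "e > 0" and \<alpha>: "\<alpha> holomorphic_on ball 0 e" "\<alpha> 0 = 0"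
    and \<beta>: "\<beta> holomorphic_on ball 0 e'" "\<beta> 0 = 0"
    and \<alpha>\<beta>: "\<And>z. z \<in> ball 0 e \<Longrightarrow> \<alpha> z \<in> ball 0 e' \<and> \<beta> (\<alpha> z) = z"
    and n: "n > 0" and \<omega>: "\<omega> ^ n = 1"
    and H: "H holomorphic_on ball 0 e - {0}" "\<And>z. z \<in> ball 0 e - {0} \<Longrightarrow> deriv H z \<noteq> 0"
    and HT: "\<And>z. z \<in> ball 0 e - {0} \<Longrightarrow> \<beta> (\<alpha> (\<omega> * z) / \<omega>) \<in> ball 0 e - {0} \<Longrightarrow> H (\<beta> (\<alpha> (\<omega> * z) / \<omega>)) = H (\<omega> * z)"
    and E: "\<And>z. z \<in> ball 0 e - {0} \<Longrightarrow> m' (H z) * norm (of_nat n * z ^ (n - 1)) = m (a + z ^ n) * norm (deriv H z)"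
    and c: "c > 0" and low: "\<And>z. z \<in> ball 0 e - {0} \<Longrightarrow> c * norm z ^ n \<le> m (a + z ^ n)"
    and z: "z \<in> ball 0 e"
  shows "\<beta> (\<alpha> (\<omega> * z) / \<omega>) = z"
proof -
  have norm\<omega>: "norm \<omega> = 1" using power_eq_1_iff[OF \<omega>] n by simp
  then have \<omega>0: "\<omega> \<noteq> 0" by auto
  have rot: "\<omega> * z \<in> ball 0 e - {0} \<longleftrightarrow> z \<in> ball 0 e - {0}" "\<omega> * z \<in> ball 0 e \<longleftrightarrow> z \<in> ball 0 e" for z
    using norm\<omega> \<omega>0 by (auto simp: norm_mult)
  define T where "T z = \<beta> (\<alpha> (\<omega> * z) / \<omega>)" for z
  define \<mu> where "\<mu> z = m (a + z ^ n) / norm (of_nat n * z ^ (n - 1))" for z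
  have D0: "of_nat n * z ^ (n - 1) \<noteq> 0" if "z \<in> ball 0 e - {0}" for z :: complex using that n by simp
  have h1: "(\<lambda>z. \<alpha> (\<omega> * z) / \<omega>) holomorphic_on ball 0 e"
  proof -
    have "(\<alpha> \<circ> (\<lambda>z. \<omega> * z)) holomorphic_on ball 0 e"
      by (rule holomorphic_on_compose_gen[OF _ \<alpha>(1)]) (use rot(2) in \<open>auto intro!: holomorphic_intros\<close>)
    then show ?thesis using \<omega>0 by (auto simp: o_def intro!: holomorphic_intros)
  qed
  have in': "\<alpha> (\<omega> * z) / \<omega> \<in> ball 0 e'" if "z \<in> ball 0 e" for z
    using \<alpha>\<beta>[of "\<omega> * z"] rot(2)[of z] that norm\<omega> by (simp add: norm_divide)
  have hT: "T holomorphic_on ball 0 e"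
  proof -
    have "(\<beta> \<circ> (\<lambda>z. \<alpha> (\<omega> * z) / \<omega>)) holomorphic_on ball 0 e"
      by (rule holomorphic_on_compose_gen[OF h1 \<beta>(1)]) (use in' in auto)
    then show ?thesis by (simp add: o_def T_def[abs_def])
  qed
  have e': "e' > 0" using \<alpha>\<beta>[of 0] e \<alpha>(2) by simp
  have d\<alpha>: "(\<alpha> has_field_derivative deriv \<alpha> 0) (at 0)"
    using \<alpha>(1) e by (intro holomorphic_derivI[of \<alpha> "ball 0 e"]) auto
  have d\<beta>: "(\<beta> has_field_derivative deriv \<beta> 0) (at 0)"
    using \<beta>(1) e' by (intro holomorphic_derivI[of \<beta> "ball 0 e'"]) auto
  have one: "deriv \<beta> 0 * deriv \<alpha> 0 = 1"
  proof -
    have "((\<lambda>z. \<beta> (\<alpha> z)) has_field_derivative deriv \<beta> 0 * deriv \<alpha> 0) (at 0)"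
      by (rule DERIV_chain2[OF _ d\<alpha>]) (simp add: \<alpha> d\<beta>)
    moreover have "((\<lambda>z. \<beta> (\<alpha> z)) has_field_derivative 1) (at 0)"
      by (rule has_field_derivative_transform_within_open[OF DERIV_ident open_ball[of 0 e]]) (use e \<alpha>\<beta> in auto)
    ultimately show ?thesis by (rule DERIV_unique)
  qed
  have T0: "T 0 = 0" using \<alpha> \<beta> by (simp add: T_def)
  have T1: "deriv T 0 = 1"
  proof -
    have "((\<lambda>z. \<alpha> (\<omega> * z)) has_field_derivative deriv \<alpha> 0 * \<omega>) (at 0)"
      by (rule DERIV_chain2[of \<alpha> _ "\<lambda>z. \<omega> * z"]) (use d\<alpha> in \<open>auto intro!: derivative_eq_intros\<close>)
    then have "((\<lambda>z. \<alpha> (\<omega> * z) / \<omega>) has_field_derivative deriv \<alpha> 0) (at 0)"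
      using \<omega>0 by (auto dest: DERIV_cdivide[of _ _ _ _ \<omega>])
    then have "((\<lambda>z. \<beta> (\<alpha> (\<omega> * z) / \<omega>)) has_field_derivative deriv \<beta> 0 * deriv \<alpha> 0) (at 0)"
      by (rule DERIV_chain2[rotated]) (simp add: \<alpha> d\<beta>)
    then show ?thesis using one by (simp add: T_def[abs_def] DERIV_imp_deriv)
  qed
  have "T z = z"
  proof (rule invariant_density_tangent_identity[OF hT T0 T1, of "c / n" \<mu>])
    show "c / n > 0" using c n by simp
    fix z :: complex assume z: "z \<in> ball 0 e - {0}"
    \<comment> \<open>The bound of order \<open>norm z ^ n\<close> on \<open>m\<close> is divided by
      the derivative of \<open>z ^ n\<close>, which leaves a bound linear in
      \<open>norm z\<close>.\<close>
    have "c / n * norm z = c * norm z ^ n / norm (of_nat n * z ^ (n - 1))"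
    proof -
      have "norm (of_nat n * z ^ (n - 1)) = n * norm z ^ (n - 1)" by (simp add: norm_mult norm_power)
      moreover have "norm z ^ n = norm z * norm z ^ (n - 1)" using n by (metis power_minus_mult mult.commute)
      ultimately show ?thesis using z n by simp
    qed
    also have "\<dots> \<le> \<mu> z" unfolding \<mu>_def using low[OF z] by (intro divide_right_mono) auto
    finally show "c / n * norm z \<le> \<mu> z" .
    assume Tz: "T z \<in> ball 0 e - {0}"
    define N where "N = {w \<in> ball 0 e - {0}. T w \<in> ball 0 e - {0}}"
    have "open N"
    proof -
      have "continuous_on (ball 0 e - {0}) T"
        using holomorphic_on_imp_continuous_on[OF hT] continuous_on_subset by blast
      then have "open ((ball 0 e - {0}) \<inter> T -` (ball 0 e - {0}))"
        by (intro continuous_open_preimage) auto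
      then show ?thesis by (simp add: N_def vimage_def Int_def)
    qed
    have zN: "z \<in> N" using z Tz by (simp add: N_def)
    have dH: "(H has_field_derivative deriv H w) (at w)" if "w \<in> ball 0 e - {0}" for w
      using H(1) that by (intro holomorphic_derivI[of H "ball 0 e - {0}"]) auto
    have dT: "(T has_field_derivative deriv T z) (at z)"
      using hT z by (intro holomorphic_derivI[of T "ball 0 e"]) auto
    have wz: "\<omega> * z \<in> ball 0 e - {0}" using z rot by blast
    have "((\<lambda>w. H (T w)) has_field_derivative deriv H (T z) * deriv T z) (at z)"
      by (rule DERIV_chain2[OF dH[OF Tz] dT])
    moreover have "((\<lambda>w. H (T w)) has_field_derivative deriv H (\<omega> * z) * \<omega>) (at z)"
    proof (rule has_field_derivative_transform_within_open[OF _ \<open>open N\<close> zN])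
      show "((\<lambda>w. H (\<omega> * w)) has_field_derivative deriv H (\<omega> * z) * \<omega>) (at z)"
        by (rule DERIV_chain2[where f = H and g = "\<lambda>w. \<omega> * w", OF dH[OF wz]]) (auto intro!: derivative_eq_intros)
      show "H (\<omega> * w) = H (T w)" if "w \<in> N" for w
        using HT[of w] that by (simp add: N_def T_def)
    qed
    ultimately have dd: "deriv H (T z) * deriv T z = deriv H (\<omega> * z) * \<omega>" by (rule DERIV_unique)
    then have nn: "norm (deriv H (T z)) * norm (deriv T z) = norm (deriv H (\<omega> * z))"
      using norm\<omega> by (metis norm_mult mult.right_neutral)
    \<comment> \<open>The second description of \<mu>, through \<open>H\<close>. The first shows
      invariance under \<omega>, this one invariance under the rotation of \<open>y\<close>.\<close>
    have mu: "\<mu> w = m' (H w) / norm (deriv H w)" if w: "w \<in> ball 0 e - {0}" for w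
      using E[OF w] D0[OF w] H(2)[OF w] unfolding \<mu>_def by (simp add: frac_eq_eq)
    have "norm (of_nat n * (\<omega> * z) ^ (n - 1)) = norm (of_nat n * z ^ (n - 1))"
      using norm\<omega> by (simp add: norm_mult norm_power)
    then have "\<mu> (\<omega> * z) = \<mu> z" using \<omega> by (simp add: \<mu>_def power_mult_distrib)
    then have "\<mu> z = m' (H (T z)) / norm (deriv H (\<omega> * z))"
      using mu[OF wz] HT[OF z] Tz by (simp add: T_def)
    moreover have "\<mu> (T z) = m' (H (T z)) / norm (deriv H (T z))" by (rule mu[OF Tz])
    ultimately have "\<mu> (T z) * norm (deriv H (T z)) = \<mu> z * norm (deriv H (\<omega> * z))"
      using H(2)[OF Tz] H(2)[OF wz] by simp
    then have "\<mu> (T z) * norm (deriv H (T z)) = norm (deriv T z) * \<mu> z * norm (deriv H (T z))"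
      unfolding nn[symmetric] by (simp add: ac_simps)
    then show "\<mu> (T z) = norm (deriv T z) * \<mu> z" using H(2)[OF Tz] by simp
  qed (rule z)
  then show ?thesis by (simp add: T_def)
qed

locale same_ramification = sphere_map_pair P f h + H: sphere_map P h
  for P :: "'a surface" and f h +
  assumes ord_eq: "\<And>p. p \<in> points P \<Longrightarrow> H.ord p = ord p"
    and critical_preimage_eq: "critical_preimage P riemann_sphere h = critical_preimage P riemann_sphere f"
begin

abbreviation S where "S \<equiv> critical_preimage P riemann_sphere f"

lemma ord_1: "p \<in> points P \<Longrightarrow> p \<notin> S \<Longrightarrow> ord p = 1"
  using critical_preimageI by blast

lemma openin_Compl_S: "openin (topo P) (points P - (S - {p}))"
proof -
  have "closedin (topo P) (S - {p})"
    by (rule closedin_Hausdorff_finite[OF haus])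
      (use finite_critical_preimage in \<open>auto simp: critical_preimage_def\<close>)
  then show ?thesis by blast
qed

text \<open>Ramification number 1 makes \<open>h\<close> injective near \<open>p\<close>, and an
  injective holomorphic function has no critical point. For \<open>f\<close> it is obtained by
  exchanging the two maps.\<close>

lemma deriv_h_nonzero:
  assumes d: "disc P p r \<gamma>" and "\<And>z. z \<in> ball 0 r \<Longrightarrow> h (\<gamma> z) \<noteq> None" "H.ord p = 1"
  shows "deriv (\<lambda>z. the (h (\<gamma> z))) 0 \<noteq> 0"
proof -
  note pP = disc_neighbourhood(3)[OF P d]
  obtain A where A: "openin (topo P) A" "p \<in> A" "inj_on h A"
    by (rule H.inj_if_ord_1[OF pP assms(3)]) (rule that)
  obtain s where s: "0 < s" "s \<le> r" "disc P p s \<gamma>" "\<gamma> ` ball 0 s \<subseteq> A"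
    by (rule disc_shrink_into[OF P d A(1,2)]) (rule that)
  have ne: "h (\<gamma> z) \<noteq> None" if "z \<in> ball 0 s" for z using assms(2) that s(2) by auto
  have hol: "(\<lambda>z. the (h (\<gamma> z))) holomorphic_on ball 0 s"
    by (rule holomorphic_on_the_disc[OF P hol_h s(3) ne])
  have inj: "inj_on (\<lambda>z. the (h (\<gamma> z))) (ball 0 s)"
  proof (rule inj_onI)
    fix x y :: complex assume xy: "x \<in> ball 0 s" "y \<in> ball 0 s" "the (h (\<gamma> x)) = the (h (\<gamma> y))"
    then have "h (\<gamma> x) = h (\<gamma> y)" using ne[of x] ne[of y] by (metis option.expand)
    moreover have "\<gamma> x \<in> A" "\<gamma> y \<in> A" using s(4) xy by blast+
    ultimately have "\<gamma> x = \<gamma> y" using A(3) by (auto dest: inj_onD)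
    then show "x = y" using discD(3)[OF s(3)] xy by (auto dest: inj_onD)
  qed
  show ?thesis by (rule holomorphic_injective_imp_regular[OF hol open_ball inj]) (use s in simp)
qed

text \<open>
  Let \<open>z\<close> and \<open>y\<close> be coordinates at \<open>p\<close> in which \<open>f\<close> and \<open>h\<close> are powers. The maps \<open>z \<mapsto> \<omega> * z\<close> and
  \<open>y \<mapsto> \<omega> * y\<close> both preserve the common density, and their quotient is tangent to the
  identity. Hence they coincide, so that \<open>h\<close> is a function of \<open>f\<close> near \<open>p\<close>.
\<close>

lemma factors_at_if_density:
  assumes p: "p \<in> points P" "f p = Some a"
    and fin: "\<And>q. q \<in> points P \<Longrightarrow> q \<notin> S \<Longrightarrow> f q \<noteq> None \<and> h q \<noteq> None"
    and dens: "\<And>q r \<gamma>. q \<in> points P \<Longrightarrow> q \<notin> S \<Longrightarrow> disc P q r \<gamma> \<Longrightarrow>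
      m' (the (h q)) * norm (deriv (\<lambda>z. the (f (\<gamma> z))) 0) = m (the (f q)) * norm (deriv (\<lambda>z. the (h (\<gamma> z))) 0)"
    and c: "c > 0" "\<epsilon> > 0" and low: "\<And>b. b \<in> ball a \<epsilon> - {a} \<Longrightarrow> c * norm (b - a) \<le> m b"
  shows "factors_at p"
proof -
  define n where "n = ord p"
  have n: "n > 0" using ord_pos[OF p(1)] by (simp add: n_def)
  obtain r \<gamma> where d: "disc P p r \<gamma>" "\<And>z. z \<in> ball 0 r \<Longrightarrow> f (\<gamma> z) = sphere_shift (f p) (z ^ ord p)"
    "\<gamma> ` ball 0 r \<subseteq> points P - (S - {p})"
    by (rule normal_form_shrink[OF p(1) openin_Compl_S[of p]]) (use p in simp, rule that)
  have fz: "f (\<gamma> z) = Some (a + z ^ n)" if "z \<in> ball 0 r" for z using d(2)[OF that] p(2) by (simp add: n_def)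
  have nS: "\<gamma> z \<in> points P" "\<gamma> z \<notin> S" if "z \<in> ball 0 r - {0}" for z
  proof -
    show "\<gamma> z \<in> points P" using d(3) that by blast
    have "\<gamma> z \<noteq> p" using inj_onD[OF discD(3)[OF d(1)], of z 0] discD(1,2)[OF d(1)] that by auto
    then show "\<gamma> z \<notin> S" using d(3) that by blast
  qed
  obtain r2 \<gamma>2 where d2: "disc P p r2 \<gamma>2" "\<And>z. z \<in> ball 0 r2 \<Longrightarrow> h (\<gamma>2 z) = sphere_shift (h p) (z ^ H.ord p)"
    by (rule H.normal_form[OF p(1)]) (rule that)
  have hy: "h (\<gamma>2 y) = sphere_shift (h p) (y ^ n)" if "y \<in> ball 0 r2" for y
    using d2(2)[OF that] ord_eq[OF p(1)] by (simp add: n_def)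
  obtain e1 \<alpha> where \<alpha>: "0 < e1" "e1 \<le> r" "\<alpha> holomorphic_on ball 0 e1" "inj_on \<alpha> (ball 0 e1)"
    "\<alpha> 0 = 0" "deriv \<alpha> 0 \<noteq> 0" "\<alpha> ` ball 0 e1 \<subseteq> ball 0 r2" "\<And>z. z \<in> ball 0 e1 \<Longrightarrow> \<gamma> z = \<gamma>2 (\<alpha> z)"
    by (rule disc_transition[OF P d(1) d2(1)]) (rule that)
  obtain e2 \<beta> where \<beta>: "0 < e2" "e2 \<le> r2" "\<beta> holomorphic_on ball 0 e2" "inj_on \<beta> (ball 0 e2)"
    "\<beta> 0 = 0" "deriv \<beta> 0 \<noteq> 0" "\<beta> ` ball 0 e2 \<subseteq> ball 0 r" "\<And>z. z \<in> ball 0 e2 \<Longrightarrow> \<gamma>2 z = \<gamma> (\<beta> z)"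
    by (rule disc_transition[OF P d2(1) d(1)]) (rule that)
  have "open (ball 0 e1 \<inter> \<alpha> -` ball 0 e2)"
    by (intro continuous_open_preimage holomorphic_on_imp_continuous_on \<alpha>) auto
  moreover have "0 \<in> ball 0 e1 \<inter> \<alpha> -` ball 0 e2" using \<alpha> \<beta> by simp
  ultimately obtain e3 where e3: "e3 > 0" "ball 0 e3 \<subseteq> ball 0 e1 \<inter> \<alpha> -` ball 0 e2"
    using open_contains_ball by blast
  \<comment> \<open>Below \<open>e3\<close> the function \<alpha> lands in the domain of \<beta>;
    the bounds 1 and \<epsilon> give \<open>norm w ^ n \<le> norm w < \<epsilon>\<close>, so that
    \<open>low\<close> applies to \<open>a + w ^ n\<close>.\<close>
  define e where "e = min (min e1 e3) (min 1 \<epsilon>)"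
  have e: "e > 0" "e \<le> e1" "e \<le> e3" "e \<le> 1" "e \<le> \<epsilon>" "e \<le> r" using \<alpha> e3 c by (auto simp: e_def)
  have ab: "\<alpha> z \<in> ball 0 e2 \<and> \<beta> (\<alpha> z) = z" if z: "z \<in> ball 0 e" for z
  proof -
    have "z \<in> ball 0 e3" using z e by simp
    then have 1: "\<alpha> z \<in> ball 0 e2" "z \<in> ball 0 e1" "z \<in> ball 0 r" using z e subsetD[OF e3(2)] by auto
    have "\<gamma> (\<beta> (\<alpha> z)) = \<gamma> z" using \<alpha>(8)[OF 1(2)] \<beta>(8)[OF 1(1)] by simp
    moreover have "\<beta> (\<alpha> z) \<in> ball 0 r" using 1 \<beta>(7) by blast
    ultimately show ?thesis using 1 discD(3)[OF d(1)] by (auto dest: inj_onD)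
  qed
  \<comment> \<open>The map \<open>h\<close> in the coordinate \<open>z\<close>. It may have a pole
    at 0, so the density is handled on the punctured disc.\<close>
  define K where "K z = the (h (\<gamma> z))" for z
  have hK: "h (\<gamma> z) = Some (K z)" if "z \<in> ball 0 r - {0}" for z
    using fin[OF nS[OF that]] by (simp add: K_def)
  have shift: "disc P (\<gamma> z) (min (norm z) (r - norm z)) (\<lambda>w. \<gamma> (z + w))" 
      "\<And>w. w \<in> ball 0 (min (norm z) (r - norm z)) \<Longrightarrow> z + w \<in> ball 0 r - {0}" if z: "z \<in> ball 0 r - {0}" for z
  proof -
    show "disc P (\<gamma> z) (min (norm z) (r - norm z)) (\<lambda>w. \<gamma> (z + w))"
      by (rule disc_shift[OF P d(1)]) (use z in auto)
    fix w :: complex assume w: "w \<in> ball 0 (min (norm z) (r - norm z))"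
    then have "norm (z + w) < r" using norm_triangle_ineq[of z w] by simp
    moreover have "z + w \<noteq> 0" using w by (auto simp: add_eq_0_iff2)
    ultimately show "z + w \<in> ball 0 r - {0}" by simp
  qed
  have K': "(\<lambda>w. K (z + w)) holomorphic_on ball 0 (min (norm z) (r - norm z))" "deriv K z \<noteq> 0"
    if z: "z \<in> ball 0 r - {0}" for z
  proof -
    have ne: "h (\<gamma> (z + w)) \<noteq> None" if "w \<in> ball 0 (min (norm z) (r - norm z))" for w
      using hK[OF shift(2)[OF z that]] by simp
    show "(\<lambda>w. K (z + w)) holomorphic_on ball 0 (min (norm z) (r - norm z))"
      unfolding K_def by (rule holomorphic_on_the_disc[OF P hol_h shift(1)[OF z] ne])
    have "H.ord (\<gamma> z) = 1" using ord_eq nS[OF z] ord_1 by simp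
    from deriv_h_nonzero[OF shift(1)[OF z] ne this] show "deriv K z \<noteq> 0"
      using deriv_shift[of K z] by (simp add: K_def)
  qed
  have hol: "K holomorphic_on ball 0 r - {0}"
    unfolding holomorphic_on_def
  proof
    fix z :: complex assume z: "z \<in> ball 0 r - {0}"
    have "(\<lambda>w. K (z + w)) field_differentiable at 0"
      using K'(1)[OF z] z by (intro holomorphic_on_imp_differentiable_at[OF _ open_ball]) auto
    then have "K field_differentiable at z"
      unfolding field_differentiable_def using DERIV_shift[of K _ 0 z] by (auto simp: add.commute)
    then show "K field_differentiable at z within ball 0 r - {0}" by (rule field_differentiable_at_within)
  qed
  have E: "m' (K z) * norm (of_nat n * z ^ (n - 1)) = m (a + z ^ n) * norm (deriv K z)" if z: "z \<in> ball 0 r - {0}" for z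
  proof -
    have "deriv (\<lambda>w. the (f (\<gamma> (z + w)))) 0 = deriv (\<lambda>w. a + (z + w) ^ n) 0"
    proof (rule deriv_cong_ev[OF _ refl])
      have "\<forall>\<^sub>F w in nhds 0. w \<in> ball (0::complex) (min (norm z) (r - norm z))"
        using z by (intro eventually_nhds_in_open) auto
      then show "\<forall>\<^sub>F w in nhds 0. the (f (\<gamma> (z + w))) = a + (z + w) ^ n"
      proof eventually_elim
        case (elim w)
        have "z + w \<in> ball 0 r - {0}" by (rule shift(2)[OF z elim])
        then show ?case using fz[of "z + w"] by simp
      qed
    qed
    also have "\<dots> = of_nat n * z ^ (n - 1)"
      by (rule DERIV_imp_deriv) (auto intro!: derivative_eq_intros)
    finally have 1: "deriv (\<lambda>w. the (f (\<gamma> (z + w)))) 0 = of_nat n * z ^ (n - 1)" .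
    have 2: "deriv (\<lambda>w. the (h (\<gamma> (z + w)))) 0 = deriv K z" using deriv_shift[of K z] by (simp add: K_def)
    show ?thesis using dens[OF nS[OF z] shift(1)[OF z]] fz[of z] z unfolding 1 2 by (simp add: K_def)
  qed
  have sub: "ball 0 e - {0} \<subseteq> ball 0 r - {0 :: complex}" using e by auto
  \<comment> \<open>Invariance under all \<open>n\<close>-th roots of unity means that
    \<open>h\<close> depends on \<open>z ^ n\<close> only, that is, on the value of
    \<open>f\<close>.\<close>
  have rot: "h (\<gamma> (\<omega> * z)) = h (\<gamma> z)" if \<omega>: "\<omega> ^ n = 1" and z: "z \<in> ball 0 e" for \<omega> z
  proof -
    have norm\<omega>: "norm \<omega> = 1" using power_eq_1_iff[OF \<omega>] n by simp
    have wz: "\<omega> * w \<in> ball 0 e" if "w \<in> ball 0 e" for w using that norm\<omega> by (simp add: norm_mult)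
    have y: "\<alpha> (\<omega> * w) / \<omega> \<in> ball 0 e2" if "w \<in> ball 0 e" for w
      using ab[OF wz[OF that]] norm\<omega> by (simp add: norm_divide)
    have hT: "h (\<gamma> (\<beta> (\<alpha> (\<omega> * w) / \<omega>))) = h (\<gamma> (\<omega> * w))" if w: "w \<in> ball 0 e" for w
    proof -
      have 1: "\<alpha> (\<omega> * w) / \<omega> \<in> ball 0 r2" "\<alpha> (\<omega> * w) \<in> ball 0 r2" using y[OF w] ab[OF wz[OF w]] \<beta>(2) by auto
      have "h (\<gamma> (\<beta> (\<alpha> (\<omega> * w) / \<omega>))) = h (\<gamma>2 (\<alpha> (\<omega> * w) / \<omega>))" using \<beta>(8)[OF y[OF w]] by simp
      also have "\<dots> = h (\<gamma>2 (\<alpha> (\<omega> * w)))" using hy[OF 1(1)] hy[OF 1(2)] \<omega> by (simp add: power_divide)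
      also have "\<dots> = h (\<gamma> (\<omega> * w))" using \<alpha>(8)[of "\<omega> * w"] wz[OF w] e(2) by auto
      finally show ?thesis .
    qed
    have "\<beta> (\<alpha> (\<omega> * z) / \<omega>) = z"
    proof (rule density_rotation[of e \<alpha> \<beta> e2 n \<omega> K m' m a c z])
      show "\<alpha> holomorphic_on ball 0 e" using \<alpha>(3) e by (auto intro: holomorphic_on_subset)
      show "K holomorphic_on ball 0 e - {0}" using hol sub by (rule holomorphic_on_subset)
      show "c * norm w ^ n \<le> m (a + w ^ n)" if w: "w \<in> ball 0 e - {0}" for w
      proof -
        have "norm w ^ n \<le> norm w ^ 1" using w e n by (intro power_decreasing) auto
        then have "norm w ^ n < \<epsilon>" using w e by auto
        then show ?thesis using low[of "a + w ^ n"] w by (simp add: dist_norm norm_power)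
      qed
      show "K (\<beta> (\<alpha> (\<omega> * w) / \<omega>)) = K (\<omega> * w)" if "w \<in> ball 0 e - {0}" for w
        using hT[of w] that by (simp add: K_def)
    qed (use e \<alpha> \<beta> ab n \<omega> K'(2) E sub c z in auto)
    then show ?thesis using hT[OF z] by simp
  qed
  show ?thesis unfolding factors_at_def
  proof (intro exI[of _ "\<gamma> ` ball 0 e"] conjI ballI impI)
    show "openin (topo P) (\<gamma> ` ball 0 e)" by (rule disc_open_image[OF P d(1)]) (use e in auto)
    show "p \<in> \<gamma> ` ball 0 e" using discD(2)[OF d(1)] e by (auto intro: image_eqI[of _ _ 0])
    fix q q' assume "q \<in> \<gamma> ` ball 0 e" "q' \<in> \<gamma> ` ball 0 e" and eq: "f q = f q'"
    then obtain z z' where z: "z \<in> ball 0 e" "q = \<gamma> z" "z' \<in> ball 0 e" "q' = \<gamma> z'" by blast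
    then have pw: "z ^ n = z' ^ n" using eq fz[of z] fz[of z'] e by auto
    show "h q = h q'"
    proof (cases "z' = 0")
      case True
      then have "z = 0" using pw n by (simp add: zero_power)
      then show ?thesis using True z by simp
    next
      case False
      then have "(z / z') ^ n = 1" using pw by (simp add: power_divide)
      from rot[OF this z(3)] show ?thesis using z False by simp
    qed
  qed
qed

lemma factors_at_unramified:
  assumes "p \<in> points P" "p \<notin> S"
  shows "factors_at p"
proof -
  obtain A where "openin (topo P) A" "p \<in> A" "inj_on f A"
    by (rule inj_if_ord_1[OF assms(1) ord_1[OF assms]]) (rule that)
  then show ?thesis unfolding factors_at_def by (auto dest: inj_onD)
qed

end

section \<open>Lifting and the Kobayashi radius\<close>

text \<open>Convexity of the domains makes their intersections connected, so that two lifts with a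
  common value agree on the whole intersection.\<close>

definition lifts :: "'a topology \<Rightarrow> ('a \<Rightarrow> complex option) \<Rightarrow> (complex \<Rightarrow> complex) \<Rightarrow> (complex set \<times> (complex \<Rightarrow> 'a)) set" where
  "lifts X f \<phi> = {(V, u). open V \<and> convex V \<and> continuous_map (top_of_set V) X u \<and> (\<forall>t\<in>V. f (u t) = Some (\<phi> t))}"

context sphere_map
begin

lemma unramified_branch:
  assumes p: "p \<in> points P" "f p = Some b" "ord p = 1"
  obtains r \<gamma> where "disc P p r \<gamma>" "\<And>z. z \<in> ball 0 r \<Longrightarrow> f (\<gamma> z) = Some (b + z)"
proof -
  obtain r \<gamma> where "disc P p r \<gamma>" "\<And>z. z \<in> ball 0 r \<Longrightarrow> f (\<gamma> z) = sphere_shift (f p) (z ^ ord p)"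
    by (rule normal_form[OF p(1)]) (rule that)
  then show ?thesis using that[of r \<gamma>] p by simp
qed

lemma disc_lift:
  assumes d: "disc P p r \<gamma>" "\<And>z. z \<in> ball 0 r \<Longrightarrow> f (\<gamma> z) = Some (b + z)"
    and \<phi>: "continuous_on UNIV \<phi>" and e: "\<And>t. t \<in> ball t0 e \<Longrightarrow> \<phi> t \<in> ball b r"
  shows "(ball t0 e, \<lambda>t. \<gamma> (\<phi> t - b)) \<in> lifts (topo P) f \<phi>"
proof -
  have in': "\<phi> t - b \<in> ball 0 r" if "t \<in> ball t0 e" for t
    using e[OF that] by (simp add: dist_norm norm_minus_commute)
  have "continuous_map (top_of_set (ball t0 e)) (top_of_set (ball 0 r)) (\<lambda>t. \<phi> t - b)"
    using in' by (auto simp: continuous_map_in_subtopology intro!: continuous_intros continuous_on_subset[OF \<phi>])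
  from continuous_map_compose[OF this discD(5)[OF d(1)]]
  have "continuous_map (top_of_set (ball t0 e)) (topo P) (\<lambda>t. \<gamma> (\<phi> t - b))" by (simp add: o_def)
  moreover have "f (\<gamma> (\<phi> t - b)) = Some (\<phi> t)" if "t \<in> ball t0 e" for t using d(2)[OF in'[OF that]] by simp
  ultimately show ?thesis by (simp add: lifts_def)
qed

text \<open>Coincidence of two lifts is an open condition because \<open>f\<close> is locally
  injective over the values of \<phi>, and a closed one because \<open>P\<close> is Hausdorff. Local
  lifts exist by inverting \<open>f\<close> near each point of the finite fibre.\<close>

lemma local_sections_lifts:
  fixes \<phi> :: "complex \<Rightarrow> complex"
  assumes \<phi>: "continuous_on UNIV \<phi>" and unram: "\<And>p t. p \<in> points P \<Longrightarrow> f p = Some (\<phi> t) \<Longrightarrow> ord p = 1"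
  shows "local_sections (lifts (topo P) f \<phi>)"
proof
  fix V u V' u' t t'
  assume *: "(V, u) \<in> lifts (topo P) f \<phi>" "(V', u') \<in> lifts (topo P) f \<phi>" "t \<in> V \<inter> V'" "u t = u' t" "t' \<in> V \<inter> V'"
  then have V: "open V" "convex V" "continuous_map (top_of_set V) (topo P) u" "\<And>t. t \<in> V \<Longrightarrow> f (u t) = Some (\<phi> t)"
    and V': "open V'" "convex V'" "continuous_map (top_of_set V') (topo P) u'" "\<And>t. t \<in> V' \<Longrightarrow> f (u' t) = Some (\<phi> t)"
    by (auto simp: lifts_def)
  have conn: "connected (V \<inter> V')" using V(2) V'(2) by (intro convex_connected convex_Int)
  have uP: "u a \<in> points P" if "a \<in> V" for a using continuous_map_image_subset_topspace[OF V(3)] that by auto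
  have uP': "u' a \<in> points P" if "a \<in> V'" for a using continuous_map_image_subset_topspace[OF V'(3)] that by auto
  have "(u t = u' t) = (u t' = u' t')"
  proof (rule connected_local_const[OF conn *(3,5)], intro ballI)
    fix a assume a: "a \<in> V \<inter> V'"
    have "\<exists>N. open N \<and> a \<in> N \<and> (\<forall>b\<in>N \<inter> (V \<inter> V'). (u a = u' a) = (u b = u' b))"
    proof (cases "u a = u' a")
      case True
      have "ord (u a) = 1" using unram[of "u a" a] uP V(4) a by auto
      then obtain A where A: "openin (topo P) A" "u a \<in> A" "inj_on f A"
        using inj_if_ord_1[OF uP[of a]] a by blast
      have eq: "u b = u' b" if "b \<in> V \<inter> V'" "u b \<in> A" "u' b \<in> A" for b
        using inj_onD[OF A(3), of "u b" "u' b"] V(4) V'(4) that by auto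
      have "open {b \<in> V. u b \<in> A}" "open {b \<in> V'. u' b \<in> A}"
        using open_plane_preimage[OF V(3,1) A(1)] open_plane_preimage[OF V'(3,1) A(1)] by auto
      then have "open ({b \<in> V. u b \<in> A} \<inter> {b \<in> V'. u' b \<in> A})" by (rule open_Int)
      then show ?thesis using a A(2) True eq by (intro exI[of _ "{b \<in> V. u b \<in> A} \<inter> {b \<in> V'. u' b \<in> A}"]) auto
    next
      case False
      then obtain A A' where A: "openin (topo P) A" "openin (topo P) A'" "u a \<in> A" "u' a \<in> A'" "disjnt A A'"
        using haus uP uP' a unfolding Hausdorff_space_def by (metis IntD1 IntD2)
      have "open {b \<in> V. u b \<in> A}" "open {b \<in> V'. u' b \<in> A'}"
        using open_plane_preimage[OF V(3,1) A(1)] open_plane_preimage[OF V'(3,1) A(2)] by auto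
      then have "open ({b \<in> V. u b \<in> A} \<inter> {b \<in> V'. u' b \<in> A'})" by (rule open_Int)
      then show ?thesis using a A False by (intro exI[of _ "{b \<in> V. u b \<in> A} \<inter> {b \<in> V'. u' b \<in> A'}"]) (auto simp: disjnt_iff)
    qed
    then obtain N where N: "open N" "a \<in> N" "\<And>b. b \<in> N \<inter> (V \<inter> V') \<Longrightarrow> (u a = u' a) = (u b = u' b)" by blast
    then show "\<forall>\<^sub>F b in at a within V \<inter> V'. (u a = u' a) = (u b = u' b)"
      unfolding eventually_at_topological by blast
  qed
  then show "u t' = u' t'" using *(4) by simp
next
  fix t0 :: complex
  define b where "b = \<phi> t0"
  let ?fib = "{q \<in> points P. f q = Some b}"
  define good where "good q x \<longleftrightarrow> (case x of (r, \<gamma>) \<Rightarrow> disc P q r \<gamma> \<and> (\<forall>z\<in>ball 0 r. f (\<gamma> z) = Some (b + z)))" for q x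
  have "\<exists>x. good q x" if q: "q \<in> ?fib" for q
  proof -
    have q': "q \<in> points P" "f q = Some b" "ord q = 1" using q unram b_def by auto
    obtain r \<gamma> where "disc P q r \<gamma>" "\<And>z. z \<in> ball 0 r \<Longrightarrow> f (\<gamma> z) = Some (b + z)"
      by (rule unramified_branch[OF q']) (rule that)
    then show ?thesis by (intro exI[of _ "(r, \<gamma>)"]) (simp add: good_def)
  qed
  then obtain X where X: "\<forall>q\<in>?fib. good q (X q)" using bchoice[of ?fib good] by blast
  define R where "R q = fst (X q)" for q
  define \<gamma> where "\<gamma> q = snd (X q)" for q
  have *: "disc P q (R q) (\<gamma> q)" "\<And>z. z \<in> ball 0 (R q) \<Longrightarrow> f (\<gamma> q z) = Some (b + z)" if "q \<in> ?fib" for q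
    using X[rule_format, OF that] unfolding good_def R_def \<gamma>_def by (simp_all add: split_def)
  obtain e1 where e1: "e1 > 0"
    "\<And>p w. p \<in> points P \<Longrightarrow> w \<in> ball b e1 \<Longrightarrow> f p = Some w \<Longrightarrow> \<exists>q\<in>points P. f q = Some b \<and> p \<in> \<gamma> q ` ball 0 (R q)"
  proof (rule fibre_neighbourhood_ball[of b "\<lambda>q. \<gamma> q ` ball 0 (R q)"])
    fix q assume "q \<in> points P" "f q = Some b"
    then have "q \<in> ?fib" by simp
    note d = *(1)[OF this]
    show "openin (topo P) (\<gamma> q ` ball 0 (R q)) \<and> q \<in> \<gamma> q ` ball 0 (R q)"
      using disc_neighbourhood[OF P d] by blast
  qed (rule that)
  \<comment> \<open>At most every \<open>R q\<close>, so that each local inverse of \<open>f\<close>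
    is defined on the ball, and at most \<open>e1\<close>, so that each point over the ball lies in
    the image of one of them.\<close>
  define E where "E = Min (insert e1 (R ` ?fib))"
  have fin: "finite (insert e1 (R ` ?fib))" using finite_fibre by simp
  have E: "E > 0" "E \<le> e1" "\<And>q. q \<in> ?fib \<Longrightarrow> E \<le> R q"
    unfolding E_def using fin e1(1) discD(1)[OF *(1)] by (auto simp: Min_gr_iff intro: Min_le)
  have "open (\<phi> -` ball b E)" using \<phi> by (intro open_vimage) auto
  moreover have "t0 \<in> \<phi> -` ball b E" using E by (simp add: b_def)
  ultimately obtain d where d: "d > 0" "ball t0 d \<subseteq> \<phi> -` ball b E" using open_contains_ball by blast
  show "\<exists>W. open W \<and> t0 \<in> W \<and> (\<forall>t\<in>W. \<forall>V u. (V, u) \<in> lifts (topo P) f \<phi> \<longrightarrow> t \<in> V \<longrightarrow>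
     (\<exists>V' u'. (V', u') \<in> lifts (topo P) f \<phi> \<and> W \<subseteq> V' \<and> u' t = u t))"
  proof (rule exI[of _ "ball t0 d"], intro conjI ballI allI impI)
    fix t V u assume t: "t \<in> ball t0 d" and Vu: "(V, u) \<in> lifts (topo P) f \<phi>" "t \<in> V"
    then have u: "u t \<in> points P" "f (u t) = Some (\<phi> t)"
      using continuous_map_image_subset_topspace[of "top_of_set V" "topo P" u] by (auto simp: lifts_def)
    have \<phi>E: "\<phi> t' \<in> ball b E" if "t' \<in> ball t0 d" for t' using d(2) that by blast
    have "\<phi> t \<in> ball b e1" using \<phi>E[OF t] E by auto
    then obtain q where q: "q \<in> ?fib" "u t \<in> \<gamma> q ` ball 0 (R q)" using e1(2)[OF u(1) _ u(2)] by blast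
    then obtain z where z: "z \<in> ball 0 (R q)" "u t = \<gamma> q z" by blast
    then have "\<phi> t = b + z" using *(2)[OF q(1) z(1)] u(2) by simp
    then have "\<gamma> q (\<phi> t - b) = u t" using z by simp
    moreover have "(ball t0 d, \<lambda>t. \<gamma> q (\<phi> t - b)) \<in> lifts (topo P) f \<phi>"
      by (rule disc_lift[OF *[OF q(1)] \<phi>]) (use \<phi>E E(3)[OF q(1)] in \<open>auto intro: less_le_trans\<close>)
    ultimately show "\<exists>V' u'. (V', u') \<in> lifts (topo P) f \<phi> \<and> ball t0 d \<subseteq> V' \<and> u' t = u t" by blast
  qed (use d in auto)
qed

text \<open>The monodromy theorem over the plane. A section is locally a member of
  \<open>lifts\<close>, and these are continuous lifts.\<close>

lemma lift_exists:
  fixes \<phi> :: "complex \<Rightarrow> complex"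
  assumes \<phi>: "continuous_on UNIV \<phi>" and unram: "\<And>p t. p \<in> points P \<Longrightarrow> f p = Some (\<phi> t) \<Longrightarrow> ord p = 1"
    and p: "p \<in> points P" "f p = Some (\<phi> t0)"
  obtains s where "continuous_map euclidean (topo P) s" "\<And>t. f (s t) = Some (\<phi> t)" "s t0 = p"
proof -
  interpret L: local_sections "lifts (topo P) f \<phi>" by (rule local_sections_lifts[OF \<phi> unram])
  have op: "ord p = 1" by (rule unram[OF p])
  obtain r \<gamma> where d: "disc P p r \<gamma>" "\<And>z. z \<in> ball 0 r \<Longrightarrow> f (\<gamma> z) = Some (\<phi> t0 + z)"
    by (rule unramified_branch[OF p op]) (rule that)
  have "open (\<phi> -` ball (\<phi> t0) r)" using \<phi> by (intro open_vimage) auto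
  moreover have "t0 \<in> \<phi> -` ball (\<phi> t0) r" using discD(1)[OF d(1)] by simp
  ultimately obtain e where e: "e > 0" "ball t0 e \<subseteq> \<phi> -` ball (\<phi> t0) r" using open_contains_ball by blast
  have "(ball t0 e, \<lambda>t. \<gamma> (\<phi> t - \<phi> t0)) \<in> lifts (topo P) f \<phi>"
    by (rule disc_lift[OF d \<phi>]) (use e in auto)
  moreover have "t0 \<in> ball t0 e" using e by simp
  ultimately obtain s where s: "L.section_on UNIV s" "s t0 = \<gamma> (\<phi> t0 - \<phi> t0)"
    by (rule L.section_exists) (rule that)
  have loc: "\<exists>W u. open W \<and> t \<in> W \<and> continuous_map (top_of_set W) (topo P) u \<and> (\<forall>t'\<in>W. s t' = u t' \<and> f (u t') = Some (\<phi> t'))" for t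
  proof -
    obtain V u W where 1: "(V, u) \<in> lifts (topo P) f \<phi>" "open W" "t \<in> W" "W \<subseteq> V" "\<And>t'. t' \<in> UNIV \<Longrightarrow> t' \<in> W \<Longrightarrow> s t' = u t'"
      by (rule L.section_onE[OF s(1) UNIV_I[of t]]) (rule that)
    then have "continuous_map (top_of_set W) (topo P) u" "\<forall>t'\<in>W. f (u t') = Some (\<phi> t')"
      using continuous_map_from_subtopology_mono[of _ V _ u W] by (auto simp: lifts_def)
    then show ?thesis using 1 by blast
  qed
  have fs: "f (s t) = Some (\<phi> t)" for t using loc[of t] by metis
  have "continuous_map euclidean (topo P) s"
    unfolding continuous_map_def
  proof (intro conjI allI impI)
    show "s \<in> topspace euclidean \<rightarrow> points P"
    proof
      fix t :: complex
      obtain W u where W: "open W" "t \<in> W" "continuous_map (top_of_set W) (topo P) u" "\<And>t'. t' \<in> W \<Longrightarrow> s t' = u t'"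
        using loc[of t] by blast
      then show "s t \<in> points P" using continuous_map_image_subset_topspace[OF W(3)] by auto
    qed
    fix A assume A: "openin (topo P) A"
    have "open {t. s t \<in> A}"
    proof (subst open_subopen, intro ballI)
      fix t assume t: "t \<in> {t. s t \<in> A}"
      obtain W u where W: "open W" "t \<in> W" "continuous_map (top_of_set W) (topo P) u" "\<And>t'. t' \<in> W \<Longrightarrow> s t' = u t'"
        using loc[of t] by blast
      then show "\<exists>T. open T \<and> t \<in> T \<and> T \<subseteq> {t. s t \<in> A}"
        using open_plane_preimage[OF W(3,1) A] t by (intro exI[of _ "{t \<in> W. u t \<in> A}"]) auto
    qed
    then show "openin euclidean {x \<in> topspace euclidean. s x \<in> A}" by simp
  qed
  then show ?thesis using that[of s] fs s(2) discD(2)[OF d(1)] by simp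
qed

end

section \<open>The Kobayashi radius of a plane domain\<close>

definition square :: "complex set" where "square = cbox (Complex (-1) (-1)) (Complex 1 1)"

text \<open>The supremum of the derivatives at the centre is, up to a constant factor, the reciprocal of the
  Kobayashi metric; unlike the hyperbolic metric it requires no uniformization. A map of a closed
  square, unlike one of a disc, is extended to a continuous map of the plane by \<open>clamp\<close>, so that
  it can be lifted.\<close>

definition square_maps :: "complex set \<Rightarrow> complex \<Rightarrow> (complex \<Rightarrow> complex) set" where
  "square_maps B b = {\<phi>. continuous_on square \<phi> \<and> \<phi> holomorphic_on interior square \<and> \<phi> ` square \<subseteq> B \<and> \<phi> 0 = b}"

definition kobayashi_radius :: "complex set \<Rightarrow> complex \<Rightarrow> real" where
  "kobayashi_radius B b = (SUP \<phi>\<in>square_maps B b. norm (deriv \<phi> 0))"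

lemma mem_square: "z \<in> square \<longleftrightarrow> \<bar>Re z\<bar> \<le> 1 \<and> \<bar>Im z\<bar> \<le> 1"
  by (auto simp: square_def in_cbox_complex_iff)

lemma ball_subset_interior_square: "ball 0 1 \<subseteq> interior square"
proof (rule interior_maximal)
  show "ball 0 1 \<subseteq> square"
  proof
    fix z :: complex assume "z \<in> ball 0 1"
    then show "z \<in> square" using abs_Re_le_cmod[of z] abs_Im_le_cmod[of z] by (auto simp: mem_square)
  qed
qed auto

lemma norm_square: "z \<in> square \<Longrightarrow> norm z < 2"
proof -
  assume "z \<in> square"
  then have "(Re z)\<^sup>2 \<le> 1" "(Im z)\<^sup>2 \<le> 1" by (auto simp: mem_square abs_square_le_1)
  then have "(norm z)\<^sup>2 < 2\<^sup>2" by (simp add: cmod_power2)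
  then show "norm z < 2" by (rule power_less_imp_less_base) simp
qed

text \<open>The theorem of Landau and Picard bounds the derivative at 0 of a function that omits 0
  and 1, on a disc whose radius depends on the value at 0. An affine map takes \<open>c1\<close> and
  \<open>c2\<close> to 0 and 1.\<close>

lemma bdd_above_square_maps:
  assumes c: "c1 \<noteq> c2" "c1 \<notin> B" "c2 \<notin> B"
  shows "bdd_above ((\<lambda>\<phi>. norm (deriv \<phi> 0)) ` square_maps B b)"
proof -
  obtain R where R: "\<And>z. 0 < R z"
      "\<And>f. \<lbrakk>f holomorphic_on cball 0 (R(f 0)); \<And>z. norm z \<le> R(f 0) \<Longrightarrow> f z \<noteq> 0 \<and> f z \<noteq> 1\<rbrakk> \<Longrightarrow> norm(deriv f 0) < 1"
    using Landau_Picard by metis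
  define w where "w = (b - c1) / (c2 - c1)"
  \<comment> \<open>Division by \<rho> shrinks the closed ball of radius \<open>R w\<close> to
    radius 1/2, well inside the square.\<close>
  define \<rho> where "\<rho> = 2 * R w"
  have \<rho>: "\<rho> > 0" using R(1)[of w] by (simp add: \<rho>_def)
  have "norm (deriv \<phi> 0) \<le> \<rho> * norm (c2 - c1)" if \<phi>: "\<phi> \<in> square_maps B b" for \<phi>
  proof -
    have hol: "\<phi> holomorphic_on interior square" and img: "\<phi> ` square \<subseteq> B" and \<phi>0: "\<phi> 0 = b"
      using \<phi> by (auto simp: square_maps_def)
    define g where "g z = (\<phi> (z / of_real \<rho>) - c1) / (c2 - c1)" for z
    have g0: "g 0 = w" by (simp add: g_def w_def \<phi>0)
    have in': "z / of_real \<rho> \<in> ball 0 1" if "norm z \<le> R w" for z :: complex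
      using that R(1)[of w] by (simp add: norm_divide norm_mult \<rho>_def)
    then have in2: "z / of_real \<rho> \<in> interior square" if "norm z \<le> R w" for z :: complex
      using that ball_subset_interior_square by blast
    have "(\<phi> \<circ> (\<lambda>z. z / of_real \<rho>)) holomorphic_on cball 0 (R w)"
      by (rule holomorphic_on_compose_gen[OF _ hol]) (use in2 \<rho> in \<open>auto intro!: holomorphic_intros\<close>)
    then have "g holomorphic_on cball 0 (R w)" unfolding g_def
      using c(1) by (auto simp: o_def intro!: holomorphic_intros)
    moreover have "g z \<noteq> 0 \<and> g z \<noteq> 1" if "norm z \<le> R w" for z
    proof -
      have "\<phi> (z / of_real \<rho>) \<in> B" using img in2[OF that] interior_subset by blast
      then have "\<phi> (z / of_real \<rho>) \<noteq> c1" "\<phi> (z / of_real \<rho>) \<noteq> c2" using c by auto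
      then show ?thesis using c(1) by (auto simp: g_def)
    qed
    ultimately have "norm (deriv g 0) < 1" using R(2)[of g] g0 by simp
    moreover have "deriv g 0 = deriv \<phi> 0 / of_real \<rho> / (c2 - c1)"
    proof (rule DERIV_imp_deriv)
      have "0 \<in> interior square" using ball_subset_interior_square by auto
      then have "(\<phi> has_field_derivative deriv \<phi> 0) (at (0 / of_real \<rho>))"
        using hol by (auto intro: holomorphic_derivI)
      then have "((\<lambda>z. \<phi> (z / of_real \<rho>)) has_field_derivative deriv \<phi> 0 * (1 / of_real \<rho>)) (at 0)"
        by (rule DERIV_chain2) (use \<rho> in \<open>auto intro!: derivative_eq_intros\<close>)
      then show "(g has_field_derivative deriv \<phi> 0 / of_real \<rho> / (c2 - c1)) (at 0)"
        unfolding g_def using c(1) by (auto intro!: derivative_eq_intros)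
    qed
    ultimately have "norm (deriv \<phi> 0) / \<rho> / norm (c2 - c1) < 1" using \<rho> by (simp add: norm_divide norm_mult)
    moreover have "norm (c2 - c1) > 0" using c(1) by simp
    ultimately show ?thesis using \<rho> by (simp add: divide_less_eq mult.commute)
  qed
  then show ?thesis by (rule bdd_aboveI2)
qed

text \<open>The affine map with slope \<open>d / 2\<close> is a competitor: the square lies in the
  ball of radius 2, so its image stays in the ball of radius \<open>d\<close> about
  \<open>b\<close>.\<close>

lemma kobayashi_radius_ge:
  assumes c: "c1 \<noteq> c2" "c1 \<notin> B" "c2 \<notin> B" and d: "d > 0" "ball b d \<subseteq> B"
  shows "d / 2 \<le> kobayashi_radius B b"
proof -
  let ?\<phi> = "\<lambda>z. b + of_real (d / 2) * z"
  have "?\<phi> z \<in> B" if "z \<in> square" for z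
  proof -
    have "norm (of_real (d / 2) * z) = d / 2 * norm z" using d by (simp add: norm_mult)
    also have "\<dots> < d" using norm_square[OF that] d by simp
    finally have "b + of_real (d / 2) * z \<in> ball b d" by (simp add: dist_norm)
    then show ?thesis using d by blast
  qed
  then have "?\<phi> \<in> square_maps B b" by (auto simp: square_maps_def intro!: continuous_intros holomorphic_intros)
  moreover have "deriv ?\<phi> 0 = of_real (d / 2)"
    by (rule DERIV_imp_deriv) (auto intro!: derivative_eq_intros)
  then have "norm (deriv ?\<phi> 0) = d / 2" using d by (metis abs_of_pos half_gt_zero norm_of_real)
  ultimately show ?thesis unfolding kobayashi_radius_def
    using cSUP_upper[OF _ bdd_above_square_maps[OF c], of ?\<phi> b] by simp
qed

section \<open>Comparison of the two Kobayashi radii\<close>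

context same_ramification
begin

lemma same_ramification_swap: "same_ramification P h f"
proof
  show "holomorphic_map P riemann_sphere f" by (rule hol)
  show "sphere_map.ord P f p = H.ord p" if "p \<in> points P" for p using ord_eq[OF that] by simp
  show "critical_preimage P riemann_sphere f = critical_preimage P riemann_sphere h"
    using critical_preimage_eq by simp
qed

lemma not_critical_iff: "p \<in> points P \<Longrightarrow> p \<notin> S \<longleftrightarrow> f p \<notin> critical_values P riemann_sphere f"
  by (auto simp: critical_preimage_def)

lemma not_critical_iff_h: "p \<in> points P \<Longrightarrow> p \<notin> S \<longleftrightarrow> h p \<notin> critical_values P riemann_sphere h"
  unfolding critical_preimage_eq[symmetric] by (auto simp: critical_preimage_def)

lemma disc_avoiding_S:
  assumes d: "disc P q r \<gamma>" and q: "q \<notin> S"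
  obtains s where "0 < s" "s \<le> r" "disc P q s \<gamma>" "\<And>z. z \<in> ball 0 s \<Longrightarrow> \<gamma> z \<in> points P \<and> \<gamma> z \<notin> S"
proof -
  note qP = disc_neighbourhood(3)[OF P d]
  obtain s where "0 < s" "s \<le> r" "disc P q s \<gamma>" "\<gamma> ` ball 0 s \<subseteq> points P - (S - {q})"
    by (rule disc_shrink_into[OF P d openin_Compl_S[of q]]) (use qP q in simp, rule that)
  then show ?thesis using q by (intro that[of s]) blast+
qed

text \<open>The square is lifted through \<open>f\<close> to the complement of \<open>S\<close> and
  projected by \<open>h\<close>. Lifting and projecting multiply the derivative at 0 by those of
  \<open>h\<close> and of an inverse of \<open>f\<close>, which is the stated relation.\<close>

lemma square_map_transfer:
  assumes V: "None \<in> critical_values P riemann_sphere f" "None \<in> critical_values P riemann_sphere h"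
    and q: "q \<in> points P" "q \<notin> S" and d: "disc P q r \<gamma>"
    and \<phi>: "\<phi> \<in> square_maps {b. Some b \<notin> critical_values P riemann_sphere f} (the (f q))"
  obtains \<psi> where "\<psi> \<in> square_maps {b. Some b \<notin> critical_values P riemann_sphere h} (the (h q))"
    "deriv \<psi> 0 * deriv (\<lambda>z. the (f (\<gamma> z))) 0 = deriv (\<lambda>z. the (h (\<gamma> z))) 0 * deriv \<phi> 0"
proof -
  have c\<phi>: "continuous_on square \<phi>" and h\<phi>: "\<phi> holomorphic_on interior square"
    and img: "\<And>t. t \<in> square \<Longrightarrow> Some (\<phi> t) \<notin> critical_values P riemann_sphere f" and \<phi>0: "\<phi> 0 = the (f q)"
    using \<phi> by (auto simp: square_maps_def)
  have fin: "f p \<noteq> None \<and> h p \<noteq> None" if "p \<in> points P" "p \<notin> S" for p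
    using not_critical_iff[of p] not_critical_iff_h[of p] that V by metis
  \<comment> \<open>The retraction of the plane onto the square. The lifting theorem needs a map
    defined on the plane, and on the square the composition is still \<phi>.\<close>
  define cl where "cl = clamp (Complex (-1) (-1)) (Complex 1 1)"
  have cl: "cl t \<in> square" for t
    unfolding cl_def square_def by (rule clamp_in_interval) (auto simp: Basis_complex_def inner_complex_def)
  have cl_id: "cl t = t" if "t \<in> square" for t
    using that unfolding cl_def square_def by (rule clamp_cancel_cbox)
  have c\<phi>cl: "continuous_on UNIV (\<lambda>t. \<phi> (cl t))"
    unfolding cl_def
    by (rule clamp_continuous_on) (use c\<phi> in \<open>simp add: square_def\<close>)
  have 0: "0 \<in> square" "0 \<in> interior square" using ball_subset_interior_square by (auto simp: mem_square)
  have unram: "ord p = 1" if "p \<in> points P" "f p = Some (\<phi> (cl t))" for p t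
    using ord_1[OF that(1)] not_critical_iff[OF that(1)] img[OF cl[of t]] that(2) by simp
  have fq: "f q = Some (\<phi> (cl 0))" using fin[OF q] \<phi>0 cl_id[OF 0(1)] by auto
  obtain s where s: "continuous_map euclidean (topo P) s" "\<And>t. f (s t) = Some (\<phi> (cl t))" "s 0 = q"
    by (rule lift_exists[OF c\<phi>cl unram q(1) fq]) (assumption, assumption, rule that)
  have sP: "s t \<in> points P" "s t \<notin> S" for t
  proof -
    show "s t \<in> points P" using continuous_map_image_subset_topspace[OF s(1)] by auto
    then show "s t \<notin> S" using not_critical_iff[of "s t"] s(2)[of t] img[OF cl[of t]] by simp
  qed
  define \<psi> where "\<psi> t = the (h (s t))" for t
  have hs: "h (s t) = Some (\<psi> t)" for t using fin[OF sP[of t]] by (auto simp: \<psi>_def)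
  have c\<psi>: "continuous_on UNIV \<psi>"
  proof -
    have "continuous_map euclidean (topo riemann_sphere) (h \<circ> s)"
      using continuous_map_compose[OF s(1) cont_h] by (simp add: topo_sphere)
    then have "continuous_map euclidean (subtopology (topo riemann_sphere) (UNIV - {None})) (h \<circ> s)"
      using hs by (auto simp: continuous_map_in_subtopology)
    moreover have "continuous_map (subtopology (topo riemann_sphere) (UNIV - {None})) euclidean the"
      using homeomorphic_imp_continuous_map[OF homeomorphic_map_the] by (simp add: topo_sphere)
    ultimately have "continuous_map euclidean euclidean (the \<circ> (h \<circ> s))" by (rule continuous_map_compose)
    then show ?thesis by (simp add: o_def \<psi>_def[abs_def])
  qed
  \<comment> \<open>Over an interior point the lift is a disc \<eta>, a local inverse of
    \<open>f\<close>, composed with \<phi>. This makes \<psi> holomorphic there and gives its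
    derivative at 0.\<close>
  have loc: "\<exists>\<epsilon> e \<eta>. \<epsilon> > 0 \<and> e > 0 \<and> disc P (s t0) e \<eta> \<and> (\<forall>z\<in>ball 0 e. f (\<eta> z) = Some (\<phi> t0 + z) \<and> \<eta> z \<in> points P \<and> \<eta> z \<notin> S) \<and>
      (\<forall>t\<in>ball t0 \<epsilon>. t \<in> interior square \<and> \<phi> t - \<phi> t0 \<in> ball 0 e \<and> \<psi> t = the (h (\<eta> (\<phi> t - \<phi> t0))))"
    if t0: "t0 \<in> interior square" for t0
  proof -
    have sq: "t0 \<in> square" using t0 interior_subset by blast
    have ft0: "f (s t0) = Some (\<phi> t0)" using s(2)[of t0] cl_id[OF sq] by simp
    have o1: "ord (s t0) = 1" by (rule ord_1[OF sP])
    obtain e0 \<eta> where e0: "disc P (s t0) e0 \<eta>" "\<And>z. z \<in> ball 0 e0 \<Longrightarrow> f (\<eta> z) = Some (\<phi> t0 + z)"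
      by (rule unramified_branch[OF sP(1) ft0 o1]) (rule that)
    obtain e where e: "0 < e" "e \<le> e0" "disc P (s t0) e \<eta>" "\<And>z. z \<in> ball 0 e \<Longrightarrow> \<eta> z \<in> points P \<and> \<eta> z \<notin> S"
      by (rule disc_avoiding_S[OF e0(1) sP(2)]) (rule that)
    have "open {t \<in> UNIV. s t \<in> \<eta> ` ball 0 e}" using open_plane_preimage[of UNIV "topo P" s] s(1) disc_neighbourhood(1)[OF P e(3)] by auto
    then have "open ({t \<in> UNIV. s t \<in> \<eta> ` ball 0 e} \<inter> interior square)" by auto
    moreover have "s t0 \<in> \<eta> ` ball 0 e" by (rule disc_neighbourhood[OF P e(3)])
    ultimately obtain \<epsilon> where \<epsilon>: "\<epsilon> > 0" "ball t0 \<epsilon> \<subseteq> {t \<in> UNIV. s t \<in> \<eta> ` ball 0 e} \<inter> interior square"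
      using t0 open_contains_ball by (metis (no_types, lifting) IntI UNIV_I mem_Collect_eq)
    have "t \<in> interior square \<and> \<phi> t - \<phi> t0 \<in> ball 0 e \<and> \<psi> t = the (h (\<eta> (\<phi> t - \<phi> t0)))" if t: "t \<in> ball t0 \<epsilon>" for t
    proof -
      have t': "t \<in> interior square" "s t \<in> \<eta> ` ball 0 e" using \<epsilon>(2) t by auto
      then obtain z where z: "z \<in> ball 0 e" "s t = \<eta> z" by blast
      have "t \<in> square" using t'(1) interior_subset by blast
      then have "Some (\<phi> t) = Some (\<phi> t0 + z)" using s(2)[of t] cl_id[of t] e0(2)[of z] z e(2) by auto
      then have "\<phi> t - \<phi> t0 = z" by simp
      then show ?thesis using t' z by (simp add: \<psi>_def)
    qed
    then show ?thesis using \<epsilon>(1) e e0(2) by (intro exI[of _ \<epsilon>] exI[of _ e] exI[of _ \<eta>]) auto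
  qed
  note holH = holomorphic_on_the_disc[OF P]
  have h\<psi>: "\<psi> holomorphic_on interior square"
  proof (rule holomorphic_on_local)
    fix t0 assume "t0 \<in> interior square"
    note l0 = loc[OF this]
    obtain \<epsilon> e \<eta> where *: "\<epsilon> > 0" "disc P (s t0) e \<eta>" "\<And>z. z \<in> ball 0 e \<Longrightarrow> \<eta> z \<in> points P \<and> \<eta> z \<notin> S"
      "\<And>t. t \<in> ball t0 \<epsilon> \<Longrightarrow> t \<in> interior square \<and> \<phi> t - \<phi> t0 \<in> ball 0 e \<and> \<psi> t = the (h (\<eta> (\<phi> t - \<phi> t0)))"
      using l0 by (elim exE conjE) (rule that, assumption+, auto)
    have hh: "(\<lambda>z. the (h (\<eta> z))) holomorphic_on ball 0 e" by (rule holH[OF hol_h *(2)]) (use fin *(3) in blast)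
    have "\<phi> holomorphic_on ball t0 \<epsilon>" using h\<phi> by (rule holomorphic_on_subset) (use *(4) in blast)
    then have "(\<lambda>t. \<phi> t - \<phi> t0) holomorphic_on ball t0 \<epsilon>" by (intro holomorphic_intros)
    then have "((\<lambda>z. the (h (\<eta> z))) \<circ> (\<lambda>t. \<phi> t - \<phi> t0)) holomorphic_on ball t0 \<epsilon>"
      by (rule holomorphic_on_compose_gen[OF _ hh]) (use *(4) in blast)
    then have "\<psi> holomorphic_on ball t0 \<epsilon>" by (rule holomorphic_transform) (use *(4) in simp)
    then show "\<exists>T. open T \<and> t0 \<in> T \<and> \<psi> holomorphic_on T" using *(1) by (intro exI[of _ "ball t0 \<epsilon>"]) auto
  qed
  have \<psi>mem: "\<psi> \<in> square_maps {b. Some b \<notin> critical_values P riemann_sphere h} (the (h q))"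
    unfolding square_maps_def
  proof (intro CollectI conjI)
    show "continuous_on square \<psi>" using continuous_on_subset[OF c\<psi>] by blast
    show "\<psi> ` square \<subseteq> {b. Some b \<notin> critical_values P riemann_sphere h}"
      using not_critical_iff_h[OF sP(1)] sP(2) hs by auto
    show "\<psi> 0 = the (h q)" using s(3) by (simp add: \<psi>_def)
  qed (rule h\<psi>)
  obtain \<epsilon> e \<eta> where A: "\<epsilon> > 0" "e > 0" "disc P q e \<eta>"
      and B: "\<forall>z\<in>ball 0 e. f (\<eta> z) = Some (\<phi> 0 + z) \<and> \<eta> z \<in> points P \<and> \<eta> z \<notin> S"
      and C: "\<forall>t\<in>ball 0 \<epsilon>. t \<in> interior square \<and> \<phi> t - \<phi> 0 \<in> ball 0 e \<and> \<psi> t = the (h (\<eta> (\<phi> t - \<phi> 0)))"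
    using loc[OF 0(2), unfolded s(3)] by (elim exE conjE) (rule that)
  have *: "\<epsilon> > 0" "e > 0" "disc P q e \<eta>"
      "\<And>z. z \<in> ball 0 e \<Longrightarrow> f (\<eta> z) = Some (\<phi> 0 + z)" "\<And>z. z \<in> ball 0 e \<Longrightarrow> \<eta> z \<in> points P \<and> \<eta> z \<notin> S"
      "\<And>t. t \<in> ball 0 \<epsilon> \<Longrightarrow> \<phi> t - \<phi> 0 \<in> ball 0 e \<and> \<psi> t = the (h (\<eta> (\<phi> t - \<phi> 0)))"
    using A B C by blast+
  obtain r' where r': "0 < r'" "r' \<le> r" "disc P q r' \<gamma>" "\<And>z. z \<in> ball 0 r' \<Longrightarrow> \<gamma> z \<in> points P \<and> \<gamma> z \<notin> S"
    by (rule disc_avoiding_S[OF d q(2)]) (rule that)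
  obtain e' \<alpha> where \<alpha>: "0 < e'" "e' \<le> e" "\<alpha> holomorphic_on ball 0 e'" "inj_on \<alpha> (ball 0 e')"
    "\<alpha> 0 = 0" "deriv \<alpha> 0 \<noteq> 0" "\<alpha> ` ball 0 e' \<subseteq> ball 0 r'" "\<And>z. z \<in> ball 0 e' \<Longrightarrow> \<eta> z = \<gamma> (\<alpha> z)"
    by (rule disc_transition[OF P *(3) r'(3)]) (rule that)
  let ?F = "\<lambda>z. the (f (\<gamma> z))" and ?H = "\<lambda>z. the (h (\<gamma> z))" and ?K = "\<lambda>z. the (h (\<eta> z))"
  have dF: "(?F has_field_derivative deriv ?F 0) (at 0)"
    by (rule holomorphic_derivI[OF holH[OF hol r'(3)] open_ball]) (use fin r' in auto)
  have dH: "(?H has_field_derivative deriv ?H 0) (at 0)"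
    by (rule holomorphic_derivI[OF holH[OF hol_h r'(3)] open_ball]) (use fin r' in auto)
  have "h (\<eta> z) \<noteq> None" if "z \<in> ball 0 e" for z using fin *(5)[OF that] by blast
  from holH[OF hol_h *(3) this] have hH0: "?K holomorphic_on ball 0 e" .
  have "0 \<in> ball (0::complex) e" using *(2) by simp
  from holomorphic_derivI[OF hH0 open_ball this] have dH0: "(?K has_field_derivative deriv ?K 0) (at 0)" .
  have d\<alpha>: "(\<alpha> has_field_derivative deriv \<alpha> 0) (at 0)"
    by (rule holomorphic_derivI[OF \<alpha>(3) open_ball]) (use \<alpha> in auto)
  have d\<phi>: "(\<phi> has_field_derivative deriv \<phi> 0) (at 0)"
    by (rule holomorphic_derivI[OF h\<phi> open_interior 0(2)])
  \<comment> \<open>In the disc \<eta>, up to a constant, \<open>f\<close> is the parameter itself,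
    so the change \<alpha> to the given disc inverts the derivative of \<open>f\<close>.\<close>
  have e1: "deriv ?F 0 * deriv \<alpha> 0 = 1"
  proof (rule DERIV_unique)
    show "((\<lambda>z. ?F (\<alpha> z)) has_field_derivative deriv ?F 0 * deriv \<alpha> 0) (at 0)"
      by (rule DERIV_chain2[OF _ d\<alpha>]) (use dF \<alpha>(5) in simp)
    have "((\<lambda>z. \<phi> 0 + z) has_field_derivative 1) (at 0)" by (auto intro!: derivative_eq_intros)
    then show "((\<lambda>z. ?F (\<alpha> z)) has_field_derivative 1) (at 0)"
    proof (rule has_field_derivative_transform_within_open[OF _ open_ball[of 0 e']])
      show "0 \<in> ball 0 e'" using \<alpha>(1) by simp
      fix z :: complex assume z: "z \<in> ball 0 e'"
      then have "z \<in> ball 0 e" using \<alpha>(2) by auto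
      from *(4)[OF this] show "\<phi> 0 + z = ?F (\<alpha> z)" unfolding \<alpha>(8)[OF z, symmetric] by simp
    qed
  qed
  have e2: "deriv ?H 0 * deriv \<alpha> 0 = deriv ?K 0"
  proof (rule DERIV_unique)
    show "(?K has_field_derivative deriv ?K 0) (at 0)" by (rule dH0)
    have "((\<lambda>z. ?H (\<alpha> z)) has_field_derivative deriv ?H 0 * deriv \<alpha> 0) (at 0)"
      by (rule DERIV_chain2[OF _ d\<alpha>]) (use dH \<alpha>(5) in simp)
    then show "(?K has_field_derivative deriv ?H 0 * deriv \<alpha> 0) (at 0)"
      by (rule has_field_derivative_transform_within_open[OF _ open_ball[of 0 e']]) (use \<alpha>(1,8) in auto)
  qed
  have e3: "deriv \<psi> 0 = deriv ?K 0 * deriv \<phi> 0"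
  proof (rule DERIV_imp_deriv)
    have "((\<lambda>t. \<phi> t - \<phi> 0) has_field_derivative deriv \<phi> 0) (at 0)"
      using d\<phi> by (auto intro!: derivative_eq_intros)
    then have "((\<lambda>t. ?K (\<phi> t - \<phi> 0)) has_field_derivative deriv ?K 0 * deriv \<phi> 0) (at 0)"
      by (rule DERIV_chain2[rotated]) (use dH0 in simp)
    then show "(\<psi> has_field_derivative deriv ?K 0 * deriv \<phi> 0) (at 0)"
      by (rule has_field_derivative_transform_within_open[OF _ open_ball[of 0 \<epsilon>]]) (use *(1,6) in auto)
  qed
  have "deriv \<psi> 0 * deriv ?F 0 = deriv ?H 0 * (deriv ?F 0 * deriv \<alpha> 0) * deriv \<phi> 0"
    unfolding e3 e2[symmetric] by (simp add: ac_simps)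
  then show ?thesis using that[OF \<psi>mem] e1 by simp
qed

text \<open>Every competitor for \<open>f\<close> transfers to one for \<open>h\<close>, whose
  derivative is bounded by the supremum. Exchanging the maps will turn this into an
  equality.\<close>

lemma kobayashi_radius_le:
  assumes V: "None \<in> critical_values P riemann_sphere f" "None \<in> critical_values P riemann_sphere h"
    and q: "q \<in> points P" "q \<notin> S" and d: "disc P q r \<gamma>"
    and c: "c1 \<noteq> c2" "Some c1 \<in> critical_values P riemann_sphere h" "Some c2 \<in> critical_values P riemann_sphere h"
  shows "kobayashi_radius {b. Some b \<notin> critical_values P riemann_sphere f} (the (f q)) * norm (deriv (\<lambda>z. the (h (\<gamma> z))) 0)
    \<le> kobayashi_radius {b. Some b \<notin> critical_values P riemann_sphere h} (the (h q)) * norm (deriv (\<lambda>z. the (f (\<gamma> z))) 0)"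
proof -
  let ?B = "{b. Some b \<notin> critical_values P riemann_sphere f}" and ?B' = "{b. Some b \<notin> critical_values P riemann_sphere h}"
  let ?F = "norm (deriv (\<lambda>z. the (f (\<gamma> z))) 0)" and ?H = "norm (deriv (\<lambda>z. the (h (\<gamma> z))) 0)"
  have "f q \<noteq> None" using not_critical_iff[OF q(1)] q(2) V(1) by metis
  then obtain b where b: "f q = Some b" by blast
  have "b \<in> ?B" using not_critical_iff[OF q(1)] q(2) b by simp
  then have ne: "square_maps ?B (the (f q)) \<noteq> {}"
    using b by (auto simp: square_maps_def intro!: exI[of _ "\<lambda>_. b"] holomorphic_intros)
  have H: "?H > 0"
  proof -
    obtain s where s: "0 < s" "s \<le> r" "disc P q s \<gamma>" "\<And>z. z \<in> ball 0 s \<Longrightarrow> \<gamma> z \<in> points P \<and> \<gamma> z \<notin> S"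
      by (rule disc_avoiding_S[OF d q(2)]) (rule that)
    have "h (\<gamma> z) \<noteq> None" if "z \<in> ball 0 s" for z using s(4)[OF that] not_critical_iff_h[of "\<gamma> z"] V(2) by metis
    then show ?thesis using deriv_h_nonzero[OF s(3)] ord_eq[OF q(1)] ord_1[OF q] by simp
  qed
  have "norm (deriv \<phi> 0) \<le> kobayashi_radius ?B' (the (h q)) * ?F / ?H" if \<phi>: "\<phi> \<in> square_maps ?B (the (f q))" for \<phi>
  proof -
    obtain \<psi> where \<psi>: "\<psi> \<in> square_maps ?B' (the (h q))"
      "deriv \<psi> 0 * deriv (\<lambda>z. the (f (\<gamma> z))) 0 = deriv (\<lambda>z. the (h (\<gamma> z))) 0 * deriv \<phi> 0"
      by (rule square_map_transfer[OF V q d \<phi>]) (rule that)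
    have "norm (deriv \<psi> 0) \<le> kobayashi_radius ?B' (the (h q))" unfolding kobayashi_radius_def
      by (rule cSUP_upper[OF \<psi>(1) bdd_above_square_maps[OF c(1)]]) (use c in auto)
    moreover have "?H * norm (deriv \<phi> 0) = norm (deriv \<psi> 0) * ?F" using \<psi>(2) by (metis norm_mult)
    ultimately have "?H * norm (deriv \<phi> 0) \<le> kobayashi_radius ?B' (the (h q)) * ?F" by (simp add: mult_right_mono)
    then show ?thesis using H by (simp add: field_simps)
  qed
  then have "kobayashi_radius ?B (the (f q)) \<le> kobayashi_radius ?B' (the (h q)) * ?F / ?H"
    unfolding kobayashi_radius_def[of ?B] using ne by (intro cSUP_least)
  then show ?thesis using H by (simp add: field_simps)
qed

text \<open>The reciprocal density is the Kobayashi radius of the complement of the critical values.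
  Besides infinity each map has two critical values, so both radii are finite.\<close>

lemma factors_at_hyperbolic:
  assumes p: "p \<in> points P" "f p \<noteq> None"
    and V: "None \<in> critical_values P riemann_sphere f" "None \<in> critical_values P riemann_sphere h"
    and c: "c1 \<noteq> c2" "Some c1 \<in> critical_values P riemann_sphere f" "Some c2 \<in> critical_values P riemann_sphere f"
    and d: "d1 \<noteq> d2" "Some d1 \<in> critical_values P riemann_sphere h" "Some d2 \<in> critical_values P riemann_sphere h"
  shows "factors_at p"
proof -
  let ?B = "{b. Some b \<notin> critical_values P riemann_sphere f}" and ?B' = "{b. Some b \<notin> critical_values P riemann_sphere h}"
  interpret swap: same_ramification P h f by (rule same_ramification_swap)
  obtain a where a: "f p = Some a" using p by blast
  \<comment> \<open>The finite critical values other than \<open>a\<close>; \<epsilon> will keep a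
    distance from them.\<close>
  define A where "A = - ?B - {a}"
  have "finite A"
  proof (rule finite_subset)
    show "A \<subseteq> the ` critical_values P riemann_sphere f" by (force simp: A_def)
    show "finite (the ` critical_values P riemann_sphere f)"
      using finite_critical_points by (simp add: critical_values_def)
  qed
  then have "open (- A)" by (intro open_Compl finite_imp_closed)
  moreover have "a \<in> - A" by (simp add: A_def)
  ultimately obtain \<epsilon> where \<epsilon>: "\<epsilon> > 0" "ball a \<epsilon> \<subseteq> - A" using open_contains_ball by blast
  show ?thesis
  proof (rule factors_at_if_density[OF p(1) a, where m = "kobayashi_radius ?B" and m' = "kobayashi_radius ?B'" and c = "1/2" and \<epsilon> = "\<epsilon> / 2"])
    show "f q \<noteq> None \<and> h q \<noteq> None" if "q \<in> points P" "q \<notin> S" for q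
      using not_critical_iff[of q] not_critical_iff_h[of q] that V by metis
    show "kobayashi_radius ?B' (the (h q)) * norm (deriv (\<lambda>z. the (f (\<gamma> z))) 0) =
       kobayashi_radius ?B (the (f q)) * norm (deriv (\<lambda>z. the (h (\<gamma> z))) 0)"
      if q: "q \<in> points P" "q \<notin> S" and dd: "disc P q r \<gamma>" for q r \<gamma>
    proof (rule antisym)
      show "kobayashi_radius ?B (the (f q)) * norm (deriv (\<lambda>z. the (h (\<gamma> z))) 0) \<le>
        kobayashi_radius ?B' (the (h q)) * norm (deriv (\<lambda>z. the (f (\<gamma> z))) 0)"
        by (rule kobayashi_radius_le[OF V q dd d])
      show "kobayashi_radius ?B' (the (h q)) * norm (deriv (\<lambda>z. the (f (\<gamma> z))) 0) \<le>
        kobayashi_radius ?B (the (f q)) * norm (deriv (\<lambda>z. the (h (\<gamma> z))) 0)"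
        using swap.kobayashi_radius_le[OF V(2,1) q(1) _ dd c] q(2) critical_preimage_eq by simp
    qed
    show "1 / 2 * norm (b - a) \<le> kobayashi_radius ?B b" if b: "b \<in> ball a (\<epsilon> / 2) - {a}" for b
    proof -
      \<comment> \<open>The ball just fails to reach \<open>a\<close>, and it stays within
        \<epsilon> of \<open>a\<close> because \<open>b\<close> is closer than
        \<open>\<epsilon> / 2\<close>; so it misses all critical values. The general bound then
        gives the constant 1/2.\<close>
      have "ball b (norm (b - a)) \<subseteq> ?B"
      proof
        fix x assume x: "x \<in> ball b (norm (b - a))"
        have "dist a x \<le> dist a b + dist b x" by (rule dist_triangle)
        also have "\<dots> < \<epsilon>" using x b by (simp add: dist_norm norm_minus_commute)
        finally have "x \<notin> A" using \<epsilon>(2) by auto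
        moreover have "x \<noteq> a" using x by (auto simp: dist_norm)
        ultimately show "x \<in> ?B" by (simp add: A_def)
      qed
      then have "norm (b - a) / 2 \<le> kobayashi_radius ?B b"
        by (intro kobayashi_radius_ge[OF c(1)]) (use c b in auto)
      then show ?thesis by simp
    qed
  qed (use \<epsilon> in auto)
qed

end

section \<open>Two critical values\<close>

text \<open>The function \<rho> is the modulus of a holomorphic function only locally, so the local
  functions may differ by phases. The set where the maximum is attained is closed, and open by the
  maximum principle.\<close>

lemma max_modulus_compact_surface:
  fixes \<rho> :: "'a \<Rightarrow> real"
  assumes P: "complex_atlas P" and comp: "compact_space (topo P)" and conn: "connected_space (topo P)"
    and loc: "\<And>p. p \<in> points P \<Longrightarrow> \<exists>r \<gamma> g. disc P p r \<gamma> \<and> g holomorphic_on ball 0 r \<and> (\<forall>z\<in>ball 0 r. \<rho> (\<gamma> z) = norm (g z))"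
    and pq: "p \<in> points P" "q \<in> points P"
  shows "\<rho> p = \<rho> q"
proof -
  have op: "openin (topo P) {x \<in> points P. \<rho> x \<in> U}" if U: "open U" for U
  proof (subst openin_subopen, intro ballI)
    fix x assume x: "x \<in> {x \<in> points P. \<rho> x \<in> U}"
    then have xP: "x \<in> points P" by simp
    obtain r \<gamma> g where d: "disc P x r \<gamma>" "g holomorphic_on ball 0 r" "\<And>z. z \<in> ball 0 r \<Longrightarrow> \<rho> (\<gamma> z) = norm (g z)"
      using loc[OF xP] by blast
    have "open (ball 0 r \<inter> (\<lambda>z. norm (g z)) -` U)"
      by (intro continuous_open_preimage continuous_intros holomorphic_on_imp_continuous_on d(2) U) auto
    then have "openin (topo P) (\<gamma> ` (ball 0 r \<inter> (\<lambda>z. norm (g z)) -` U))" by (rule disc_open_image[OF P d(1)]) auto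
    moreover have "x \<in> \<gamma> ` (ball 0 r \<inter> (\<lambda>z. norm (g z)) -` U)"
      using discD(1,2)[OF d(1)] d(3)[of 0] x by (intro image_eqI[of _ _ 0]) auto
    moreover have "\<gamma> ` (ball 0 r \<inter> (\<lambda>z. norm (g z)) -` U) \<subseteq> {x \<in> points P. \<rho> x \<in> U}"
      using discD(7)[OF d(1)] d(3) by auto
    ultimately show "\<exists>T. openin (topo P) T \<and> x \<in> T \<and> T \<subseteq> {x \<in> points P. \<rho> x \<in> U}" by blast
  qed
  have cont: "continuous_map (topo P) euclideanreal \<rho>" unfolding continuous_map_def using op by auto
  have "compactin euclideanreal (\<rho> ` points P)"
    using image_compactin[OF comp[unfolded compact_space_def] cont] .
  then have "compact (\<rho> ` points P)" by simp
  moreover have "\<rho> ` points P \<noteq> {}" using pq by auto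
  ultimately obtain M where M: "M \<in> \<rho> ` points P" "\<forall>t\<in>\<rho> ` points P. t \<le> M"
    using compact_attains_sup[of "\<rho> ` points P"] by blast
  then obtain p0 where p0: "p0 \<in> points P" "\<And>x. x \<in> points P \<Longrightarrow> \<rho> x \<le> \<rho> p0" by blast
  define E where "E = {x \<in> points P. \<rho> x = \<rho> p0}"
  have oE: "openin (topo P) E"
  proof (subst openin_subopen, intro ballI)
    fix x assume x: "x \<in> E"
    then have xP: "x \<in> points P" by (simp add: E_def)
    obtain r \<gamma> g where d: "disc P x r \<gamma>" "g holomorphic_on ball 0 r" "\<And>z. z \<in> ball 0 r \<Longrightarrow> \<rho> (\<gamma> z) = norm (g z)"
      using loc[OF xP] by blast
    have r: "r > 0" "\<gamma> 0 = x" using discD(1,2)[OF d(1)] by auto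
    have "g constant_on ball 0 r"
    proof (rule maximum_modulus_principle[OF d(2) open_ball connected_ball open_ball order_refl])
      show "0 \<in> ball (0::complex) r" using r by simp
      show "norm (g z) \<le> norm (g 0)" if "z \<in> ball 0 r" for z
        using d(3)[OF that] d(3)[of 0] r p0(2)[OF discD(7)[OF d(1) that]] x by (simp add: E_def)
    qed
    then obtain c where "\<And>z. z \<in> ball 0 r \<Longrightarrow> g z = c" unfolding constant_on_def by blast
    then have "\<rho> (\<gamma> z) = \<rho> x" if "z \<in> ball 0 r" for z using d(3)[OF that] d(3)[of 0] r that by simp
    then have "\<gamma> ` ball 0 r \<subseteq> E" using discD(7)[OF d(1)] x by (auto simp: E_def)
    then show "\<exists>T. openin (topo P) T \<and> x \<in> T \<and> T \<subseteq> E" using disc_neighbourhood(1,2)[OF P d(1)] by blast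
  qed
  have "openin (topo P) {x \<in> points P. \<rho> x \<in> - {\<rho> p0}}" by (rule op) auto
  moreover have "{x \<in> points P. \<rho> x \<in> - {\<rho> p0}} = points P - E" by (auto simp: E_def)
  ultimately have "closedin (topo P) E" by (auto simp: closedin_def E_def)
  then have "E = {} \<or> E = points P" using conn oE unfolding connected_space_clopen_in by blast
  then have "E = points P" using p0 by (auto simp: E_def)
  then show ?thesis using pq unfolding E_def by (metis (mono_tags, lifting) mem_Collect_eq)
qed

lemma deriv_the_transition:
  assumes P: "complex_atlas P" and k: "holomorphic_map P riemann_sphere k" "k q \<noteq> None" and d: "disc P q r \<gamma>"
    and \<alpha>: "e > 0" "\<alpha> holomorphic_on ball 0 e" "\<alpha> 0 = 0" "\<And>z. z \<in> ball 0 e \<Longrightarrow> \<eta> z = \<gamma> (\<alpha> z)"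
  shows "deriv (\<lambda>z. the (k (\<eta> z))) 0 = deriv (\<lambda>z. the (k (\<gamma> z))) 0 * deriv \<alpha> 0"
proof (rule DERIV_imp_deriv)
  note qP = disc_neighbourhood(3)[OF P d]
  have "openin (topo P) {p \<in> points P. k p \<in> UNIV - {None}}"
    using holomorphic_mapD(1)[OF k(1)] openin_sphere_finite
    by (intro openin_preimage[of _ sphere_topology]) (auto simp: topo_sphere)
  then obtain s where s: "0 < s" "s \<le> r" "disc P q s \<gamma>" "\<gamma> ` ball 0 s \<subseteq> {p \<in> points P. k p \<in> UNIV - {None}}"
    by (rule disc_shrink_into[OF P d]) (use qP k(2) in simp, rule that)
  have hol: "(\<lambda>z. the (k (\<gamma> z))) holomorphic_on ball 0 s"
  proof (rule holomorphic_on_the_disc[OF P k(1) s(3)])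
    fix z :: complex assume "z \<in> ball 0 s"
    then have "\<gamma> z \<in> {p \<in> points P. k p \<in> UNIV - {None}}" using s(4) by blast
    then show "k (\<gamma> z) \<noteq> None" by simp
  qed
  have dk: "((\<lambda>z. the (k (\<gamma> z))) has_field_derivative deriv (\<lambda>z. the (k (\<gamma> z))) 0) (at (\<alpha> 0))"
    unfolding \<alpha>(3) by (rule holomorphic_derivI[OF hol open_ball]) (use s in simp)
  have "(\<alpha> has_field_derivative deriv \<alpha> 0) (at 0)"
    by (rule holomorphic_derivI[OF \<alpha>(2) open_ball]) (use \<alpha> in simp)
  from DERIV_chain2[OF dk this]
  show "((\<lambda>z. the (k (\<eta> z))) has_field_derivative deriv (\<lambda>z. the (k (\<gamma> z))) 0 * deriv \<alpha> 0) (at 0)"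
    by (rule has_field_derivative_transform_within_open[OF _ open_ball[of 0 e]]) (use \<alpha>(1,4) in auto)
qed

text \<open>The logarithmic derivatives of \<open>u ^ n\<close> and of its inverse differ only in
  sign, so the modulus treats zeros and poles alike.\<close>

lemma logarithmic_deriv_power:
  assumes u: "(u has_field_derivative u') (at z)" and u0: "u z \<noteq> 0" and c: "c = None \<or> c = Some 0" and n: "n > 0"
  shows "norm (deriv (\<lambda>w. the (sphere_shift c (u w ^ n))) z) / norm (the (sphere_shift c (u z ^ n))) = n * norm u' / norm (u z)"
proof -
  have un: "u z ^ n = u z * u z ^ (n - 1)" using n by (metis power_minus_mult mult.commute)
  have d1: "((\<lambda>w. u w ^ n) has_field_derivative of_nat n * (u' * u z ^ (n - 1))) (at z)"
    using DERIV_power[OF u, of n] by simp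
  show ?thesis
    using c
  proof
    assume c: "c = Some 0"
    then have "deriv (\<lambda>w. the (sphere_shift c (u w ^ n))) z = of_nat n * (u' * u z ^ (n - 1))"
      using d1 by (simp add: DERIV_imp_deriv)
    then show ?thesis using c u0 n un by (simp add: norm_mult norm_power)
  next
    assume c: "c = None"
    have "(u \<longlongrightarrow> u z) (nhds z)"
      using DERIV_isCont[OF u] by (simp add: isCont_def tendsto_at_iff_tendsto_nhds)
    then have "\<forall>\<^sub>F w in nhds z. u w \<noteq> 0" using u0 by (rule tendsto_imp_eventually_ne)
    then have "\<forall>\<^sub>F w in nhds z. the (sphere_shift c (u w ^ n)) = inverse (u w ^ n)"
      by eventually_elim (simp add: c)
    then have "deriv (\<lambda>w. the (sphere_shift c (u w ^ n))) z = deriv (\<lambda>w. inverse (u w ^ n)) z"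
      by (rule deriv_cong_ev) simp
    also have "\<dots> = - (inverse (u z ^ n) * (of_nat n * (u' * u z ^ (n - 1))) * inverse (u z ^ n))"
      by (rule DERIV_imp_deriv, rule DERIV_inverse'[OF d1]) (use u0 in simp)
    finally have *: "deriv (\<lambda>w. the (sphere_shift c (u w ^ n))) z = - (inverse (u z ^ n) * (of_nat n * (u' * u z ^ (n - 1))) * inverse (u z ^ n))" .
    define B where "B = norm (u z) ^ (n - 1)"
    have B: "norm (u z) ^ n = norm (u z) * B" using un unfolding B_def by (metis norm_mult norm_power)
    have B0: "B \<noteq> 0" using u0 by (simp add: B_def)
    have "norm (deriv (\<lambda>w. the (sphere_shift c (u w ^ n))) z) = n * norm u' * B / (norm (u z) * B) / (norm (u z) * B)"
      unfolding * norm_minus_cancel norm_mult norm_inverse norm_power B B_def by (simp add: divide_inverse)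
    moreover have "norm (the (sphere_shift c (u z ^ n))) = 1 / (norm (u z) * B)"
      using c u0 by (simp add: norm_inverse norm_power B divide_inverse)
    ultimately show ?thesis using u0 B0 by simp
  qed
qed

section \<open>The quotient of the logarithmic derivatives\<close>

context same_ramification
begin

text \<open>The modulus of \<open>dh / h\<close> divided by \<open>df / f\<close> at the centre of
  the disc. A change of disc multiplies both derivatives by the same factor, so it depends on the
  centre only.\<close>

definition log_deriv_ratio :: "(complex \<Rightarrow> 'a) \<Rightarrow> real" where
  "log_deriv_ratio \<gamma> =
    (norm (deriv (\<lambda>z. the (h (\<gamma> z))) 0) / norm (the (h (\<gamma> 0)))) / (norm (deriv (\<lambda>z. the (f (\<gamma> z))) 0) / norm (the (f (\<gamma> 0))))"

text \<open>The differentials \<open>dh / h\<close> and \<open>df / f\<close> have the same simple poles and no zeros, so the modulus of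
  their quotient is constant by the maximum principle. It is 1 because the residues agree up to sign.\<close>

lemma log_deriv_ratio_eq_1:
  assumes V: "critical_values P riemann_sphere f = {None, Some 0}" "critical_values P riemann_sphere h = {None, Some 0}"
    and q: "q \<in> points P" "q \<notin> S" and d: "disc P q r \<gamma>"
  shows "log_deriv_ratio \<gamma> = 1"
proof -
  interpret swap: same_ramification P h f by (rule same_ramification_swap)
  have fin: "f p \<noteq> None \<and> h p \<noteq> None \<and> the (f p) \<noteq> 0 \<and> the (h p) \<noteq> 0" if "p \<in> points P" "p \<notin> S" for p
    using not_critical_iff[of p] not_critical_iff_h[of p] that unfolding V by auto
  \<comment> \<open>At \<open>S\<close> the value 1 is the continuous extension: zeros and poles of
    \<open>f\<close> and \<open>h\<close> there have the same order, so the residues agree up to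
    sign.\<close>
  define R where "R p = (if p \<in> S then 1 else log_deriv_ratio (SOME \<gamma>. \<exists>r. disc P p r \<gamma>))" for p
  have R: "R p = log_deriv_ratio \<gamma>" if p: "p \<in> points P" "p \<notin> S" and d: "disc P p r \<gamma>" for p r \<gamma>
  proof -
    define \<eta> where "\<eta> = (SOME \<gamma>. \<exists>r. disc P p r \<gamma>)"
    have "\<exists>\<gamma> r. disc P p r \<gamma>" using d by blast
    from someI_ex[OF this] have "\<exists>r. disc P p r \<eta>" unfolding \<eta>_def .
    then obtain r' where d': "disc P p r' \<eta>" by blast
    obtain e \<alpha> where \<alpha>: "0 < e" "e \<le> r'" "\<alpha> holomorphic_on ball 0 e" "inj_on \<alpha> (ball 0 e)"
      "\<alpha> 0 = 0" "deriv \<alpha> 0 \<noteq> 0" "\<alpha> ` ball 0 e \<subseteq> ball 0 r" "\<And>z. z \<in> ball 0 e \<Longrightarrow> \<eta> z = \<gamma> (\<alpha> z)"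
      by (rule disc_transition[OF P d' d]) (rule that)
    have "deriv (\<lambda>z. the (f (\<eta> z))) 0 = deriv (\<lambda>z. the (f (\<gamma> z))) 0 * deriv \<alpha> 0"
      "deriv (\<lambda>z. the (h (\<eta> z))) 0 = deriv (\<lambda>z. the (h (\<gamma> z))) 0 * deriv \<alpha> 0"
      using deriv_the_transition[OF P hol _ d \<alpha>(1,3,5,8)] deriv_the_transition[OF P hol_h _ d \<alpha>(1,3,5,8)] fin[OF p] by blast+
    moreover have "\<eta> 0 = \<gamma> 0" using discD(2)[OF d] discD(2)[OF d'] by simp
    ultimately have "log_deriv_ratio \<eta> = log_deriv_ratio \<gamma>"
      unfolding log_deriv_ratio_def using \<alpha>(6) by (simp add: norm_mult)
    then show ?thesis using p by (simp add: R_def \<eta>_def)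
  qed
  note holH = holomorphic_on_the_disc[OF P]
  have R_shift: "R (\<eta> z) = (norm (deriv (\<lambda>z. the (h (\<eta> z))) z) / norm (the (h (\<eta> z)))) / (norm (deriv (\<lambda>z. the (f (\<eta> z))) z) / norm (the (f (\<eta> z))))"
    if "disc P p e \<eta>" "z \<in> ball 0 e" "\<eta> z \<notin> S" for p e \<eta> z
  proof -
    have d: "disc P (\<eta> z) (e - norm z) (\<lambda>w. \<eta> (z + w))"
      by (rule disc_shift[OF P that(1,2)]) (use that in auto)
    have zP: "\<eta> z \<in> points P" by (rule discD(7)[OF that(1,2)])
    show ?thesis unfolding R[OF zP that(3) d] log_deriv_ratio_def
      using deriv_shift[of "\<lambda>z. the (h (\<eta> z))" z] deriv_shift[of "\<lambda>z. the (f (\<eta> z))" z] by simp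
  qed
  have const: "R p = R p'" if "p \<in> points P" "p' \<in> points P" for p p'
  proof (rule max_modulus_compact_surface[OF P compact_topo connected _ that])
    fix p assume p: "p \<in> points P"
    show "\<exists>r \<gamma> g. disc P p r \<gamma> \<and> g holomorphic_on ball 0 r \<and> (\<forall>z\<in>ball 0 r. R (\<gamma> z) = norm (g z))"
    proof (cases "p \<in> S")
      case False
      obtain r0 \<eta> where d0: "disc P p r0 \<eta>" using disc_exists[OF P p] .
      obtain e where e: "0 < e" "e \<le> r0" "disc P p e \<eta>" "\<And>z. z \<in> ball 0 e \<Longrightarrow> \<eta> z \<in> points P \<and> \<eta> z \<notin> S"
        by (rule disc_avoiding_S[OF d0 False]) (rule that)
      define F where "F z = the (f (\<eta> z))" for z
      define H where "H z = the (h (\<eta> z))" for z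
      have nz: "F z \<noteq> 0" "H z \<noteq> 0" "f (\<eta> z) \<noteq> None" "h (\<eta> z) \<noteq> None" if "z \<in> ball 0 e" for z
        using fin[of "\<eta> z"] e(4)[OF that] by (auto simp: F_def H_def)
      have hF: "F holomorphic_on ball 0 e" unfolding F_def by (rule holH[OF hol e(3) nz(3)])
      have hH: "H holomorphic_on ball 0 e" unfolding H_def by (rule holH[OF hol_h e(3) nz(4)])
      have dF: "deriv F z \<noteq> 0" if z: "z \<in> ball 0 e" for z
      proof -
        have sh: "disc P (\<eta> z) (e - norm z) (\<lambda>w. \<eta> (z + w))" by (rule disc_shift[OF P e(3) z]) (use z in auto)
        have ne: "f (\<eta> (z + w)) \<noteq> None" if "w \<in> ball 0 (e - norm z)" for w
        proof (rule nz(3))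
          show "z + w \<in> ball 0 e" using that norm_triangle_ineq[of z w] by simp
        qed
        have "ord (\<eta> z) = 1" using ord_1 e(4)[OF z] by blast
        then show ?thesis using swap.deriv_h_nonzero[OF sh ne] deriv_shift[of F z] by (simp add: F_def)
      qed
      show ?thesis
      proof (intro exI conjI ballI)
        show "disc P p e \<eta>" by (rule e(3))
        show "(\<lambda>z. (deriv H z / H z) / (deriv F z / F z)) holomorphic_on ball 0 e"
          using nz dF by (intro holomorphic_intros hF hH) auto
        show "R (\<eta> z) = norm ((deriv H z / H z) / (deriv F z / F z))" if "z \<in> ball 0 e" for z
          using R_shift[OF e(3) that] e(4)[OF that] by (simp add: norm_divide norm_mult F_def[abs_def] H_def[abs_def])
      qed
    next
      case True
      define n where "n = ord p"
      have n: "n > 0" using ord_pos[OF p] by (simp add: n_def)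
      obtain r \<eta> where \<eta>: "disc P p r \<eta>" "\<And>z. z \<in> ball 0 r \<Longrightarrow> f (\<eta> z) = sphere_shift (f p) (z ^ ord p)"
        "\<eta> ` ball 0 r \<subseteq> points P - (S - {p})"
        by (rule normal_form_shrink[OF p openin_Compl_S[of p]]) (use p in simp, rule that)
      obtain r2 \<eta>2 where \<eta>2: "disc P p r2 \<eta>2" "\<And>z. z \<in> ball 0 r2 \<Longrightarrow> h (\<eta>2 z) = sphere_shift (h p) (z ^ H.ord p)"
        by (rule H.normal_form[OF p]) (rule that)
      obtain e \<alpha> where \<alpha>: "0 < e" "e \<le> r" "\<alpha> holomorphic_on ball 0 e" "inj_on \<alpha> (ball 0 e)"
        "\<alpha> 0 = 0" "deriv \<alpha> 0 \<noteq> 0" "\<alpha> ` ball 0 e \<subseteq> ball 0 r2" "\<And>z. z \<in> ball 0 e \<Longrightarrow> \<eta> z = \<eta>2 (\<alpha> z)"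
        by (rule disc_transition[OF P \<eta>(1) \<eta>2(1)]) (rule that)
      have cf: "f p = None \<or> f p = Some 0" using True V(1) by (auto simp: critical_preimage_def)
      have ch: "h p = None \<or> h p = Some 0" using True V(2) critical_preimage_eq by (auto simp: critical_preimage_def)
      have fz: "f (\<eta> z) = sphere_shift (f p) (z ^ n)" if "z \<in> ball 0 e" for z
        using \<eta>(2)[of z] that \<alpha>(2) by (simp add: n_def)
      have hz: "h (\<eta> z) = sphere_shift (h p) (\<alpha> z ^ n)" if "z \<in> ball 0 e" for z
      proof -
        have "\<alpha> z \<in> ball 0 r2" using \<alpha>(7) that by blast
        then show ?thesis using \<eta>2(2)[of "\<alpha> z"] \<alpha>(8)[OF that] ord_eq[OF p] by (simp add: n_def)
      qed
      \<comment> \<open>The function \<open>\<alpha> z / z\<close> with its singularity removed.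
        Near \<open>p\<close> the ratio is the modulus of
        \<open>deriv \<alpha> z * z / \<alpha> z\<close>, hence of
        \<open>deriv \<alpha> z / g z\<close>, which is 1 at 0.\<close>
      define g where "g z = (if z = 0 then deriv \<alpha> 0 else (\<alpha> z - \<alpha> 0) / (z - 0))" for z
      have hg: "g holomorphic_on ball 0 e" unfolding g_def
        by (rule pole_lemma[OF \<alpha>(3)]) (use \<alpha>(1) in simp)
      have \<alpha>0: "\<alpha> z \<noteq> 0" if "z \<in> ball 0 e" "z \<noteq> 0" for z
        using inj_onD[OF \<alpha>(4), of z 0] \<alpha>(1,5) that by auto
      have g0: "g z \<noteq> 0" if "z \<in> ball 0 e" for z using \<alpha>0[OF that] \<alpha>(5,6) by (simp add: g_def)
      have de: "disc P p e \<eta>" by (rule disc_shrink[OF P \<eta>(1) \<alpha>(1,2)])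
      have "R (\<eta> z) = norm (deriv \<alpha> z / g z)" if z: "z \<in> ball 0 e" for z
      proof (cases "z = 0")
        case z0: True
        then show ?thesis using True discD(2)[OF \<eta>(1)] \<alpha>(6) by (simp add: R_def g_def)
      next
        case False
        have "\<eta> z \<noteq> p" using inj_onD[OF discD(3)[OF de], of z 0] discD(2)[OF de] z False \<alpha>(1) by auto
        moreover have "z \<in> ball 0 r" using z \<alpha>(2) by auto
        then have "\<eta> z \<in> points P - (S - {p})" using \<eta>(3) by blast
        ultimately have nS: "\<eta> z \<notin> S" by blast
        have "\<forall>\<^sub>F w in nhds z. w \<in> ball 0 e" using z by (intro eventually_nhds_in_open) auto
        then have "\<forall>\<^sub>F w in nhds z. the (f (\<eta> w)) = the (sphere_shift (f p) (w ^ n))"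
            "\<forall>\<^sub>F w in nhds z. the (h (\<eta> w)) = the (sphere_shift (h p) (\<alpha> w ^ n))"
          by (eventually_elim, simp add: fz hz)+
        then have "deriv (\<lambda>w. the (f (\<eta> w))) z = deriv (\<lambda>w. the (sphere_shift (f p) (w ^ n))) z"
            "deriv (\<lambda>w. the (h (\<eta> w))) z = deriv (\<lambda>w. the (sphere_shift (h p) (\<alpha> w ^ n))) z"
          by (auto intro: deriv_cong_ev)
        moreover have "(\<alpha> has_field_derivative deriv \<alpha> z) (at z)"
          by (rule holomorphic_derivI[OF \<alpha>(3) open_ball z])
        ultimately have "R (\<eta> z) = (n * norm (deriv \<alpha> z) / norm (\<alpha> z)) / (n * norm (1::complex) / norm z)"
          unfolding R_shift[OF de z nS] fz[OF z] hz[OF z]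
          using logarithmic_deriv_power[where u = \<alpha> and z = z, OF _ \<alpha>0[OF z False] ch n]
            logarithmic_deriv_power[where u = "\<lambda>w. w" and z = z, OF DERIV_ident False cf n] by simp
        then show ?thesis using n False \<alpha>(5) by (simp add: g_def norm_divide norm_mult)
      qed
      moreover have "(\<lambda>z. deriv \<alpha> z / g z) holomorphic_on ball 0 e"
        using g0 by (intro holomorphic_intros \<alpha>(3) hg) auto
      ultimately show ?thesis using de by blast
    qed
  qed
  \<comment> \<open>A critical point over infinity lies in \<open>S\<close>, where the constant is
    known to be 1.\<close>
  have "None \<in> f ` critical_points P riemann_sphere f" using V(1) by (simp add: critical_values_def)
  then obtain p0 where p0: "p0 \<in> critical_points P riemann_sphere f" "f p0 = None" by auto
  then have "p0 \<in> points P" "p0 \<in> S" using V(1) by (auto simp: critical_points_def critical_preimage_def)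
  then have "R q = 1" using const[OF q(1), of p0] by (simp add: R_def)
  then show ?thesis using R[OF q d] by simp
qed

text \<open>The reciprocal density is \<open>norm\<close>, so the lower bound at the critical value
  0 holds with constant 1. The equality of the two pullbacks says that
  \<open>log_deriv_ratio\<close> is 1.\<close>

lemma factors_at_parabolic:
  assumes V: "critical_values P riemann_sphere f = {None, Some 0}" "critical_values P riemann_sphere h = {None, Some 0}"
    and p: "p \<in> points P" "p \<in> S" "f p \<noteq> None"
  shows "factors_at p"
proof -
  have p0: "f p = Some 0" using p V(1) by (auto simp: critical_preimage_def)
  show ?thesis
  proof (rule factors_at_if_density[OF p(1) p0, where m = norm and m' = norm and c = 1 and \<epsilon> = 1])
    show fin: "f q \<noteq> None \<and> h q \<noteq> None" if "q \<in> points P" "q \<notin> S" for q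
      using not_critical_iff[of q] not_critical_iff_h[of q] that V by auto
    show "norm (the (h q)) * norm (deriv (\<lambda>z. the (f (\<gamma> z))) 0) = norm (the (f q)) * norm (deriv (\<lambda>z. the (h (\<gamma> z))) 0)"
      if q: "q \<in> points P" "q \<notin> S" and d: "disc P q r \<gamma>" for q r \<gamma>
      using log_deriv_ratio_eq_1[OF V q d] discD(2)[OF d]
      unfolding log_deriv_ratio_def by (auto simp: divide_simps mult.commute split: if_splits)
  qed auto
qed

text \<open>Under the first alternative for the critical values every point with finite value is
  unramified. Under the second, infinity and 0 are critical, and a further critical value decides
  between the two metrics.\<close>

lemma fibres_constant:
  assumes Vh: "critical_values P riemann_sphere h = sphere_cnj ` critical_values P riemann_sphere f"
    and V: "critical_values P riemann_sphere f \<subseteq> {None} \<or> {None, Some 0} \<subseteq> critical_values P riemann_sphere f"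
    and pq: "p \<in> points P" "q \<in> points P" "f p = f q"
  shows "h p = h q"
proof (rule factor[OF _ pq])
  fix p assume p: "p \<in> points P" "f p \<noteq> None"
  show "factors_at p"
  proof (cases "p \<in> S")
    case False
    then show ?thesis using factors_at_unramified p by blast
  next
    case True
    then have "f p \<in> critical_values P riemann_sphere f" by (simp add: critical_preimage_def)
    then have V: "None \<in> critical_values P riemann_sphere f" "Some 0 \<in> critical_values P riemann_sphere f" using V p by auto
    have cnjV: "sphere_cnj w \<in> critical_values P riemann_sphere h" if "w \<in> critical_values P riemann_sphere f" for w
      using that Vh by auto
    show ?thesis
    proof (cases "critical_values P riemann_sphere f = {None, Some 0}")
      case V2: True
      then have "critical_values P riemann_sphere h = {None, Some 0}" unfolding Vh by auto
      then show ?thesis using factors_at_parabolic V2 p True by blast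
    next
      case False
      then obtain w where w: "w \<in> critical_values P riemann_sphere f" "w \<noteq> None" "w \<noteq> Some 0" using V by blast
      then obtain c where c: "w = Some c" "c \<noteq> 0" by auto
      \<comment> \<open>The finite critical values used are 0 and \<open>c\<close> for
        \<open>f\<close>, and their conjugates 0 and \<open>cnj c\<close> for
        \<open>h\<close>.\<close>
      show ?thesis
        by (rule factors_at_hyperbolic[OF p V(1), of 0 c 0 "cnj c"])
          (use cnjV[OF V(1)] cnjV[OF V(2)] cnjV[OF w(1)] V w c in auto)
    qed
  qed
qed

end

text \<open>Since \<open>f\<close> is surjective, \<psi> is determined everywhere. Near a value it
  is read off from the normal form of \<open>f\<close> at a preimage, as a function of the
  \<open>n\<close>-th power.\<close>

lemma (in sphere_map_pair) quotient_map:
  assumes fib: "\<And>p q. p \<in> points P \<Longrightarrow> q \<in> points P \<Longrightarrow> f p = f q \<Longrightarrow> h p = h q"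
  obtains \<psi> where "holomorphic_map riemann_sphere riemann_sphere \<psi>" "\<And>p. p \<in> points P \<Longrightarrow> h p = \<psi> (f p)"
proof -
  define \<psi> where "\<psi> c = h (SOME p. p \<in> points P \<and> f p = c)" for c
  have \<psi>: "h p = \<psi> (f p)" if "p \<in> points P" for p
  proof -
    have "(SOME q. q \<in> points P \<and> f q = f p) \<in> points P \<and> f (SOME q. q \<in> points P \<and> f q = f p) = f p"
      by (rule someI[of _ p]) (use that in simp)
    then show ?thesis unfolding \<psi>_def using that by (intro fib) auto
  qed
  have "holomorphic_map riemann_sphere riemann_sphere \<psi>"
  proof (rule holomorphic_map_from_sphere[OF complex_atlas_sphere])
    fix c
    obtain p where p: "p \<in> points P" "f p = c" using surj by (metis UNIV_I imageE)
    obtain r \<gamma> where d: "disc P p r \<gamma>" "\<And>z. z \<in> ball 0 r \<Longrightarrow> f (\<gamma> z) = sphere_shift (f p) (z ^ ord p)"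
      by (rule normal_form[OF p(1)]) (rule that)
    have "holomorphic_map (plane (ball 0 (r ^ ord p))) riemann_sphere (\<lambda>z. \<psi> (sphere_shift c z))"
    proof (rule holomorphic_map_power_quotient[OF complex_atlas_sphere holomorphic_map_disc_h[OF d(1)] discD(1)[OF d(1)] ord_pos[OF p(1)]])
      show "h (\<gamma> z) = \<psi> (sphere_shift c (z ^ ord p))" if "z \<in> ball 0 r" for z
        using \<psi>[OF discD(7)[OF d(1) that]] d(2)[OF that] p(2) by simp
    qed
    then show "\<exists>r>0. holomorphic_map (plane (ball 0 r)) riemann_sphere (\<lambda>z. \<psi> (sphere_shift c z))"
      using discD(1)[OF d(1)] by (intro exI[of _ "r ^ ord p"]) simp
  qed
  then show ?thesis using that \<psi> by blast
qed

section \<open>Antiholomorphic involutions of the sphere\<close>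

lemma holomorphic_map_conj_sandwich:
  assumes "holomorphic_map riemann_sphere riemann_sphere g"
  shows "holomorphic_map riemann_sphere riemann_sphere (\<lambda>w. sphere_cnj (g (sphere_cnj w)))"
proof -
  let ?S = riemann_sphere
  have c: "holomorphic_map ?S (conj_surface ?S) sphere_cnj"
    using antiholomorphic_map_sphere_cnj by (simp add: antiholomorphic_map_iff)
  have "holomorphic_map ?S ?S (sphere_cnj \<circ> (g \<circ> sphere_cnj))"
    by (intro holomorphic_map_compose[OF _ _ _ _ holomorphic_map_sphere_cnj] holomorphic_map_compose[OF _ _ _ c]
        holomorphic_map_conj assms complex_atlas_sphere complex_atlas_conj)
  then show ?thesis by (simp add: o_def)
qed

lemma sphere_aut_conj_sandwich:
  assumes "g \<in> sphere_aut"
  shows "(\<lambda>w. sphere_cnj (g (sphere_cnj w))) \<in> sphere_aut"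
proof -
  obtain h where h: "h \<in> sphere_aut" "\<And>w. h (g w) = w" "\<And>w. g (h w) = w" by (rule sphere_autE[OF assms]) (rule that)
  show ?thesis
    by (rule sphere_autI[of _ "\<lambda>w. sphere_cnj (h (sphere_cnj w))"])
      (use h assms in \<open>simp_all add: holomorphic_map_conj_sandwich sphere_aut_holomorphic\<close>)
qed

text \<open>In the coordinate \<open>1 / z\<close> the automorphism has a simple zero at infinity, so it grows linearly.\<close>

lemma sphere_aut_fixing_infinity:
  assumes g: "g \<in> sphere_aut" and gN: "g None = None"
  obtains a b where "a \<noteq> 0" "g = sphere_affine a b"
proof -
  note inj = sphere_aut_inj[OF g] and hol = sphere_aut_holomorphic[OF g]
  have fin: "g (Some z) \<noteq> None" for z using inj gN by (metis injD option.distinct(1))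
  define e where "e z = the (g (Some z))" for z
  have ge: "g (Some z) = Some (e z)" for z using fin[of z] by (simp add: e_def)
  have "holomorphic_map (plane UNIV) riemann_sphere (g \<circ> Some)"
    by (rule holomorphic_map_compose[OF complex_atlas_plane complex_atlas_sphere complex_atlas_sphere holomorphic_map_Some hol]) auto
  then have he: "e holomorphic_on UNIV"
    unfolding e_def using holomorphic_on_the[of UNIV "g \<circ> Some"] fin by (simp add: o_def)
  \<comment> \<open>The automorphism in the coordinate \<open>1 / z\<close> on both sides. It is
    injective and fixes 0, so its derivative there does not vanish.\<close>
  define k where "k t = sphere_recip (g (sphere_recip (Some t)))" for t
  have k0: "k 0 = Some 0" by (simp add: k_def gN)
  have "inj k" unfolding k_def by (rule injI) (metis inj injD inj_sphere_recip option.inject)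
  have "holomorphic_map (plane UNIV) riemann_sphere (sphere_recip \<circ> (g \<circ> (\<lambda>t. sphere_recip (Some t))))"
    by (intro holomorphic_map_compose[OF complex_atlas_plane complex_atlas_sphere complex_atlas_sphere]
      holomorphic_map_sphere_recip hol holomorphic_map_recip_Some) auto
  then have hk: "holomorphic_map (plane UNIV) riemann_sphere k" by (simp add: o_def k_def[abs_def])
  have "open {t \<in> UNIV. k t \<in> UNIV - {None}}"
    using hk openin_sphere_finite by (intro open_plane_preimage[of _ sphere_topology]) (auto simp: holomorphic_map_from_plane topo_sphere)
  moreover have "0 \<in> {t \<in> UNIV. k t \<in> UNIV - {None}}" using k0 by simp
  ultimately obtain r where r: "r > 0" "ball 0 r \<subseteq> {t \<in> UNIV. k t \<in> UNIV - {None}}" using open_contains_ball by blast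
  define u where "u t = the (k t)" for t
  have ku: "k t = Some (u t)" if "t \<in> ball 0 r" for t
  proof -
    have "k t \<noteq> None" using subsetD[OF r(2) that] by simp
    then show ?thesis by (simp add: u_def)
  qed
  have hu: "u holomorphic_on ball 0 r" unfolding u_def
    by (rule holomorphic_on_the[OF holomorphic_map_plane_subset[OF hk]]) (use ku in auto)
  have "inj_on u (ball 0 r)" by (rule inj_onI) (metis \<open>inj k\<close> injD ku)
  then have du: "deriv u 0 \<noteq> 0" using holomorphic_injective_imp_regular[OF hu open_ball] r by simp
  have "(u has_field_derivative deriv u 0) (at 0)" by (rule holomorphic_derivI[OF hu open_ball]) (use r in simp)
  moreover have u0: "u 0 = 0" by (simp add: u_def k0)
  ultimately have "((\<lambda>t. u t / t) \<longlongrightarrow> deriv u 0) (at 0)" by (simp add: DERIV_def)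
  then have "\<forall>\<^sub>F t in at 0. dist (u t / t) (deriv u 0) < norm (deriv u 0) / 2" using du by (intro tendstoD) auto
  then obtain d where d: "d > 0" "\<And>t. t \<noteq> 0 \<Longrightarrow> dist t 0 < d \<Longrightarrow> dist (u t / t) (deriv u 0) < norm (deriv u 0) / 2"
    unfolding eventually_at by auto
  define c where "c = norm (deriv u 0) / 2"
  have c: "c > 0" using du by (simp add: c_def)
  have low: "c * norm t \<le> norm (u t)" if t: "t \<noteq> 0" "norm t < d" for t
  proof -
    have "norm (deriv u 0) - norm (u t / t) \<le> norm (u t / t - deriv u 0)" using norm_triangle_ineq2[of "deriv u 0" "u t / t"] by (simp add: norm_minus_commute)
    then have "c \<le> norm (u t / t)" using d(2)[of t] t by (simp add: c_def dist_norm)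
    then show ?thesis using t by (simp add: norm_divide field_simps)
  qed
  \<comment> \<open>The lower bound \<open>c * norm t\<close> for \<open>u t\<close> at
    \<open>t = 1 / z\<close> becomes a linear upper bound for \<open>e z\<close>, to which
    Liouville's theorem for polynomials applies.\<close>
  have grow: "norm (e z) \<le> 1 / c * norm z ^ 1" if z: "1 + 1 / min r d \<le> norm z" for z
  proof -
    have m: "min r d > 0" using r d by simp
    then have z0: "z \<noteq> 0" "norm z > 1 / min r d" using z by (auto intro: add_pos_pos) (smt (verit) divide_pos_pos norm_zero)
    define t where "t = inverse z"
    have "inverse (norm z) < inverse (1 / min r d)" by (rule less_imp_inverse_less[OF z0(2)]) (use m in simp)
    then have t: "t \<noteq> 0" "norm t < min r d" using z0 by (auto simp: t_def norm_inverse)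
    have "k t = sphere_recip (Some (e z))" using z0 by (simp add: k_def t_def ge)
    moreover have kt: "k t = Some (u t)" using ku t by simp
    moreover have ut: "u t \<noteq> 0" using low[of t] t c by (auto simp: mult_le_0_iff)
    ultimately have "e z = inverse (u t)" by (auto simp: sphere_recip_def split: if_splits)
    then have "norm (e z) = 1 / norm (u t)" by (simp add: norm_inverse divide_inverse)
    also have "\<dots> \<le> 1 / (c * norm t)" using low[of t] t c ut by (intro divide_left_mono mult_pos_pos) auto
    also have "\<dots> = 1 / c * norm z ^ 1" by (simp add: t_def norm_inverse divide_inverse)
    finally show ?thesis .
  qed
  have eq: "e z = deriv e 0 * z + e 0" for z
    using Liouville_polynomial[OF he grow, where \<xi> = z] by (simp add: mult.commute)
  have "deriv e 0 \<noteq> 0"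
  proof
    assume "deriv e 0 = 0"
    then have "e 1 = e 0" using eq[of 1] by simp
    then have "g (Some 1) = g (Some 0)" by (simp add: ge)
    from injD[OF inj this] show False by simp
  qed
  moreover have "g = sphere_affine (deriv e 0) (e 0)"
  proof
    fix w
    show "g w = sphere_affine (deriv e 0) (e 0) w"
    proof (cases w)
      case (Some z)
      have "g w = Some (deriv e 0 * z + e 0)" unfolding Some ge eq[of z, symmetric] ..
      then show ?thesis using Some by simp
    qed (use gN in simp)
  qed
  ultimately show ?thesis by (rule that)
qed

text \<open>The involution \<open>w \<mapsto> sphere_cnj (\<psi> w)\<close>, transported by
  \<open>g\<close> and followed by another conjugation, is holomorphic and invertible; thus the
  classification of automorphisms applies to involutions.\<close>

lemma antiholomorphic_involution_conj:
  assumes hol: "holomorphic_map riemann_sphere riemann_sphere \<psi>"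
    and inv: "\<And>w. sphere_cnj (\<psi> (sphere_cnj (\<psi> w))) = w"
    and g: "g \<in> sphere_aut" and h: "\<And>w. h (g w) = w" "\<And>w. g (h w) = w"
  shows "(\<lambda>w. sphere_cnj (g (sphere_cnj (\<psi> (h w))))) \<in> sphere_aut"
proof -
  have "\<psi> \<in> sphere_aut"
  proof (rule sphere_autI[OF hol holomorphic_map_conj_sandwich[OF hol]])
    show "sphere_cnj (\<psi> (sphere_cnj (\<psi> w))) = w" for w by (rule inv)
    show "\<psi> (sphere_cnj (\<psi> (sphere_cnj w))) = w" for w
      using inv[of "sphere_cnj w"] by (metis sphere_cnj_sphere_cnj)
  qed
  moreover have "h \<in> sphere_aut" using sphere_autE[OF g] h by (metis ext)
  ultimately have "(\<lambda>w. sphere_cnj (g (sphere_cnj w))) \<circ> (\<psi> \<circ> h) \<in> sphere_aut"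
    by (intro sphere_aut_compose sphere_aut_conj_sandwich[OF g])
  then show ?thesis by (simp add: o_def)
qed

text \<open>With the fixed point at infinity the involution is
  \<open>\<alpha> * cnj z + \<beta>\<close>. Being an involution, it has
  \<open>\<alpha> * cnj \<alpha> = 1\<close> and
  \<open>\<alpha> * cnj \<beta> + \<beta> = 0\<close>, so it is a reflection in a line, which is
  moved to the real axis.\<close>

lemma involution_with_fixed_point:
  assumes hol: "holomorphic_map riemann_sphere riemann_sphere \<psi>"
    and inv: "\<And>w. sphere_cnj (\<psi> (sphere_cnj (\<psi> w))) = w" and fp: "sphere_cnj (\<psi> c) = c"
  obtains g where "g \<in> sphere_aut" "\<And>w. g (sphere_cnj (\<psi> w)) = sphere_cnj (g w)"
proof -
  obtain d :: "complex option" where "c \<noteq> d" by (cases c) blast+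
  then obtain g where g: "g \<in> sphere_aut" "g c = None" by (rule sphere_aut_two_points) (rule that)
  obtain h where h: "h \<in> sphere_aut" "\<And>w. h (g w) = w" "\<And>w. g (h w) = w" by (rule sphere_autE[OF g(1)]) (rule that)
  define B where "B w = sphere_cnj (g (sphere_cnj (\<psi> (h w))))" for w
  have "B \<in> sphere_aut" unfolding B_def[abs_def] by (rule antiholomorphic_involution_conj[OF hol inv g(1) h(2,3)])
  moreover have "B None = None" using g(2) h(2)[of c] fp by (simp add: B_def)
  ultimately obtain \<alpha>' \<beta>' where B': "B = sphere_affine \<alpha>' \<beta>'" by (rule sphere_aut_fixing_infinity) (rule that)
  define \<alpha> \<beta> where "\<alpha> = cnj \<alpha>'" and "\<beta> = cnj \<beta>'"
  have A1: "g (sphere_cnj (\<psi> (h (Some z)))) = Some (\<alpha> * cnj z + \<beta>)" for z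
  proof -
    have "sphere_cnj (B (Some z)) = Some (\<alpha> * cnj z + \<beta>)" by (simp add: B' \<alpha>_def \<beta>_def)
    then show ?thesis by (simp add: B_def)
  qed
  have invo: "\<alpha> * cnj (\<alpha> * cnj z + \<beta>) + \<beta> = z" for z
  proof -
    have "g (sphere_cnj (\<psi> (h (g (sphere_cnj (\<psi> (h (Some z)))))))) = Some z" by (simp add: h inv)
    then show ?thesis unfolding A1 by simp
  qed
  have \<beta>: "\<alpha> * cnj \<beta> + \<beta> = 0" using invo[of 0] by simp
  have "\<alpha> * cnj \<alpha> + (\<alpha> * cnj \<beta> + \<beta>) = 1" using invo[of 1] by (simp add: algebra_simps)
  then have \<alpha>: "\<alpha> * cnj \<alpha> = 1" unfolding \<beta> by simp
  define a where "a = csqrt \<alpha>"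
  have a2: "a * a = \<alpha>" by (simp add: a_def power2_eq_square[symmetric])
  have "norm a * norm a * (norm a * norm a) = 1"
    using arg_cong[OF \<alpha>, of norm] unfolding a2[symmetric] by (simp add: norm_mult)
  then have "norm a = 1"
    by (metis abs_norm_cancel abs_square_eq_1 power2_eq_square norm_ge_zero zero_le_mult_iff abs_of_nonneg)
  then have a1: "a * cnj a = 1" by (simp add: complex_norm_square[symmetric])
  then have a0: "a \<noteq> 0" by auto
  have ca: "cnj a = inverse a" using a1 a0 by (simp add: field_simps)
  \<comment> \<open>The point \<open>\<beta> / 2\<close> lies on the axis of the reflection, and the
    square root \<open>a\<close> of \<alpha> gives the direction of this axis; hence the map
    \<open>(z - \<beta> / 2) / a\<close>.\<close>
  define G where "G = sphere_affine (inverse a) (- \<beta> / (2 * a)) \<circ> g"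
  have "G \<in> sphere_aut" unfolding G_def using sphere_aut_compose[OF g(1) sphere_affine_aut] a0 by simp
  moreover have "G (sphere_cnj (\<psi> w)) = sphere_cnj (G w)" for w
  proof (cases "g w")
    case None
    then have "w = c" using g(2) sphere_aut_inj[OF g(1)] by (metis injD)
    then show ?thesis using fp g(2) by (simp add: G_def)
  next
    case (Some z)
    then have "w = h (Some z)" using h(2)[of w] by simp
    then have 1: "g (sphere_cnj (\<psi> w)) = Some (\<alpha> * cnj z + \<beta>)" using A1 by simp
    have cb: "cnj \<beta> = - \<beta> / \<alpha>"
    proof -
      have "\<alpha> \<noteq> 0" using \<alpha> by auto
      then show ?thesis using \<beta> by (simp add: field_simps add_eq_0_iff)
    qed
    have "inverse a * (\<alpha> * cnj z + \<beta>) - \<beta> / (2 * a) = a * cnj z + \<beta> / (2 * a)"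
      unfolding a2[symmetric] using a0 by (simp add: field_simps)
    moreover have "cnj (inverse a * z - \<beta> / (2 * a)) = a * cnj z + \<beta> / (2 * a)"
      using a0 unfolding complex_cnj_diff complex_cnj_mult complex_cnj_divide complex_cnj_inverse ca cb a2[symmetric]
      by (simp add: field_simps)
    ultimately show ?thesis using 1 Some by (simp add: G_def)
  qed
  ultimately show ?thesis using that by blast
qed

text \<open>With infinity and its image at infinity and 0, the involution becomes the reciprocal of
  \<open>cnj (\<alpha> * z)\<close>, and \<alpha> must be real. A positive \<alpha> would give fixed
  points; a negative one is scaled to -1.\<close>

lemma involution_without_fixed_point:
  assumes hol: "holomorphic_map riemann_sphere riemann_sphere \<psi>"
    and inv: "\<And>w. sphere_cnj (\<psi> (sphere_cnj (\<psi> w))) = w" and nfp: "\<And>w. sphere_cnj (\<psi> w) \<noteq> w"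
  obtains g where "g \<in> sphere_aut" "\<And>w. g (sphere_cnj (\<psi> w)) = sphere_cnj (sphere_neg_recip (g w))"
proof -
  define d where "d = sphere_cnj (\<psi> None)"
  have "None \<noteq> d" using nfp[of None] unfolding d_def by metis
  then obtain g where g: "g \<in> sphere_aut" "g None = None" "g d = Some 0" by (rule sphere_aut_two_points) (rule that)
  obtain h where h: "h \<in> sphere_aut" "\<And>w. h (g w) = w" "\<And>w. g (h w) = w" by (rule sphere_autE[OF g(1)]) (rule that)
  define A where "A w = g (sphere_cnj (\<psi> (h w)))" for w
  define B where "B w = sphere_recip (sphere_cnj (A w))" for w
  have "(\<lambda>w. sphere_cnj (A w)) \<in> sphere_aut" unfolding A_def by (rule antiholomorphic_involution_conj[OF hol inv g(1) h(2,3)])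
  then have "sphere_recip \<circ> (\<lambda>w. sphere_cnj (A w)) \<in> sphere_aut" by (rule sphere_aut_compose[OF _ sphere_recip_aut])
  then have Ba: "B \<in> sphere_aut" by (simp add: o_def B_def[abs_def])
  have hN: "h None = None" "h (Some 0) = d" using h(2)[of None] h(2)[of d] g by simp_all
  have AA: "A (A w) = w" for w by (simp add: A_def h inv)
  have AN: "A None = Some 0" using g(3) by (simp add: A_def hN d_def)
  have A0: "A (Some 0) = None" using AA[of None] AN by simp
  have "B None = None" by (simp add: B_def AN)
  with Ba obtain \<alpha> b where B: "\<alpha> \<noteq> 0" "B = sphere_affine \<alpha> b" by (rule sphere_aut_fixing_infinity) (rule that)
  have "B (Some 0) = Some 0" by (simp add: B_def A0)
  then have b: "b = 0" using B by simp
  have A: "A (Some z) = Some (inverse (cnj (\<alpha> * z)))" if "z \<noteq> 0" for z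
  proof -
    have "A (Some z) = sphere_cnj (sphere_recip (B (Some z)))" by (simp add: B_def)
    then show ?thesis using B b that by simp
  qed
  have "inverse (cnj (\<alpha> * inverse (cnj \<alpha>))) = 1"
    using AA[of "Some 1"] A[of 1] A[of "inverse (cnj \<alpha>)"] B(1) by simp
  then have "cnj \<alpha> = \<alpha>" using B(1) by (simp add: field_simps)
  then obtain x where x: "\<alpha> = of_real x" by (metis Reals_cases Reals_cnj_iff)
  have x0: "x \<noteq> 0" using B(1) x by simp
  have "x < 0"
  proof (rule ccontr)
    assume "\<not> x < 0"
    then have xp: "x > 0" using x0 by simp
    \<comment> \<open>The fixed points for positive \<open>x\<close> would form the circle of radius
      \<open>1 / sqrt x\<close>; this is its point on the positive axis.\<close>
    define z :: complex where "z = of_real (1 / sqrt x)"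
    have z0: "z \<noteq> 0" using xp by (simp add: z_def)
    have "inverse (x * (1 / sqrt x)) = 1 / sqrt x" using xp by (simp add: field_simps)
    then have "inverse (cnj (\<alpha> * z)) = z" by (simp add: x z_def flip: of_real_mult of_real_inverse of_real_divide)
    then have "A (Some z) = Some z" using A[OF z0] by simp
    then have "h (A (Some z)) = h (Some z)" by simp
    then have "sphere_cnj (\<psi> (h (Some z))) = h (Some z)" by (simp add: A_def h)
    then show False using nfp by blast
  qed
  define s where "s = sqrt (- x)"
  have s: "s > 0" "s * s = - x" using \<open>x < 0\<close> by (auto simp: s_def)
  define G where "G = sphere_affine (of_real s) 0 \<circ> g"
  have "G \<in> sphere_aut" unfolding G_def using sphere_aut_compose[OF g(1) sphere_affine_aut] s by simp
  moreover have "G (sphere_cnj (\<psi> w)) = sphere_cnj (sphere_neg_recip (G w))" for w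
  proof -
    have w: "w = h (g w)" by (simp add: h)
    have Gw: "G (sphere_cnj (\<psi> w)) = sphere_affine (of_real s) 0 (A (g w))" by (simp add: G_def A_def h)
    show ?thesis
    proof (cases "g w")
      case None
      then show ?thesis unfolding Gw by (simp add: G_def AN sphere_neg_recip_def)
    next
      case (Some z)
      show ?thesis
      proof (cases "z = 0")
        case True
        then show ?thesis unfolding Gw using Some by (simp add: G_def A0 sphere_neg_recip_def)
      next
        case False
        have \<alpha>: "\<alpha> = - (of_real s * of_real s)" using s(2) x by (metis of_real_minus of_real_mult minus_minus)
        have "of_real s * inverse (cnj (\<alpha> * z)) = cnj (- 1 / (of_real s * z))"
          unfolding \<alpha> using s False by (simp add: field_simps)
        then show ?thesis unfolding Gw using Some A[OF False] s False by (simp add: G_def sphere_neg_recip_def)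
      qed
    qed
  qed
  ultimately show ?thesis using that by blast
qed

section \<open>Invariance of the divisor\<close>

lemma ramification_cong:
  assumes P: "complex_atlas P" and Q: "complex_atlas Q" and p: "p \<in> points P" and eq: "\<And>q. q \<in> points P \<Longrightarrow> f q = g q"
  shows "ramification P Q f p = ramification P Q g p"
proof -
  have "power_form P Q f p = power_form P Q g p"
    unfolding power_form_def using eq discD(7)[of P p] p by (intro ext) metis
  then show ?thesis unfolding ramification_def has_ramification_iff_power_form[OF P Q] by simp
qed

lemma ramification_aut:
  assumes P: "complex_atlas P" and g: "g \<in> sphere_aut"
  shows "ramification P riemann_sphere (g \<circ> f) p = ramification P riemann_sphere f p"
proof -
  let ?S = riemann_sphere
  have 1: "\<exists>\<delta>'. power_form P ?S (g \<circ> f) p n r \<gamma> \<delta>'" if "g \<in> sphere_aut" "power_form P ?S f p n r \<gamma> \<delta>" for f g n r \<gamma> \<delta>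
  proof -
    have "disc ?S (g (f p)) (r ^ n) (g \<circ> \<delta>)"
      by (rule disc_image[OF complex_atlas_sphere complex_atlas_sphere _ sphere_aut_holomorphic[OF that(1)]])
        (use that sphere_aut_inj[OF that(1)] in \<open>auto simp: power_form_def\<close>)
    then have "power_form P ?S (g \<circ> f) p n r \<gamma> (g \<circ> \<delta>)" using that(2) by (simp add: power_form_def)
    then show ?thesis by blast
  qed
  obtain h where h: "h \<in> sphere_aut" "\<And>w. h (g w) = w" "\<And>w. g (h w) = w" by (rule sphere_autE[OF g]) (rule that)
  have "h \<circ> (g \<circ> f) = f" using h by auto
  then have "(\<exists>r \<gamma> \<delta>. power_form P ?S (g \<circ> f) p n r \<gamma> \<delta>) \<longleftrightarrow> (\<exists>r \<gamma> \<delta>. power_form P ?S f p n r \<gamma> \<delta>)" for n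
    using 1[OF g, of f n] 1[OF h(1), of "g \<circ> f" n] by metis
  then show ?thesis unfolding ramification_def has_ramification_iff_power_form[OF P complex_atlas_sphere] by simp
qed

lemma critical_values_aut:
  assumes P: "complex_atlas P" and g: "g \<in> sphere_aut"
  shows "critical_values P riemann_sphere (g \<circ> f) = g ` critical_values P riemann_sphere f"
    "critical_preimage P riemann_sphere (g \<circ> f) = critical_preimage P riemann_sphere f"
proof -
  show 1: "critical_values P riemann_sphere (g \<circ> f) = g ` critical_values P riemann_sphere f"
    by (simp add: critical_values_def critical_points_def ramification_aut[OF P g] image_comp)
  show "critical_preimage P riemann_sphere (g \<circ> f) = critical_preimage P riemann_sphere f"
    unfolding critical_preimage_def 1 using inj_image_mem_iff[OF sphere_aut_inj[OF g]] by simp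
qed

lemma constant_on_aut:
  assumes "g \<in> sphere_aut"
  shows "(g \<circ> f) constant_on A \<longleftrightarrow> f constant_on A"
proof -
  obtain h where h: "h \<in> sphere_aut" "\<And>w. h (g w) = w" "\<And>w. g (h w) = w" by (rule sphere_autE[OF assms]) (rule that)
  then show ?thesis unfolding constant_on_def by (metis comp_apply)
qed

lemma critical_divisor_aut:
  assumes "complex_atlas P" "g \<in> sphere_aut"
  shows "critical_divisor P riemann_sphere (g \<circ> f) = critical_divisor P riemann_sphere f"
  unfolding critical_divisor_def critical_values_aut(2)[OF assms] ramification_aut[OF assms] constant_on_aut[OF assms(2)] ..

lemma sphere_map_aut:
  assumes "sphere_map P f" and g: "g \<in> sphere_aut"
  shows "sphere_map P (g \<circ> f)"
proof -
  interpret sphere_map P f by fact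
  show ?thesis
  proof
    show "holomorphic_map P riemann_sphere (g \<circ> f)"
      by (rule holomorphic_map_compose[OF P complex_atlas_sphere complex_atlas_sphere hol sphere_aut_holomorphic[OF g]])
  qed (use compact nonconst constant_on_aut[OF g] in auto)
qed

text \<open>All coefficients on the preimage of the critical values are positive, so the divisor
  determines both this set and the ramification numbers on it. Coefficients are compared point by
  point.\<close>

lemma (in sphere_map) critical_divisor_invariant_iff:
  assumes \<tau>: "\<And>p. p \<in> points P \<Longrightarrow> \<tau> p \<in> points P" "\<And>p. p \<in> points P \<Longrightarrow> \<tau> (\<tau> p) = p"
  shows "divisor_map \<tau> (critical_divisor P riemann_sphere f) = critical_divisor P riemann_sphere f \<longleftrightarrow>
    (\<forall>p\<in>points P. (\<tau> p \<in> critical_preimage P riemann_sphere f \<longleftrightarrow> p \<in> critical_preimage P riemann_sphere f) \<and>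
      (p \<in> critical_preimage P riemann_sphere f \<longrightarrow> ord (\<tau> p) = ord p))"
proof -
  define S where "S = critical_preimage P riemann_sphere f"
  define D where "D = critical_divisor P riemann_sphere f"
  have SP: "S \<subseteq> points P" by (auto simp: S_def critical_preimage_def)
  have fin: "finite S" unfolding S_def by (rule finite_critical_preimage)
  have D: "D = (\<Sum>p\<in>S. frag_cmul (int (ord p)) (frag_of p))"
    using nonconst by (simp add: D_def critical_divisor_def S_def ord_def)
  have lD: "poly_mapping.lookup D q = (if q \<in> S then int (ord q) else 0)" for q
    unfolding D lookup_sum using fin by (simp add: if_distrib cong: if_cong)
  have \<tau>D: "divisor_map \<tau> D = (\<Sum>p\<in>S. frag_cmul (int (ord p)) (frag_of (\<tau> p)))"
    unfolding divisor_map_def D frag_extend_sum[OF fin] by (simp add: frag_extend_cmul o_def)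
  have l\<tau>D: "poly_mapping.lookup (divisor_map \<tau> D) q = (if \<tau> q \<in> S then int (ord (\<tau> q)) else 0)" if q: "q \<in> points P" for q
  proof -
    have "q = \<tau> p \<longleftrightarrow> p = \<tau> q" if "p \<in> S" for p using \<tau>(2) q that SP by (metis subsetD)
    then have "poly_mapping.lookup (divisor_map \<tau> D) q = (\<Sum>p\<in>S. if p = \<tau> q then int (ord p) else 0)"
      unfolding \<tau>D lookup_sum by (intro sum.cong) auto
    then show ?thesis using fin by simp
  qed
  have l0: "poly_mapping.lookup (divisor_map \<tau> D) q = 0" if q: "q \<notin> points P" for q
  proof -
    have "q \<noteq> \<tau> p" if "p \<in> S" for p using \<tau>(1) that SP q by blast
    then show ?thesis unfolding \<tau>D lookup_sum by (intro sum.neutral) auto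
  qed
  have "divisor_map \<tau> D = D \<longleftrightarrow> (\<forall>q. poly_mapping.lookup (divisor_map \<tau> D) q = poly_mapping.lookup D q)"
    by (metis poly_mapping_eqI)
  also have "\<dots> \<longleftrightarrow> (\<forall>q\<in>points P. poly_mapping.lookup (divisor_map \<tau> D) q = poly_mapping.lookup D q)"
    using l0 lD SP by (metis subsetD)
  also have "\<dots> \<longleftrightarrow> (\<forall>p\<in>points P. (\<tau> p \<in> S \<longleftrightarrow> p \<in> S) \<and> (p \<in> S \<longrightarrow> ord (\<tau> p) = ord p))"
  proof (rule ball_cong[OF refl])
    fix p assume p: "p \<in> points P"
    show "poly_mapping.lookup (divisor_map \<tau> D) p = poly_mapping.lookup D p \<longleftrightarrow> (\<tau> p \<in> S \<longleftrightarrow> p \<in> S) \<and> (p \<in> S \<longrightarrow> ord (\<tau> p) = ord p)"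
      using ord_pos[OF p] ord_pos[OF \<tau>(1)[OF p]] by (auto simp: lD l\<tau>D[OF p])
  qed
  finally show ?thesis by (simp add: D_def S_def)
qed

section \<open>Conjugation of functions on a real curve\<close>

locale real_curve =
  fixes P :: "'a surface" and \<tau> :: "'a \<Rightarrow> 'a"
  assumes compact: "compact_riemann_surface P" and inv: "antiholomorphic_involution P \<tau>"
begin

lemma P: "complex_atlas P"
  using compact by (simp add: compact_riemann_surface_def riemann_surface_complex_atlas)

lemma \<tau>_hol: "antiholomorphic_map P P \<tau>" and \<tau>\<tau>: "p \<in> points P \<Longrightarrow> \<tau> (\<tau> p) = p"
  using inv by (auto simp: antiholomorphic_involution_def)

lemma \<tau>_in: "p \<in> points P \<Longrightarrow> \<tau> p \<in> points P"
  using holomorphic_map_in[OF \<tau>_hol[unfolded antiholomorphic_map_iff], of p] by simp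

lemma \<tau>_inj: "inj_on \<tau> (points P)"
  by (metis \<tau>\<tau> inj_onI)

definition conj_fun :: "('a \<Rightarrow> complex option) \<Rightarrow> 'a \<Rightarrow> complex option" where
  "conj_fun f p = sphere_cnj (f (\<tau> p))"

lemma holomorphic_map_conj_fun:
  assumes f: "holomorphic_map P riemann_sphere f"
  shows "holomorphic_map P riemann_sphere (conj_fun f)"
proof -
  have "holomorphic_map P riemann_sphere (sphere_cnj \<circ> (f \<circ> \<tau>))"
    by (intro holomorphic_map_compose[OF _ _ _ _ holomorphic_map_sphere_cnj] holomorphic_map_compose[OF _ _ _ \<tau>_hol[unfolded antiholomorphic_map_iff]]
        holomorphic_map_conj f P complex_atlas_sphere complex_atlas_conj)
  then show ?thesis by (simp add: o_def conj_fun_def[abs_def])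
qed

text \<open>Conjugating the parameters of both discs keeps the form \<open>z ^ n\<close> and makes
  the conjugated maps holomorphic again. The relation between \<open>f\<close> and \<open>f'\<close>
  is a hypothesis, so that the lemma serves in both directions, from \<open>f\<close> to
  \<open>conj_fun f\<close> and back.\<close>

lemma power_form_conj_fun:
  assumes p: "p \<in> points P" and f: "\<And>q. q \<in> points P \<Longrightarrow> f' (\<tau> q) = sphere_cnj (f q)"
    and pf: "power_form P riemann_sphere f p n r \<gamma> \<delta>"
  shows "power_form P riemann_sphere f' (\<tau> p) n r (\<lambda>z. \<tau> (\<gamma> (cnj z))) (\<lambda>z. sphere_cnj (\<delta> (cnj z)))"
proof -
  have d: "disc P p r \<gamma>" and D: "disc riemann_sphere (f p) (r ^ n) \<delta>" and eq: "\<And>z. z \<in> ball 0 r \<Longrightarrow> f (\<gamma> z) = \<delta> (z ^ n)"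
    and n: "n > 0" using pf by (auto simp: power_form_def)
  have "disc P (\<tau> p) r (\<lambda>z. \<tau> (\<gamma> (cnj z)))"
    by (rule disc_antiholomorphic_image[OF P P d \<tau>_hol \<tau>_inj])
  moreover have "disc riemann_sphere (f' (\<tau> p)) (r ^ n) (\<lambda>z. sphere_cnj (\<delta> (cnj z)))"
    unfolding f[OF p]
    by (rule disc_antiholomorphic_image[OF complex_atlas_sphere complex_atlas_sphere D antiholomorphic_map_sphere_cnj])
      (use inj_sphere_cnj in simp)
  moreover have "f' (\<tau> (\<gamma> (cnj z))) = sphere_cnj (\<delta> (cnj (z ^ n)))" if "z \<in> ball 0 r" for z
  proof -
    have z: "cnj z \<in> ball 0 r" using that by simp
    show ?thesis using f[OF discD(7)[OF d z]] eq[OF z] by simp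
  qed
  ultimately show ?thesis using n by (simp add: power_form_def)
qed

lemma ramification_conj_fun:
  assumes p: "p \<in> points P"
  shows "ramification P riemann_sphere (conj_fun f) p = ramification P riemann_sphere f (\<tau> p)"
proof -
  have 1: "\<exists>r \<gamma> \<delta>. power_form P riemann_sphere (conj_fun f) p n r \<gamma> \<delta>" if "power_form P riemann_sphere f (\<tau> p) n r \<gamma> \<delta>" for n r \<gamma> \<delta>
    using power_form_conj_fun[OF \<tau>_in[OF p] _ that, of "conj_fun f"] \<tau>\<tau>[OF p] by (auto simp: conj_fun_def \<tau>\<tau>)
  have 2: "\<exists>r \<gamma> \<delta>. power_form P riemann_sphere f (\<tau> p) n r \<gamma> \<delta>" if "power_form P riemann_sphere (conj_fun f) p n r \<gamma> \<delta>" for n r \<gamma> \<delta>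
    using power_form_conj_fun[OF p _ that, of f] by (auto simp: conj_fun_def)
  have "(\<exists>r \<gamma> \<delta>. power_form P riemann_sphere (conj_fun f) p n r \<gamma> \<delta>) \<longleftrightarrow> (\<exists>r \<gamma> \<delta>. power_form P riemann_sphere f (\<tau> p) n r \<gamma> \<delta>)" for n
    using 1 2 by blast
  then show ?thesis unfolding ramification_def has_ramification_iff_power_form[OF P complex_atlas_sphere] by simp
qed

lemma critical_points_conj_fun:
  "critical_points P riemann_sphere (conj_fun f) = {p \<in> points P. \<tau> p \<in> critical_points P riemann_sphere f}"
  using ramification_conj_fun \<tau>_in by (auto simp: critical_points_def)

lemma critical_values_conj_fun:
  "critical_values P riemann_sphere (conj_fun f) = sphere_cnj ` critical_values P riemann_sphere f"
proof -
  have "critical_points P riemann_sphere f \<subseteq> points P" by (auto simp: critical_points_def)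
  then have "\<tau> ` {p \<in> points P. \<tau> p \<in> critical_points P riemann_sphere f} = critical_points P riemann_sphere f"
    using \<tau>_in \<tau>\<tau> by (auto simp: image_iff) (metis subsetD)
  then have "conj_fun f ` {p \<in> points P. \<tau> p \<in> critical_points P riemann_sphere f} = sphere_cnj ` f ` critical_points P riemann_sphere f"
    unfolding conj_fun_def[abs_def] by (metis image_image)
  then show ?thesis by (simp add: critical_values_def critical_points_conj_fun)
qed

lemma critical_preimage_conj_fun:
  "critical_preimage P riemann_sphere (conj_fun f) = {p \<in> points P. \<tau> p \<in> critical_preimage P riemann_sphere f}"
  unfolding critical_preimage_def critical_values_conj_fun
  using \<tau>_in inj_image_mem_iff[OF inj_sphere_cnj] by (auto simp: conj_fun_def)

lemma sphere_map_conj_fun: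
  assumes "sphere_map P f"
  shows "sphere_map P (conj_fun f)"
proof -
  interpret sphere_map P f by fact
  show ?thesis
  proof
    show "\<not> conj_fun f constant_on points P"
    proof
      assume "conj_fun f constant_on points P"
      then obtain c where c: "\<And>p. p \<in> points P \<Longrightarrow> conj_fun f p = c" by (auto simp: constant_on_def)
      have "f p = sphere_cnj c" if "p \<in> points P" for p
        using c[OF \<tau>_in[OF that]] \<tau>\<tau>[OF that] by (auto simp: conj_fun_def)
      then show False using nonconst by (auto simp: constant_on_def)
    qed
  qed (use compact holomorphic_map_conj_fun[OF hol] in auto)
qed

text \<open>Real and pseudoreal functions are the cases where \<eta> is the identity or
  \<open>sphere_neg_recip\<close>. An automorphism applied to the values changes no ramification
  number, and it preserves the fibres.\<close>

lemma equivariant_imp_critical_divisor_invariant: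
  assumes "sphere_map P f" and \<eta>: "\<eta> \<in> sphere_aut"
    and eq: "\<And>p. p \<in> points P \<Longrightarrow> sphere_cnj (f (\<tau> p)) = \<eta> (f p)"
  shows "divisor_map \<tau> (critical_divisor P riemann_sphere f) = critical_divisor P riemann_sphere f"
proof -
  interpret sphere_map P f by fact
  have ram: "ord (\<tau> p) = ord p" if p: "p \<in> points P" for p
  proof -
    have "ord (\<tau> p) = ramification P riemann_sphere (conj_fun f) p" by (simp add: ord_def ramification_conj_fun[OF p])
    also have "\<dots> = ramification P riemann_sphere (\<eta> \<circ> f) p"
      by (rule ramification_cong[OF P complex_atlas_sphere p]) (simp add: conj_fun_def eq)
    also have "\<dots> = ord p" by (simp add: ord_def ramification_aut[OF P \<eta>])
    finally show ?thesis .
  qed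
  have imp: "\<tau> p \<in> critical_preimage P riemann_sphere f" if p: "p \<in> critical_preimage P riemann_sphere f" for p
  proof -
    obtain c where c: "c \<in> critical_points P riemann_sphere f" "f p = f c" "p \<in> points P"
      using p by (auto simp: critical_preimage_def critical_values_def)
    then have cP: "c \<in> points P" by (simp add: critical_points_def)
    have "\<tau> c \<in> critical_points P riemann_sphere f" using c(1) ram[OF cP] \<tau>_in[OF cP] by (simp add: critical_points_def ord_def)
    moreover have "f (\<tau> p) = f (\<tau> c)" using eq[OF c(3)] eq[OF cP] c(2) by (metis sphere_cnj_sphere_cnj)
    ultimately show ?thesis using \<tau>_in[OF c(3)] by (auto simp: critical_preimage_def critical_values_def)
  qed
  have "\<tau> p \<in> critical_preimage P riemann_sphere f \<longleftrightarrow> p \<in> critical_preimage P riemann_sphere f" if "p \<in> points P" for p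
    using imp[of p] imp[of "\<tau> p"] \<tau>\<tau>[OF that] by auto
  then show ?thesis using critical_divisor_invariant_iff[OF \<tau>_in \<tau>\<tau>] ram by blast
qed

text \<open>The alternative is decided by whether the involution induced on the sphere has a fixed
  point.\<close>

lemma critical_divisor_invariant_imp_equivariant:
  assumes f: "sphere_map P f"
    and div: "divisor_map \<tau> (critical_divisor P riemann_sphere f) = critical_divisor P riemann_sphere f"
  obtains g where "g \<in> sphere_aut" "real_function P \<tau> (g \<circ> f)"
  | g where "g \<in> sphere_aut" "pseudoreal_function P \<tau> (g \<circ> f)" "\<forall>p\<in>points P. \<tau> p \<noteq> p"
proof -
  let ?V = "critical_values P riemann_sphere f"
  \<comment> \<open>The normalization that \<open>fibres_constant\<close> requires: two critical
    values go to infinity and 0, and a single one goes to infinity.\<close>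
  obtain g0 where g0: "g0 \<in> sphere_aut" "g0 ` ?V \<subseteq> {None} \<or> {None, Some 0} \<subseteq> g0 ` ?V"
  proof (cases "\<exists>c\<in>?V. \<exists>d\<in>?V. c \<noteq> d")
    case True
    then obtain c d where cd: "c \<in> ?V" "d \<in> ?V" "c \<noteq> d" by blast
    obtain g where g: "g \<in> sphere_aut" "g c = None" "g d = Some 0" by (rule sphere_aut_two_points[OF cd(3)]) (rule that)
    have "{None, Some 0} \<subseteq> g ` ?V" using cd g by (auto intro: rev_image_eqI)
    then show ?thesis using that g(1) by blast
  next
    case False
    then obtain c where c: "?V \<subseteq> {c}" by blast
    obtain d :: "complex option" where "c \<noteq> d" by (cases c) blast+
    then obtain g where g: "g \<in> sphere_aut" "g c = None" "g d = Some 0" by (rule sphere_aut_two_points) (rule that)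
    have "g ` ?V \<subseteq> {None}" using c g by auto
    then show ?thesis using that g(1) by blast
  qed
  define F where "F = g0 \<circ> f"
  have SF: "sphere_map P F" unfolding F_def by (rule sphere_map_aut[OF f g0(1)])
  interpret F: sphere_map P F by (rule SF)
  interpret h: sphere_map P "conj_fun F" by (rule sphere_map_conj_fun[OF SF])
  let ?S = "critical_preimage P riemann_sphere F"
  have "divisor_map \<tau> (critical_divisor P riemann_sphere F) = critical_divisor P riemann_sphere F"
    using div unfolding F_def critical_divisor_aut[OF P g0(1)] .
  then have S: "\<tau> p \<in> ?S \<longleftrightarrow> p \<in> ?S" "p \<in> ?S \<Longrightarrow> F.ord (\<tau> p) = F.ord p" if "p \<in> points P" for p
    using F.critical_divisor_invariant_iff[OF \<tau>_in \<tau>\<tau>] that by blast+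
  interpret same_ramification P F "conj_fun F"
  proof
    show "holomorphic_map P riemann_sphere (conj_fun F)" by (rule h.hol)
    show "h.ord p = F.ord p" if p: "p \<in> points P" for p
    proof -
      have "h.ord p = F.ord (\<tau> p)" by (simp add: h.ord_def F.ord_def ramification_conj_fun[OF p])
      \<comment> \<open>The divisor gives this equality on the preimage of the critical values.
        Outside it, \<open>p\<close> and \<open>\<tau> p\<close> are both unramified, since that set
        is invariant.\<close>
      moreover have "F.ord (\<tau> p) = F.ord p"
      proof (cases "p \<in> ?S")
        case False
        then show ?thesis
          using F.critical_preimageI[OF p] F.critical_preimageI[OF \<tau>_in[OF p]] S(1)[OF p] by metis
      qed (use S(2)[OF p] in simp)
      ultimately show ?thesis by simp
    qed
    show "critical_preimage P riemann_sphere (conj_fun F) = ?S"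
      unfolding critical_preimage_conj_fun using S(1) by (auto simp: critical_preimage_def)
  qed
  have VF: "critical_values P riemann_sphere F \<subseteq> {None} \<or> {None, Some 0} \<subseteq> critical_values P riemann_sphere F"
    using g0(2) unfolding F_def critical_values_aut(1)[OF P g0(1)] .
  obtain \<psi> where \<psi>: "holomorphic_map riemann_sphere riemann_sphere \<psi>" "\<And>p. p \<in> points P \<Longrightarrow> conj_fun F p = \<psi> (F p)"
    by (rule quotient_map[OF fibres_constant[OF critical_values_conj_fun VF]]) (assumption+, rule that)
  have F\<tau>: "F (\<tau> p) = sphere_cnj (\<psi> (F p))" if "p \<in> points P" for p
    using \<psi>(2)[OF that] by (metis conj_fun_def sphere_cnj_sphere_cnj)
  \<comment> \<open>The involution property descends from \<tau> because \<open>F\<close> is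
    surjective.\<close>
  have invol: "sphere_cnj (\<psi> (sphere_cnj (\<psi> w))) = w" for w
  proof -
    obtain p where p: "p \<in> points P" "w = F p" using F.surj by blast
    show ?thesis using F\<tau>[OF p(1)] F\<tau>[OF \<tau>_in[OF p(1)]] \<tau>\<tau>[OF p(1)] p(2) by simp
  qed
  show ?thesis
  proof (cases "\<exists>c. sphere_cnj (\<psi> c) = c")
    case True
    then obtain c where c: "sphere_cnj (\<psi> c) = c" by blast
    obtain g where g: "g \<in> sphere_aut" "\<And>w. g (sphere_cnj (\<psi> w)) = sphere_cnj (g w)"
      by (rule involution_with_fixed_point[OF \<psi>(1) invol c]) (rule that)
    have "real_function P \<tau> ((g \<circ> g0) \<circ> f)" unfolding real_function_def
    proof
      fix p assume p: "p \<in> points P"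
      show "sphere_cnj (((g \<circ> g0) \<circ> f) (\<tau> p)) = ((g \<circ> g0) \<circ> f) p"
        using F\<tau>[OF p] g(2)[of "F p"] by (simp add: F_def)
    qed
    then show ?thesis using that(1) sphere_aut_compose[OF g0(1) g(1)] by blast
  next
    case False
    then have nfp: "sphere_cnj (\<psi> c) \<noteq> c" for c by blast
    obtain g where g: "g \<in> sphere_aut" "\<And>w. g (sphere_cnj (\<psi> w)) = sphere_cnj (sphere_neg_recip (g w))"
      by (rule involution_without_fixed_point[OF \<psi>(1) invol nfp]) (rule that)
    have "pseudoreal_function P \<tau> ((g \<circ> g0) \<circ> f)" unfolding pseudoreal_function_def
    proof
      fix p assume p: "p \<in> points P"
      show "sphere_cnj (((g \<circ> g0) \<circ> f) (\<tau> p)) = sphere_neg_recip (((g \<circ> g0) \<circ> f) p)"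
        using F\<tau>[OF p] g(2)[of "F p"] by (simp add: F_def)
    qed
    \<comment> \<open>A fixed point of \<tau> would make its value under \<open>F\<close> a fixed
      point of the involution on the sphere.\<close>
    moreover have "\<tau> p \<noteq> p" if "p \<in> points P" for p using F\<tau>[OF that] nfp[of "F p"] by metis
    ultimately show ?thesis using that(2) sphere_aut_compose[OF g0(1) g(1)] by blast
  qed
qed

end

theorem theorem1:
  fixes P :: "'a surface" and \<tau> :: "'a \<Rightarrow> 'a" and f :: "'a \<Rightarrow> complex option"
  assumes "compact_riemann_surface P"
    and "antiholomorphic_involution P \<tau>"
    and "holomorphic_map P riemann_sphere f"
  shows "((\<exists>p\<in>points P. \<tau> p = p) \<longrightarrow>
           ((\<exists>g\<in>automorphisms riemann_sphere. real_function P \<tau> (g \<circ> f)) \<longleftrightarrow>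
            divisor_map \<tau> (critical_divisor P riemann_sphere f)
              = critical_divisor P riemann_sphere f)) \<and>
         ((\<forall>p\<in>points P. \<tau> p \<noteq> p) \<longrightarrow>
           ((\<exists>g\<in>automorphisms riemann_sphere.
               real_function P \<tau> (g \<circ> f) \<or> pseudoreal_function P \<tau> (g \<circ> f)) \<longleftrightarrow>
            divisor_map \<tau> (critical_divisor P riemann_sphere f)
              = critical_divisor P riemann_sphere f))"
proof -
  interpret real_curve P \<tau> by standard (use assms in auto)
  let ?inv = "divisor_map \<tau> (critical_divisor P riemann_sphere f) = critical_divisor P riemann_sphere f"
  show ?thesis
  proof (cases "f constant_on points P")
    \<comment> \<open>For constant \<open>f\<close> both sides hold: the divisor is 0, and moving
      the value to infinity makes the function real.\<close>
    case True
    then obtain c where c: "\<And>p. p \<in> points P \<Longrightarrow> f p = c" by (auto simp: constant_on_def)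
    obtain d :: "complex option" where "c \<noteq> d" by (cases c) blast+
    then obtain g where g: "g \<in> sphere_aut" "g c = None" by (rule sphere_aut_two_points) (rule that)
    have "real_function P \<tau> (g \<circ> f)" using c \<tau>_in g by (simp add: real_function_def)
    moreover have ?inv using True by (simp add: critical_divisor_def divisor_map_def)
    ultimately show ?thesis using g(1) by blast
  next
    case False
    have f: "sphere_map P f" by standard (use assms False in auto)
    have 1: ?inv if g: "g \<in> sphere_aut" and "real_function P \<tau> (g \<circ> f) \<or> pseudoreal_function P \<tau> (g \<circ> f)" for g
    proof -
      have "divisor_map \<tau> (critical_divisor P riemann_sphere (g \<circ> f)) = critical_divisor P riemann_sphere (g \<circ> f)"
        using that(2)
      proof
        assume "real_function P \<tau> (g \<circ> f)"
        moreover have "(\<lambda>w. w) \<in> sphere_aut"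
          by (rule sphere_autI[OF holomorphic_map_id[OF complex_atlas_sphere] holomorphic_map_id[OF complex_atlas_sphere]]) auto
        ultimately show ?thesis
          by (intro equivariant_imp_critical_divisor_invariant[OF sphere_map_aut[OF f g], of "\<lambda>w. w"]) (auto simp: real_function_def)
      next
        assume "pseudoreal_function P \<tau> (g \<circ> f)"
        then show ?thesis
          by (intro equivariant_imp_critical_divisor_invariant[OF sphere_map_aut[OF f g] sphere_neg_recip_aut])
            (auto simp: pseudoreal_function_def)
      qed
      then show ?thesis unfolding critical_divisor_aut[OF P g] .
    qed
    have 2: "(\<exists>g\<in>sphere_aut. real_function P \<tau> (g \<circ> f)) \<or>
        (\<exists>g\<in>sphere_aut. pseudoreal_function P \<tau> (g \<circ> f)) \<and> (\<forall>p\<in>points P. \<tau> p \<noteq> p)" if inv: ?inv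
      by (rule critical_divisor_invariant_imp_equivariant[OF f inv]) blast+
    show ?thesis using 1 2 by blast
  qed
qed

end
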